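(* Let $m\ge 1$ and $n\ge 1$ be integers, let $K$ be a field, let $X=(x_{ij})$ be an $(m\times n)$-matrix of indeterminates, and let $S=K[x_{ij}: 1\le i\le m,\ 1\le j\le n]$. Let $C$ be an $m$-uniform clutter on the vertex set $[n]=\{1,\ldots,n\}$, with determinantal facet ideal $J_C\subset S$. Then the following conditions are equivalent: (a) $J_C$ has a linear resolution. (b) $J_C$ is linearly presented. (c) $C$ is a complete clutter.
   Context: $S$ is standard graded ($\deg x_{ij}=1$), and $\beta_{i,j}(I)=\dim_K\operatorname{Tor}_i^S(K,I)_j$. A graded ideal $I\subset S$ generated in degree $d$ is linearly presented if $\beta_{1,j}(I)=0$ for all $j\ne d+1$; it has a linear resolution if $\beta_{i,j}(I)=0$ for all $i$ and all $j\neq i+d$. A clutter $C$ on $[n]$ is a collection of subsets of $[n]$ (called circuits) with no containment between its elements; every vertex in $[n]$ is assumed to belong to some circuit. $C$ is $m$-uniform if all circuits have cardinality $m$. A clique of $C$ is a subset $\sigma\subseteq[n]$ such that each $m$-subset of $\sigma$ is a circuit of $C$; the clique complex $\Delta(C)$ is the simplicial complex whose faces are the cliques of $C$. $C$ is complete if $\Delta(C)$ is a simplex, i.e. $C$ consists of all $m$-subsets of its vertex set. The determinantal facet ideal $J_C\subset S$ is the ideal generated by the $m$-minors $\mathbf{m}_\tau$ of $X$, $\tau\in C$, where for $\tau=\{j_1<\cdots<j_m\}$, $\mathbf{m}_\tau$ is the minor of $X$ with columns $j_1,\ldots,j_m$. *)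

theory Defs
  imports
    "HOL-Library.Poly_Mapping"
    "HOL-Algebra.Ideal"
    "Jordan_Normal_Form.Determinant"
begin

section \<open>The polynomial ring\<close>

text \<open>
  The type allows all variables \<open>x\<^sub>i\<^sub>j\<close> with \<open>(i, j) :: nat \<times> nat\<close>; the ring
  \<open>S = K[x\<^sub>i\<^sub>j : 1 \<le> i \<le> m, 1 \<le> j \<le> n]\<close> is carved out by its carrier.
\<close>

type_synonym 'k mpol = "((nat \<times> nat) \<Rightarrow>\<^sub>0 nat) \<Rightarrow>\<^sub>0 'k"

definition poly_ring :: "nat \<Rightarrow> nat \<Rightarrow> 'k::field mpol ring" where
  "poly_ring m n =
     \<lparr>carrier = {p. \<forall>t\<in>Poly_Mapping.keys p. Poly_Mapping.keys t \<subseteq> {1..m} \<times> {1..n}},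
      monoid.mult = (*), one = 1, zero = 0, add = (+)\<rparr>"

definition var :: "nat \<Rightarrow> nat \<Rightarrow> 'k::field mpol" where
  "var i j = Poly_Mapping.single (Poly_Mapping.single (i, j) 1) 1"

definition mdeg :: "((nat \<times> nat) \<Rightarrow>\<^sub>0 nat) \<Rightarrow> nat" where
  "mdeg t = (\<Sum>v\<in>Poly_Mapping.keys t. Poly_Mapping.lookup t v)"

definition homogeneous :: "nat \<Rightarrow> 'k::field mpol \<Rightarrow> bool" where
  "homogeneous d p \<longleftrightarrow> (\<forall>t\<in>Poly_Mapping.keys p. mdeg t = d)"

definition generated_in_degree :: "nat \<Rightarrow> nat \<Rightarrow> nat \<Rightarrow> 'k::field mpol set \<Rightarrow> bool" where
  "generated_in_degree m n d I \<longleftrightarrow>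
     (\<exists>A \<subseteq> carrier (poly_ring m n). (\<forall>p\<in>A. homogeneous d p) \<and> I = Idl\<^bsub>poly_ring m n\<^esub> A)"

lemma cring_poly_ring: "cring (poly_ring m n :: 'k::field mpol ring)"
proof -
  let ?R = "poly_ring m n :: 'k mpol ring"
  let ?V = "{1..m} \<times> {1..n}"
  have mem: "p \<in> carrier ?R \<longleftrightarrow> (\<forall>t\<in>Poly_Mapping.keys p. Poly_Mapping.keys t \<subseteq> ?V)" for p
    by (simp add: poly_ring_def)
  have add: "p + q \<in> carrier ?R" if "p \<in> carrier ?R" "q \<in> carrier ?R" for p q
    using that keys_add[of p q] unfolding mem by blast
  have mult: "p * q \<in> carrier ?R" if "p \<in> carrier ?R" "q \<in> carrier ?R" for p q
    unfolding mem
  proof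
    fix t assume "t \<in> Poly_Mapping.keys (p * q)"
    then obtain a b where ab: "t = a + b" "a \<in> Poly_Mapping.keys p" "b \<in> Poly_Mapping.keys q"
      using keys_mult[of p q] by blast
    then show "Poly_Mapping.keys t \<subseteq> ?V"
      using that keys_add[of a b] unfolding mem by blast
  qed
  have zero: "0 \<in> carrier ?R" and one: "1 \<in> carrier ?R"
    unfolding mem by (auto simp: one_poly_mapping.rep_eq in_keys_iff when_def split: if_splits)
  have uminus: "- p \<in> carrier ?R" if "p \<in> carrier ?R" for p
    using that unfolding mem by (auto simp: in_keys_iff)
  have ops: "x \<oplus>\<^bsub>?R\<^esub> y = x + y" "x \<otimes>\<^bsub>?R\<^esub> y = x * y"
    "\<zero>\<^bsub>?R\<^esub> = 0" "\<one>\<^bsub>?R\<^esub> = 1" for x y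
    by (simp_all add: poly_ring_def)
  show ?thesis
  proof (rule cringI)
    show "abelian_group ?R"
    proof (rule abelian_groupI, unfold ops)
      fix p assume "p \<in> carrier ?R"
      then show "\<exists>q\<in>carrier ?R. q + p = 0"
        by (intro bexI[of _ "- p"] uminus) simp_all
    qed (fact add zero | simp add: ac_simps)+
    show "Group.comm_monoid ?R"
      by (rule comm_monoidI, unfold ops) (fact mult one | simp add: ac_simps)+
  qed (simp add: ops distrib_right)
qed


section \<open>Free modules\<close>

text \<open>
  Vectors in the free \<open>R\<close>-module on a basis \<open>B\<close> are finitely supported functions; a linear map
  between free modules is given by the images of the basis elements.
\<close>

definition scale :: "'r::comm_ring_1 \<Rightarrow> ('b \<Rightarrow>\<^sub>0 'r) \<Rightarrow> ('b \<Rightarrow>\<^sub>0 'r)" where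
  "scale c = Poly_Mapping.map ((*) c)"

definition free_module :: "'r::comm_ring_1 set \<Rightarrow> 'b set \<Rightarrow> ('b \<Rightarrow>\<^sub>0 'r) set" where
  "free_module R B = {u. Poly_Mapping.keys u \<subseteq> B \<and> (\<forall>b. Poly_Mapping.lookup u b \<in> R)}"

definition lin_ext :: "('b \<Rightarrow> ('c \<Rightarrow>\<^sub>0 'r)) \<Rightarrow> ('b \<Rightarrow>\<^sub>0 'r) \<Rightarrow> ('c \<Rightarrow>\<^sub>0 'r::comm_ring_1)" where
  "lin_ext f u = (\<Sum>b\<in>Poly_Mapping.keys u. scale (Poly_Mapping.lookup u b) (f b))"

lemma lookup_scale [simp]: "Poly_Mapping.lookup (scale c u) b = c * Poly_Mapping.lookup u b"
  by (simp add: scale_def Poly_Mapping.map.rep_eq when_def)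

lemma vector_space_scale: "vector_space (scale :: 'k::field \<Rightarrow> ('b \<Rightarrow>\<^sub>0 'k) \<Rightarrow> _)"
  by unfold_locales (auto intro!: poly_mapping_eqI simp: lookup_add algebra_simps)


section \<open>Graded free resolutions and graded Betti numbers\<close>

text \<open>
  Data of a complex \<open>\<dots> \<rightarrow> F\<^sub>1 \<rightarrow> F\<^sub>0 \<rightarrow> I\<close>: the module \<open>F\<^sub>i\<close> is free with basis \<open>gens F i\<close>, the basis
  element \<open>b\<close> having degree \<open>gdeg F i b\<close>; \<open>bd F i b \<in> F\<^sub>i\<close> is the image of the basis element
  \<open>b\<close> of \<open>F\<^bsub>i+1\<^esub>\<close>, and \<open>aug F b \<in> I\<close> is the image of the basis element \<open>b\<close> of \<open>F\<^sub>0\<close>.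
\<close>

record (overloaded) 'k free_complex =
  gens :: "nat \<Rightarrow> nat set"
  gdeg :: "nat \<Rightarrow> nat \<Rightarrow> nat"
  bd :: "nat \<Rightarrow> nat \<Rightarrow> (nat \<Rightarrow>\<^sub>0 'k mpol)"
  aug :: "nat \<Rightarrow> 'k mpol"

definition gens_deg :: "'k::field free_complex \<Rightarrow> nat \<Rightarrow> nat \<Rightarrow> nat set" where
  "gens_deg F i j = {b \<in> gens F i. gdeg F i b = j}"

definition chain_module :: "nat \<Rightarrow> nat \<Rightarrow> 'k::field free_complex \<Rightarrow> nat \<Rightarrow> (nat \<Rightarrow>\<^sub>0 'k mpol) set" where
  "chain_module m n F i = free_module (carrier (poly_ring m n)) (gens F i)"

definition aug_map :: "'k::field free_complex \<Rightarrow> (nat \<Rightarrow>\<^sub>0 'k mpol) \<Rightarrow> 'k mpol" where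
  "aug_map F u = (\<Sum>b\<in>Poly_Mapping.keys u. Poly_Mapping.lookup u b * aug F b)"

text \<open>
  The modules \<open>F\<^sub>i\<close> need not be finitely generated, but may only have finitely many generators in
  each degree. Every graded ideal of \<open>S\<close> has such a resolution.
\<close>

definition graded_free_resolution ::
    "nat \<Rightarrow> nat \<Rightarrow> 'k::field mpol set \<Rightarrow> 'k free_complex \<Rightarrow> bool" where
  "graded_free_resolution m n I F \<longleftrightarrow>
     (\<forall>i j. finite (gens_deg F i j)) \<and>
     (\<forall>b\<in>gens F 0. aug F b \<in> I \<and> homogeneous (gdeg F 0 b) (aug F b)) \<and>
     (\<forall>i. \<forall>b\<in>gens F (Suc i). bd F i b \<in> chain_module m n F i \<and>
        (\<forall>c\<in>gens F i. \<forall>t\<in>Poly_Mapping.keys (Poly_Mapping.lookup (bd F i b) c).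
           mdeg t + gdeg F i c = gdeg F (Suc i) b)) \<and>
     aug_map F ` chain_module m n F 0 = I \<and>
     lin_ext (bd F 0) ` chain_module m n F 1 = {u \<in> chain_module m n F 0. aug_map F u = 0} \<and>
     (\<forall>i. lin_ext (bd F (Suc i)) ` chain_module m n F (Suc (Suc i)) =
        {u \<in> chain_module m n F (Suc i). lin_ext (bd F i) u = 0})"

text \<open>
  In \<open>K \<otimes>\<^sub>S F\<close>, where \<open>K = S / (x\<^sub>i\<^sub>j)\<close> sits in degree \<open>0\<close>, the degree \<open>j\<close> part of
  \<open>K \<otimes>\<^sub>S F\<^sub>i\<close> is the \<open>K\<close>-vector space on the degree \<open>j\<close> basis elements of \<open>F\<^sub>i\<close>, and the
  entries of the differentials are replaced by their constant coefficients.
\<close>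

definition tensor_bd :: "'k::field free_complex \<Rightarrow> nat \<Rightarrow> nat \<Rightarrow> (nat \<Rightarrow>\<^sub>0 'k)" where
  "tensor_bd F i b = Poly_Mapping.map (\<lambda>p. Poly_Mapping.lookup p 0) (bd F i b)"

definition tensor_part :: "'k::field free_complex \<Rightarrow> nat \<Rightarrow> nat \<Rightarrow> (nat \<Rightarrow>\<^sub>0 'k) set" where
  "tensor_part F i j = free_module UNIV (gens_deg F i j)"

fun tensor_cycles :: "'k::field free_complex \<Rightarrow> nat \<Rightarrow> nat \<Rightarrow> (nat \<Rightarrow>\<^sub>0 'k) set" where
  "tensor_cycles F 0 j = tensor_part F 0 j"
| "tensor_cycles F (Suc i) j = {u \<in> tensor_part F (Suc i) j. lin_ext (tensor_bd F i) u = 0}"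

definition tensor_boundaries :: "'k::field free_complex \<Rightarrow> nat \<Rightarrow> nat \<Rightarrow> (nat \<Rightarrow>\<^sub>0 'k) set" where
  "tensor_boundaries F i j = lin_ext (tensor_bd F i) ` tensor_part F (Suc i) j"

text \<open>
  \<open>\<beta>\<^sub>i\<^sub>j(I) = dim\<^sub>K Tor\<^sub>i\<^sup>S(K, I)\<^sub>j\<close>, where \<open>Tor\<^sub>i\<^sup>S(K, I) = H\<^sub>i(K \<otimes>\<^sub>S F)\<close> for a graded free resolution
  \<open>F\<close> of \<open>I\<close>; as usual, the choice of \<open>F\<close> is immaterial. The dimension of the quotient
  cycles / boundaries is a difference, since both spaces are finite-dimensional.
\<close>

definition tor_dim :: "'k::field free_complex \<Rightarrow> nat \<Rightarrow> nat \<Rightarrow> nat" where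
  "tor_dim F i j =
     vector_space.dim scale (tensor_cycles F i j) -
     vector_space.dim scale (tensor_boundaries F i j)"

definition betti :: "nat \<Rightarrow> nat \<Rightarrow> 'k::field mpol set \<Rightarrow> nat \<Rightarrow> nat \<Rightarrow> nat" where
  "betti m n I i j = tor_dim (SOME F. graded_free_resolution m n I F) i j"

definition linearly_presented :: "nat \<Rightarrow> nat \<Rightarrow> 'k::field mpol set \<Rightarrow> bool" where
  "linearly_presented m n I \<longleftrightarrow>
     (\<exists>d. generated_in_degree m n d I \<and> (\<forall>j. j \<noteq> d + 1 \<longrightarrow> betti m n I 1 j = 0))"

definition has_linear_resolution :: "nat \<Rightarrow> nat \<Rightarrow> 'k::field mpol set \<Rightarrow> bool" where
  "has_linear_resolution m n I \<longleftrightarrow>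
     (\<exists>d. generated_in_degree m n d I \<and> (\<forall>i j. j \<noteq> i + d \<longrightarrow> betti m n I i j = 0))"


section \<open>Clutters and determinantal facet ideals\<close>

definition clutter :: "nat \<Rightarrow> nat set set \<Rightarrow> bool" where
  "clutter n C \<longleftrightarrow>
     C \<subseteq> Pow {1..n} \<and> (\<forall>\<sigma>\<in>C. \<forall>\<tau>\<in>C. \<sigma> \<subseteq> \<tau> \<longrightarrow> \<sigma> = \<tau>) \<and> (\<forall>v\<in>{1..n}. \<exists>\<tau>\<in>C. v \<in> \<tau>)"

definition uniform :: "nat \<Rightarrow> nat set set \<Rightarrow> bool" where
  "uniform m C \<longleftrightarrow> (\<forall>\<tau>\<in>C. card \<tau> = m)"

definition clique :: "nat \<Rightarrow> nat \<Rightarrow> nat set set \<Rightarrow> nat set \<Rightarrow> bool" where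
  "clique m n C \<sigma> \<longleftrightarrow> \<sigma> \<subseteq> {1..n} \<and> (\<forall>\<tau>. \<tau> \<subseteq> \<sigma> \<and> card \<tau> = m \<longrightarrow> \<tau> \<in> C)"

definition clique_complex :: "nat \<Rightarrow> nat \<Rightarrow> nat set set \<Rightarrow> nat set set" where
  "clique_complex m n C = {\<sigma>. clique m n C \<sigma>}"

definition is_simplex :: "nat set set \<Rightarrow> bool" where
  "is_simplex \<Delta> \<longleftrightarrow> (\<exists>\<sigma>. \<Delta> = Pow \<sigma>)"

definition complete_clutter :: "nat \<Rightarrow> nat \<Rightarrow> nat set set \<Rightarrow> bool" where
  "complete_clutter m n C \<longleftrightarrow> is_simplex (clique_complex m n C)"

lemma complete_clutter_iff:
  assumes "m \<ge> 1" "clutter n C" "uniform m C"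
  shows "complete_clutter m n C \<longleftrightarrow> C = {\<tau>. \<tau> \<subseteq> {1..n} \<and> card \<tau> = m}"
proof
  assume "C = {\<tau>. \<tau> \<subseteq> {1..n} \<and> card \<tau> = m}"
  then have "clique_complex m n C = Pow {1..n}"
    unfolding clique_complex_def clique_def by blast
  then show "complete_clutter m n C"
    unfolding complete_clutter_def is_simplex_def by blast
next
  assume "complete_clutter m n C"
  then obtain \<sigma> where \<sigma>: "clique_complex m n C = Pow \<sigma>"
    unfolding complete_clutter_def is_simplex_def by blast
  have circ: "\<tau> \<in> clique_complex m n C" if "\<tau> \<in> C" for \<tau>
  proof -
    have \<tau>: "\<tau> \<subseteq> {1..n}" "card \<tau> = m"
      using that assms unfolding clutter_def uniform_def by blast+
    have fin: "finite \<tau>"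
      by (rule finite_subset[OF \<tau>(1)]) simp
    have "\<rho> = \<tau>" if "\<rho> \<subseteq> \<tau>" "card \<rho> = m" for \<rho>
      by (rule card_subset_eq[OF fin that(1)]) (simp only: that(2) \<tau>(2))
    then show ?thesis
      using \<tau> \<open>\<tau> \<in> C\<close> unfolding clique_complex_def clique_def by blast
  qed
  have "{1..n} \<subseteq> \<sigma>"
  proof
    fix v assume "v \<in> {1..n}"
    then obtain \<tau> where "\<tau> \<in> C" "v \<in> \<tau>"
      using assms(2) unfolding clutter_def by blast
    then show "v \<in> \<sigma>"
      using circ[of \<tau>] \<sigma> by (simp only: Pow_iff subset_iff)
  qed
  then have "{1..n} \<in> clique_complex m n C"
    unfolding \<sigma> by (rule PowI)
  then have "clique m n C {1..n}"
    unfolding clique_complex_def by (rule CollectD)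
  then have 1: "\<tau> \<in> C" if "\<tau> \<subseteq> {1..n}" "card \<tau> = m" for \<tau>
    using that unfolding clique_def by metis
  have 2: "\<tau> \<subseteq> {1..n}" "card \<tau> = m" if "\<tau> \<in> C" for \<tau>
    using that assms(2,3) unfolding clutter_def uniform_def by (meson PowD subsetD)+
  show "C = {\<tau>. \<tau> \<subseteq> {1..n} \<and> card \<tau> = m}"
    by (rule Set.set_eqI, rule iffI) (intro CollectI conjI 2, assumption+, elim CollectE conjE, rule 1)
qed

text \<open>Matrix indices start at \<open>0\<close>; column \<open>k\<close> is the one of the \<open>(k+1)\<close>-st smallest element of \<open>\<tau>\<close>.\<close>

definition maximal_minor :: "nat \<Rightarrow> nat set \<Rightarrow> 'k::field mpol" where
  "maximal_minor m \<tau> = det (mat m m (\<lambda>(i, k). var (Suc i) (sorted_list_of_set \<tau> ! k)))"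

definition det_facet_ideal :: "nat \<Rightarrow> nat \<Rightarrow> nat set set \<Rightarrow> 'k::field mpol set" where
  "det_facet_ideal m n C = Idl\<^bsub>poly_ring m n\<^esub> (maximal_minor m ` C)"

end

theory Submission
  imports Defs "HOL-Library.Nat_Bijection"
begin

text \<open>
  A linear resolution is in particular a linear presentation. The other two implications are independent of each other.

  \<^bold>\<open>Completeness gives a linear resolution.\<close> If all \<open>m\<close>-subsets are circuits, \<open>J\<close> is the ideal of all
  maximal minors of a generic matrix, and it is resolved by the Eagon-Northcott complex, whose \<open>i\<close>-th module is
  generated in degree \<open>i + m\<close>. Acyclicity is shown by an explicit matching (\<open>en_acyclic\<close>). The complex is a complex of
  vector spaces, with terms (monomial times basis element) as bases. With respect to the weight
  \<open>i * j\<close> of the variable \<open>x\<^sub>i\<^sub>j\<close>, which behaves like a diagonal term order, the leading part of the boundary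
  map removes elements from the blocks of a staircase-shaped set of matrix positions, as in the resolution of the ideal of
  leading monomials by products of simplices. There the terms are paired by moving a leftmost possible position between
  the staircase and the monomial. Since a term is always paired with the leading term of its boundary, the pairing proves
  exactness of the full complex (\<open>exact_of_leading_terms\<close>). Betti numbers are defined through an
  arbitrary resolution; comparing it with the linear complex up to homotopy shows that all Betti numbers
  outside the linear strand vanish (\<open>tor_dim_zero_of_linear_complex\<close>).

  \<^bold>\<open>Linear presentation gives completeness.\<close> Linear presentation means that the syzygies of the minors \<open>m\<^sub>\<sigma>\<close>, \<open>\<sigma> \<in> C\<close>,
  are generated by linear ones. Comparing coefficients shows that a variable \<open>x\<^sub>i\<^sub>k\<close> can occur in the coefficient
  at \<open>\<sigma>\<close> of a linear syzygy only if \<open>k \<notin> \<sigma>\<close> and \<open>\<sigma> \<union> {k}\<close> is a clique (\<open>linear_syzygy_good\<close>). So for every syzygy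
  the coefficient at \<open>\<sigma>\<close> lies in the ideal generated by such variables (\<open>syzygy_good\<close>). For the Koszul syzygy of \<open>\<sigma>\<close> and another circuit \<open>\<tau>\<close>
  this coefficient is \<open>m\<^sub>\<tau>\<close>, whose monomials only use columns in \<open>\<tau>\<close>. Hence \<open>\<tau>\<close> contains some \<open>k \<notin> \<sigma>\<close> for which \<open>\<sigma> \<union> {k}\<close> is a clique
  (\<open>good_vertex_towards\<close>), and an exchange argument with a maximal clique shows that the whole vertex set is a clique
  (\<open>all_subsets_circuits\<close>).

  To speak of the Betti numbers at all, one needs that every determinantal facet ideal has a graded free
  resolution (\<open>exists_graded_free_resolution\<close>).
\<close>


section \<open>Polynomials and graded pieces of free modules\<close>

abbreviation coef :: "('a \<Rightarrow>\<^sub>0 'b::zero) \<Rightarrow> 'a \<Rightarrow> 'b" where "coef \<equiv> Poly_Mapping.lookup"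
abbreviation supp :: "('a \<Rightarrow>\<^sub>0 'b::zero) \<Rightarrow> 'a set" where "supp \<equiv> Poly_Mapping.keys"
abbreviation single :: "'a \<Rightarrow> 'b \<Rightarrow> ('a \<Rightarrow>\<^sub>0 'b::zero)" where "single \<equiv> Poly_Mapping.single"
type_synonym monom = "(nat \<times> nat) \<Rightarrow>\<^sub>0 nat"

abbreviation polys :: "nat \<Rightarrow> nat \<Rightarrow> 'k::field mpol set" where "polys m n \<equiv> carrier (poly_ring m n)"

lemma poly_mapping_sum_singles: "(\<Sum>a\<in>supp p. single a (coef p a)) = p"
proof (rule poly_mapping_eqI)
  fix a
  have "coef (\<Sum>a\<in>supp p. single a (coef p a)) a = (\<Sum>b\<in>supp p. if b = a then coef p b else 0)"
    by (auto simp: lookup_sum lookup_single when_def intro!: sum.cong)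
  also have "\<dots> = coef p a"
    by (simp add: in_keys_iff)
  finally show "coef (\<Sum>a\<in>supp p. single a (coef p a)) a = coef p a" .
qed

lemma coef_mult:
  fixes p q :: "('a::monoid_add) \<Rightarrow>\<^sub>0 ('b::semiring_0)"
  shows "coef (p * q) t = (\<Sum>a\<in>supp p. \<Sum>b\<in>supp q. coef p a * coef q b when a + b = t)"
proof -
  have "p * q = (\<Sum>a\<in>supp p. single a (coef p a)) * (\<Sum>b\<in>supp q. single b (coef q b))"
    by (simp only: poly_mapping_sum_singles)
  also have "\<dots> = (\<Sum>a\<in>supp p. \<Sum>b\<in>supp q. single (a + b) (coef p a * coef q b))"
    by (simp add: sum_product mult_single)
  finally show ?thesis
    by (simp add: lookup_sum lookup_single)
qed

lemma coef_single_mult_add: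
  fixes q :: "('a::cancel_comm_monoid_add) \<Rightarrow>\<^sub>0 ('b::semiring_0)"
  shows "coef (single s c * q) (s + t) = c * coef q t"
proof (cases "c = 0")
  case False
  then have "coef (single s c * q) (s + t) = (\<Sum>b\<in>supp q. if b = t then c * coef q b else 0)"
    by (auto simp: coef_mult when_def intro!: sum.cong)
  also have "\<dots> = c * coef q t"
    by (simp add: in_keys_iff)
  finally show ?thesis .
qed simp

lemma supp_single_mult:
  fixes q :: "('a::cancel_comm_monoid_add) \<Rightarrow>\<^sub>0 ('b::semiring_0)"
  shows "supp (single s c * q) \<subseteq> (+) s ` supp q"
  using keys_mult[of "single s c" q] by (auto split: if_splits)

lemma coef_mult_zero:
  fixes p q :: "('a \<Rightarrow>\<^sub>0 nat) \<Rightarrow>\<^sub>0 ('b::semiring_0)"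
  shows "coef (p * q) 0 = coef p 0 * coef q 0"
proof -
  have add0: "a + b = 0 \<longleftrightarrow> a = 0 \<and> b = 0" for a b :: "'a \<Rightarrow>\<^sub>0 nat"
    by (auto simp: poly_mapping_eq_iff fun_eq_iff lookup_add)
  have "coef (p * q) 0 =
      (\<Sum>a\<in>supp p. if a = 0 then (\<Sum>b\<in>supp q. if b = 0 then coef p a * coef q b else 0) else 0)"
    unfolding coef_mult add0 by (intro sum.cong refl) (auto simp: when_def intro!: sum.neutral)
  also have "\<dots> = coef p 0 * coef q 0"
    by (auto simp: in_keys_iff)
  finally show ?thesis .
qed

lemma mdeg_superset: "finite A \<Longrightarrow> supp t \<subseteq> A \<Longrightarrow> mdeg t = (\<Sum>v\<in>A. coef t v)"
  unfolding mdeg_def by (rule sum.mono_neutral_left) (auto simp: in_keys_iff)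

lemma mdeg_zero [simp]: "mdeg 0 = 0"
  by (simp add: mdeg_def)

lemma mdeg_add [simp]: "mdeg (s + t) = mdeg s + mdeg t"
proof -
  have "mdeg (s + t) = (\<Sum>v\<in>supp s \<union> supp t. coef (s + t) v)"
    by (rule mdeg_superset) (simp_all add: keys_add)
  also have "\<dots> = mdeg s + mdeg t"
    by (simp add: lookup_add sum.distrib mdeg_superset[of "supp s \<union> supp t"])
  finally show ?thesis .
qed

lemma mdeg_single [simp]: "mdeg (single v k) = k"
  by (simp add: mdeg_def)

lemma mdeg_eq_0_iff: "mdeg t = 0 \<longleftrightarrow> t = 0"
proof
  assume "mdeg t = 0"
  then have "\<forall>v\<in>supp t. coef t v = 0"
    by (simp add: mdeg_def)
  then show "t = 0"
    by (auto simp: in_keys_iff intro!: poly_mapping_eqI)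
qed simp

lemma in_polys_iff: "p \<in> polys m n \<longleftrightarrow> (\<forall>t\<in>supp p. supp t \<subseteq> {1..m} \<times> {1..n})"
  by (simp add: poly_ring_def)

lemma polys_add: "p \<in> polys m n \<Longrightarrow> q \<in> polys m n \<Longrightarrow> p + q \<in> polys m n"
  using keys_add[of p q] unfolding in_polys_iff by blast

lemma polys_mult: "p \<in> polys m n \<Longrightarrow> q \<in> polys m n \<Longrightarrow> p * q \<in> polys m n"
  using cring_poly_ring[of m n, THEN cring.axioms(1), THEN ring.ring_simprules(5), of p q]
  by (simp add: poly_ring_def)

lemma polys_zero [simp]: "0 \<in> polys m n"
  by (simp add: in_polys_iff)

lemma polys_single: "supp t \<subseteq> {1..m} \<times> {1..n} \<Longrightarrow> single t c \<in> polys m n"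
  by (auto simp: in_polys_iff)

lemma polys_const [simp]: "single 0 c \<in> polys m n"
  by (simp add: in_polys_iff)

lemma polys_one [simp]: "1 \<in> polys m n"
  using polys_const[of 1] by simp

lemma polys_uminus: "p \<in> polys m n \<Longrightarrow> - p \<in> polys m n"
  by (simp add: in_polys_iff)

lemma polys_sum: "(\<And>x. x \<in> A \<Longrightarrow> f x \<in> polys m n) \<Longrightarrow> sum f A \<in> polys m n"
  by (induction A rule: infinite_finite_induct) (auto intro: polys_add)

lemma scale_zero [simp]: "scale c 0 = 0" "scale 0 u = 0"
  by (auto intro!: poly_mapping_eqI)

lemma scale_one [simp]: "scale 1 u = u"
  by (auto intro!: poly_mapping_eqI)

lemma scale_scale [simp]: "scale c (scale d u) = scale (c * d) u"
  by (auto intro!: poly_mapping_eqI simp: mult.assoc)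

lemma scale_add_right: "scale c (u + v) = scale c u + scale c v"
  by (auto intro!: poly_mapping_eqI simp: lookup_add algebra_simps)

lemma scale_diff_right: "scale c (u - v) = scale c u - scale c v"
  by (rule poly_mapping_eqI) (simp add: lookup_minus algebra_simps)

lemma scale_add_left: "scale (c + d) u = scale c u + scale d u"
  by (auto intro!: poly_mapping_eqI simp: lookup_add algebra_simps)

lemma scale_sum_right: "scale c (sum f A) = (\<Sum>x\<in>A. scale c (f x))"
  by (induction A rule: infinite_finite_induct) (auto simp: scale_add_right)

lemma scale_single [simp]: "scale c (single b d) = single b (c * d)"
  by (auto intro!: poly_mapping_eqI simp: lookup_single when_def)

lemma lin_ext_superset:
  "finite A \<Longrightarrow> supp u \<subseteq> A \<Longrightarrow> lin_ext f u = (\<Sum>b\<in>A. scale (coef u b) (f b))"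
  unfolding lin_ext_def by (rule sum.mono_neutral_left) (auto simp: in_keys_iff)

lemma lin_ext_zero [simp]: "lin_ext f 0 = 0"
  by (simp add: lin_ext_def)

lemma lin_ext_single [simp]: "lin_ext f (single b c) = scale c (f b)"
  using lin_ext_superset[of "{b}" "single b c" f] by simp

lemma lin_ext_add: "lin_ext f (u + v) = lin_ext f u + lin_ext f v"
proof -
  have "lin_ext f (u + v) = (\<Sum>b\<in>supp u \<union> supp v. scale (coef (u + v) b) (f b))"
    by (rule lin_ext_superset) (simp_all add: keys_add)
  also have "\<dots> = lin_ext f u + lin_ext f v"
    by (simp add: lookup_add scale_add_left sum.distrib lin_ext_superset[of "supp u \<union> supp v"])
  finally show ?thesis .
qed

lemma lin_ext_scale: "lin_ext f (scale c u) = scale c (lin_ext f u)"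
proof -
  have "lin_ext f (scale c u) = (\<Sum>b\<in>supp u. scale (coef (scale c u) b) (f b))"
    by (rule lin_ext_superset) (auto simp: in_keys_iff)
  also have "\<dots> = scale c (lin_ext f u)"
    by (simp add: lin_ext_def scale_sum_right)
  finally show ?thesis .
qed

lemma lin_ext_uminus: "lin_ext f (- u) = - lin_ext f u"
  using lin_ext_add[of f "- u" u] by (simp add: eq_neg_iff_add_eq_0)

lemma lin_ext_diff: "lin_ext f (u - v) = lin_ext f u - lin_ext f v"
  using lin_ext_add[of f u "- v"] by (simp add: lin_ext_uminus)

lemma lin_ext_sum: "lin_ext f (sum g A) = (\<Sum>x\<in>A. lin_ext f (g x))"
  by (induction A rule: infinite_finite_induct) (auto simp: lin_ext_add)

lemma lin_ext_cong: "(\<And>b. b \<in> supp u \<Longrightarrow> f b = g b) \<Longrightarrow> lin_ext f u = lin_ext g u"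
  by (auto simp: lin_ext_def intro!: sum.cong)

lemma lin_ext_lin_ext: "lin_ext f (lin_ext g u) = lin_ext (\<lambda>b. lin_ext f (g b)) u"
  unfolding lin_ext_def[of g] lin_ext_def[of "\<lambda>b. lin_ext f (g b)"]
  by (simp add: lin_ext_sum lin_ext_scale)

lemma lin_ext_add_fun: "lin_ext (\<lambda>b. f b + g b) u = lin_ext f u + lin_ext g u"
  by (simp add: lin_ext_def scale_add_right sum.distrib)

lemma single_sum: "single c (sum f A) = (\<Sum>x\<in>A. single c (f x))"
  by (induction A rule: infinite_finite_induct) (auto simp: single_add)

lemma lin_ext_single_fun: "lin_ext (\<lambda>b. single c (f b)) u = single c (\<Sum>b\<in>supp u. coef u b * f b)"
  by (simp add: lin_ext_def single_sum)

lemma lin_ext_diff_fun: "lin_ext (\<lambda>b. f b - g b) u = lin_ext f u - lin_ext g u"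
  by (simp add: lin_ext_def scale_diff_right sum_subtractf)

lemma lin_ext_zero_fun: "(\<And>b. b \<in> supp u \<Longrightarrow> f b = 0) \<Longrightarrow> lin_ext f u = 0"
  by (simp add: lin_ext_def)

lemma lin_ext_basis [simp]: "lin_ext (\<lambda>b. single b 1) u = u"
  by (simp add: lin_ext_def poly_mapping_sum_singles)

text \<open>
  A basis element \<open>b\<close> sits in degree \<open>g b\<close>. A set of degrees, rather than a single one, lets the
  same closure lemmas serve for graded pieces, for the whole module and for the complement of a degree.
\<close>

definition gpart ::
    "nat \<Rightarrow> nat \<Rightarrow> 'b set \<Rightarrow> ('b \<Rightarrow> nat) \<Rightarrow> nat set \<Rightarrow> ('b \<Rightarrow>\<^sub>0 'k::field mpol) set" where
  "gpart m n B g D = {u \<in> free_module (polys m n) B. \<forall>b. \<forall>t\<in>supp (coef u b). mdeg t + g b \<in> D}"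

lemma free_module_eq_gpart: "free_module (polys m n) B = gpart m n B g UNIV"
  by (simp add: gpart_def)

lemma gpartI:
  assumes "\<And>b. b \<in> supp u \<Longrightarrow> b \<in> B"
    and "\<And>b t. t \<in> supp (coef u b) \<Longrightarrow> supp t \<subseteq> {1..m} \<times> {1..n}"
    and "\<And>b t. t \<in> supp (coef u b) \<Longrightarrow> mdeg t + g b \<in> D"
  shows "u \<in> gpart m n B g D"
  using assms by (auto simp: gpart_def free_module_def in_polys_iff)

lemma gpartD:
  assumes "u \<in> gpart m n B g D"
  shows "b \<in> supp u \<Longrightarrow> b \<in> B" "coef u b \<in> polys m n"
    and "t \<in> supp (coef u b) \<Longrightarrow> supp t \<subseteq> {1..m} \<times> {1..n}"
    and "t \<in> supp (coef u b) \<Longrightarrow> mdeg t + g b \<in> D"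
  using assms by (auto simp: gpart_def free_module_def in_polys_iff)

lemma gpart_mono: "u \<in> gpart m n B g D \<Longrightarrow> D \<subseteq> D' \<Longrightarrow> u \<in> gpart m n B g D'"
  by (auto simp: gpart_def)

lemma gpart_UNIV: "u \<in> gpart m n B g D \<Longrightarrow> u \<in> gpart m n B g UNIV"
  by (rule gpart_mono) auto

lemma gpart_zero [simp]: "0 \<in> gpart m n B g D"
  by (simp add: gpart_def free_module_def)

lemma gpart_add: "u \<in> gpart m n B g D \<Longrightarrow> v \<in> gpart m n B g D \<Longrightarrow> u + v \<in> gpart m n B g D"
  unfolding gpart_def free_module_def mem_Collect_eq lookup_add
  using keys_add[of u v] keys_add[of "coef u b" "coef v b" for b]
  by (blast intro: polys_add)

lemma gpart_uminus: "u \<in> gpart m n B g D \<Longrightarrow> - u \<in> gpart m n B g D"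
  by (auto simp: gpart_def free_module_def polys_uminus)

lemma gpart_diff: "u \<in> gpart m n B g D \<Longrightarrow> v \<in> gpart m n B g D \<Longrightarrow> u - v \<in> gpart m n B g D"
  using gpart_add[OF _ gpart_uminus[of v]] by simp

lemma gpart_sum: "(\<And>x. x \<in> A \<Longrightarrow> f x \<in> gpart m n B g D) \<Longrightarrow> sum f A \<in> gpart m n B g D"
  by (induction A rule: infinite_finite_induct) (auto intro: gpart_add)

lemma gpart_scale:
  assumes "u \<in> gpart m n B g D" "p \<in> polys m n"
    and "\<And>s t b. s \<in> supp p \<Longrightarrow> t \<in> D \<Longrightarrow> mdeg s + t \<in> D'"
  shows "scale p u \<in> gpart m n B g D'"
proof (rule gpartI)
  show "b \<in> B" if "b \<in> supp (scale p u)" for b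
    using that gpartD(1)[OF assms(1), of b] by (cases "coef u b = 0") (auto simp: in_keys_iff)
  fix b t assume t: "t \<in> supp (coef (scale p u) b)"
  then obtain s r where sr: "t = s + r" "s \<in> supp p" "r \<in> supp (coef u b)"
    using keys_mult[of p "coef u b"] by auto
  show "supp t \<subseteq> {1..m} \<times> {1..n}"
    using polys_mult[OF assms(2) gpartD(2)[OF assms(1)], of b] t by (simp add: in_polys_iff)
  show "mdeg t + g b \<in> D'"
    using assms(3)[OF sr(2) gpartD(4)[OF assms(1) sr(3)]] by (simp add: sr(1) add.assoc)
qed

lemma gpart_scale_UNIV:
  "u \<in> gpart m n B g UNIV \<Longrightarrow> p \<in> polys m n \<Longrightarrow> scale p u \<in> gpart m n B g UNIV"
  by (erule gpart_scale) auto

lemma gpart_scale_const: "u \<in> gpart m n B g D \<Longrightarrow> scale (single 0 c) u \<in> gpart m n B g D"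
  by (erule gpart_scale) (auto split: if_splits)

lemma gpart_single:
  assumes "b \<in> B" "p \<in> polys m n" "\<And>t. t \<in> supp p \<Longrightarrow> mdeg t + g b \<in> D"
  shows "single b p \<in> gpart m n B g D"
  using assms by (auto simp: gpart_def free_module_def lookup_single when_def)

lemma gpart_basis: "b \<in> B \<Longrightarrow> g b = j \<Longrightarrow> single b 1 \<in> gpart m n B g {j}"
  by (rule gpart_single) auto

lemma gpart_lin_ext:
  assumes "u \<in> gpart m n B g D" and "\<And>b. b \<in> B \<Longrightarrow> f b \<in> gpart m n C h {g b}"
  shows "lin_ext f u \<in> gpart m n C h D"
  unfolding lin_ext_def
proof (rule gpart_sum)
  fix b assume b: "b \<in> supp u"
  show "scale (coef u b) (f b) \<in> gpart m n C h D"
    using assms(2)[OF gpartD(1)[OF assms(1) b]]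
    by (rule gpart_scale) (auto intro: gpartD[OF assms(1)])
qed

lemma gpart_disjoint: "u \<in> gpart m n B g D \<Longrightarrow> u \<in> gpart m n B g D' \<Longrightarrow> D \<inter> D' = {} \<Longrightarrow> u = 0"
proof (rule poly_mapping_eqI, rule poly_mapping_eqI)
  fix b t assume u: "u \<in> gpart m n B g D" "u \<in> gpart m n B g D'" "D \<inter> D' = {}"
  have "t \<notin> supp (coef u b)"
    using gpartD(4)[OF u(1), of t b] gpartD(4)[OF u(2), of t b] u(3) by blast
  then show "coef (coef u b) t = coef (coef 0 b) t"
    by (simp add: in_keys_iff)
qed

definition degree_filter :: "('b \<Rightarrow> nat) \<Rightarrow> nat set \<Rightarrow> ('b \<Rightarrow>\<^sub>0 'k::field mpol) \<Rightarrow> ('b \<Rightarrow>\<^sub>0 'k mpol)" where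
  "degree_filter g D u =
     Poly_Mapping.mapp (\<lambda>b. Poly_Mapping.mapp (\<lambda>t c. c when mdeg t + g b \<in> D)) u"

lemma coef_degree_filter:
  "coef (coef (degree_filter g D u) b) t = (coef (coef u b) t when mdeg t + g b \<in> D)"
  by (auto simp: degree_filter_def lookup_mapp when_def in_keys_iff)

lemma degree_filter_split: "degree_filter g D u + degree_filter g (- D) u = u"
  by (rule poly_mapping_eqI, rule poly_mapping_eqI)
    (auto simp: coef_degree_filter lookup_add when_def)

lemma gpart_degree_filter:
  assumes "u \<in> gpart m n B g D"
  shows "degree_filter g D' u \<in> gpart m n B g (D \<inter> D')"
proof (rule gpartI)
  show "b \<in> B" if "b \<in> supp (degree_filter g D' u)" for b
    using that gpartD(1)[OF assms, of b] keys_mapp_subset[of _ u] unfolding degree_filter_def by blast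
  fix b t assume "t \<in> supp (coef (degree_filter g D' u) b)"
  then have "t \<in> supp (coef u b)" "mdeg t + g b \<in> D'"
    by (auto simp: in_keys_iff coef_degree_filter)
  then show "supp t \<subseteq> {1..m} \<times> {1..n}" "mdeg t + g b \<in> D \<inter> D'"
    using gpartD(3,4)[OF assms] by blast+
qed

lemma degree_filter_lin_ext:
  assumes "u \<in> gpart m n B g UNIV" and "\<And>b. b \<in> B \<Longrightarrow> f b \<in> gpart m n C h {g b}"
  shows "lin_ext f (degree_filter g D u) = degree_filter h D (lin_ext f u)"
proof -
  let ?u = "degree_filter g D u" and ?v = "degree_filter g (- D) u"
  let ?x = "degree_filter h D (lin_ext f u)" and ?y = "degree_filter h (- D) (lin_ext f u)"
  have uv: "lin_ext f ?u \<in> gpart m n C h D" "lin_ext f ?v \<in> gpart m n C h (- D)"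
    using gpart_degree_filter[OF assms(1)] assms(2) by (auto intro!: gpart_lin_ext)
  have xy: "?x \<in> gpart m n C h D" "?y \<in> gpart m n C h (- D)"
    using gpart_degree_filter[OF gpart_lin_ext[OF assms]] by auto
  have "lin_ext f ?u + lin_ext f ?v = ?x + ?y"
    by (simp only: lin_ext_add[symmetric] degree_filter_split)
  then have "lin_ext f ?u - ?x = ?y - lin_ext f ?v"
    by (simp add: algebra_simps)
  then have "lin_ext f ?u - ?x = 0"
    using gpart_disjoint[of "lin_ext f ?u - ?x" m n C h D "- D"] uv xy
    by (auto intro: gpart_diff) (metis gpart_diff)
  then show ?thesis by simp
qed

text \<open>
  Exactness of a resolution speaks about arbitrary vectors, whereas comparison maps have to preserve
  degrees. The gap is closed by discarding all components of a preimage outside the degree in question: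
  their images lie in other degrees, hence cancel.
\<close>

lemma homogeneous_preimage:
  assumes "lin_ext f w = u" "u \<in> gpart m n C h {j}" "w \<in> gpart m n B g UNIV"
    and "\<And>b. b \<in> B \<Longrightarrow> f b \<in> gpart m n C h {g b}"
  shows "\<exists>w'\<in>gpart m n B g {j}. lin_ext f w' = u"
proof
  show "degree_filter g {j} w \<in> gpart m n B g {j}"
    using gpart_degree_filter[OF assms(3), of "{j}"] by simp
  have "degree_filter h (- {j}) u \<in> gpart m n C h ({j} \<inter> - {j})"
    using assms(2) by (rule gpart_degree_filter)
  then have "degree_filter h (- {j}) u = 0"
    using gpart_disjoint by fastforce
  then show "lin_ext f (degree_filter g {j} w) = u"
    using degree_filter_lin_ext[OF assms(3,4)] degree_filter_split[of h "{j}" u] assms(1) by simp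
qed

subsection \<open>Reduction modulo the variables\<close>

definition const_part :: "('b \<Rightarrow>\<^sub>0 'k::field mpol) \<Rightarrow> ('b \<Rightarrow>\<^sub>0 'k)" where
  "const_part u = Poly_Mapping.map (\<lambda>p. coef p 0) u"

lemma coef_const_part [simp]: "coef (const_part u) b = coef (coef u b) 0"
  by (simp add: const_part_def Poly_Mapping.map.rep_eq when_def in_keys_iff)

lemma const_part_add: "const_part (u + v) = const_part u + const_part v"
  by (rule poly_mapping_eqI) (simp add: lookup_add)

lemma const_part_diff: "const_part (u - v) = const_part u - const_part v"
  by (rule poly_mapping_eqI) (simp add: lookup_minus)

lemma const_part_zero [simp]: "const_part 0 = 0"
  by (rule poly_mapping_eqI) simp

lemma const_part_scale: "const_part (scale p u) = scale (coef p 0) (const_part u)"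
  by (rule poly_mapping_eqI) (simp add: coef_mult_zero)

lemma const_part_sum: "const_part (sum f A) = (\<Sum>x\<in>A. const_part (f x))"
  by (induction A rule: infinite_finite_induct) (auto simp: const_part_add)

text \<open>
  Reduction modulo the variables turns the boundary maps of a resolution into those of its tensor
  product with the residue field.
\<close>

lemma const_part_lin_ext: "const_part (lin_ext f u) = lin_ext (\<lambda>b. const_part (f b)) (const_part u)"
proof -
  have "const_part (lin_ext f u) = (\<Sum>b\<in>supp u. scale (coef (const_part u) b) (const_part (f b)))"
    by (simp add: lin_ext_def const_part_sum const_part_scale)
  also have "\<dots> = lin_ext (\<lambda>b. const_part (f b)) (const_part u)"
    by (rule lin_ext_superset[symmetric]) (auto simp: in_keys_iff)
  finally show ?thesis .
qed

definition of_const :: "('b \<Rightarrow>\<^sub>0 'k::field) \<Rightarrow> ('b \<Rightarrow>\<^sub>0 'k mpol)" where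
  "of_const u = Poly_Mapping.map (\<lambda>c. single 0 c) u"

lemma coef_of_const [simp]: "coef (of_const u) b = single 0 (coef u b)"
  by (simp add: of_const_def Poly_Mapping.map.rep_eq when_def in_keys_iff)

lemma const_part_of_const [simp]: "const_part (of_const u) = u"
  by (rule poly_mapping_eqI) simp

lemma of_const_gpart:
  assumes "supp u \<subseteq> {b \<in> B. g b = j}"
  shows "of_const u \<in> gpart m n B g {j}"
proof (rule gpartI)
  show "b \<in> B" if "b \<in> supp (of_const u)" for b
    using assms that by (cases "coef u b = 0") (auto simp: in_keys_iff)
  fix b t assume "t \<in> supp (coef (of_const u) b)"
  then have "t = 0" "b \<in> supp u"
    by (auto simp: in_keys_iff lookup_single when_def split: if_splits)
  then show "supp t \<subseteq> {1..m} \<times> {1..n}" "mdeg t + g b \<in> {j}"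
    using assms by auto
qed

lemma supp_const_part:
  assumes "u \<in> gpart m n B g {j}"
  shows "supp (const_part u) \<subseteq> {b \<in> B. g b = j}"
proof
  fix b assume "b \<in> supp (const_part u)"
  then have "0 \<in> supp (coef u b)" "b \<in> supp u"
    by (auto simp: in_keys_iff)
  then show "b \<in> {b \<in> B. g b = j}"
    using gpartD(1,4)[OF assms] by fastforce
qed

section \<open>Comparison of complexes of free modules\<close>

definition chain_complex ::
    "nat \<Rightarrow> nat \<Rightarrow> (nat \<Rightarrow> 'b set) \<Rightarrow> (nat \<Rightarrow> 'b \<Rightarrow> nat) \<Rightarrow> (nat \<Rightarrow> 'b \<Rightarrow> ('b \<Rightarrow>\<^sub>0 'k::field mpol)) \<Rightarrow> bool" where
  "chain_complex m n B g d \<longleftrightarrow>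
     (\<forall>i. \<forall>b\<in>B (Suc i). d i b \<in> gpart m n (B i) (g i) {g (Suc i) b}) \<and>
     (\<forall>i. \<forall>b\<in>B (Suc (Suc i)). lin_ext (d i) (d (Suc i) b) = 0)"

definition acyclic_complex ::
    "nat \<Rightarrow> nat \<Rightarrow> (nat \<Rightarrow> 'b set) \<Rightarrow> (nat \<Rightarrow> 'b \<Rightarrow> nat) \<Rightarrow> (nat \<Rightarrow> 'b \<Rightarrow> ('b \<Rightarrow>\<^sub>0 'k::field mpol)) \<Rightarrow> bool" where
  "acyclic_complex m n B g d \<longleftrightarrow> chain_complex m n B g d \<and>
     (\<forall>i. \<forall>u\<in>gpart m n (B (Suc i)) (g (Suc i)) UNIV. lin_ext (d i) u = 0 \<longrightarrow>
        u \<in> lin_ext (d (Suc i)) ` gpart m n (B (Suc (Suc i))) (g (Suc (Suc i))) UNIV)"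

lemma chain_complexD:
  assumes "chain_complex m n B g d"
  shows "b \<in> B (Suc i) \<Longrightarrow> d i b \<in> gpart m n (B i) (g i) {g (Suc i) b}"
    and "b \<in> B (Suc (Suc i)) \<Longrightarrow> lin_ext (d i) (d (Suc i) b) = 0"
  using assms by (auto simp: chain_complex_def)

lemma homogeneous_bounding_chain:
  assumes "acyclic_complex m n B g d" "u \<in> gpart m n (B (Suc i)) (g (Suc i)) {j}" "lin_ext (d i) u = 0"
  shows "\<exists>w\<in>gpart m n (B (Suc (Suc i))) (g (Suc (Suc i))) {j}. lin_ext (d (Suc i)) w = u"
proof -
  obtain w where w: "w \<in> gpart m n (B (Suc (Suc i))) (g (Suc (Suc i))) UNIV" "lin_ext (d (Suc i)) w = u"
    using assms gpart_UNIV[OF assms(2)] unfolding acyclic_complex_def by blast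
  show ?thesis
    by (rule homogeneous_preimage[OF w(2) assms(2) w(1)])
      (use assms(1) in \<open>auto simp: acyclic_complex_def chain_complex_def\<close>)
qed

text \<open>
  The comparison theorem: since the source is free, a map can be continued from one level to the next
  by choosing images of the basis elements. The choice is possible as long as images of boundaries
  are boundaries; this is the invariant of the recursion, and acyclicity of the target preserves it.
\<close>

lemma lift_to_acyclic:
  assumes A: "chain_complex m n A ga da" and B: "acyclic_complex m n B gb db"
    and f0: "\<And>a. a \<in> A 0 \<Longrightarrow> f0 a \<in> gpart m n (B 0) (gb 0) {ga 0 a}"
    and im: "\<And>a. a \<in> A (Suc 0) \<Longrightarrow>
      lin_ext f0 (da 0 a) \<in> lin_ext (db 0) ` gpart m n (B (Suc 0)) (gb (Suc 0)) UNIV"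
  obtains f where "f 0 = f0"
    and "\<And>i a. a \<in> A i \<Longrightarrow> f i a \<in> gpart m n (B i) (gb i) {ga i a}"
    and "\<And>i a. a \<in> A (Suc i) \<Longrightarrow> lin_ext (db i) (f (Suc i) a) = lin_ext (f i) (da i a)"
proof -
  have B': "chain_complex m n B gb db"
    using B by (simp add: acyclic_complex_def)
  define P where "P i f \<longleftrightarrow> (i = 0 \<longrightarrow> f = f0) \<and> (\<forall>a\<in>A i. f a \<in> gpart m n (B i) (gb i) {ga i a}) \<and>
      (\<forall>a\<in>A (Suc i). lin_ext f (da i a) \<in> lin_ext (db i) ` gpart m n (B (Suc i)) (gb (Suc i)) UNIV)" for i f
  define Q where "Q i f f' \<longleftrightarrow> (\<forall>a\<in>A (Suc i). lin_ext (db i) (f' a) = lin_ext f (da i a))" for i f f'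
  have "\<exists>f. \<forall>i. P i (f i) \<and> Q i (f i) (f (Suc i))"
  proof (rule dependent_nat_choice)
    show "\<exists>f. P 0 f"
      using f0 im by (auto simp: P_def)
    fix f i assume Pf: "P i f"
    have "\<exists>y\<in>gpart m n (B (Suc i)) (gb (Suc i)) {ga (Suc i) a}. lin_ext (db i) y = lin_ext f (da i a)"
      if a: "a \<in> A (Suc i)" for a
    proof -
      obtain w where w: "w \<in> gpart m n (B (Suc i)) (gb (Suc i)) UNIV" "lin_ext (db i) w = lin_ext f (da i a)"
        using Pf a unfolding P_def by (metis (no_types, lifting) imageE)
      have "lin_ext f (da i a) \<in> gpart m n (B i) (gb i) {ga (Suc i) a}"
        using Pf by (intro gpart_lin_ext[OF chain_complexD(1)[OF A a]]) (auto simp: P_def)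
      then show ?thesis
        by (rule homogeneous_preimage[OF w(2) _ w(1)]) (rule chain_complexD(1)[OF B'])
    qed
    then obtain f' where f': "\<And>a. a \<in> A (Suc i) \<Longrightarrow> f' a \<in> gpart m n (B (Suc i)) (gb (Suc i)) {ga (Suc i) a}"
      "\<And>a. a \<in> A (Suc i) \<Longrightarrow> lin_ext (db i) (f' a) = lin_ext f (da i a)"
      by metis
    have "lin_ext f' (da (Suc i) a) \<in>
        lin_ext (db (Suc i)) ` gpart m n (B (Suc (Suc i))) (gb (Suc (Suc i))) UNIV"
      if a: "a \<in> A (Suc (Suc i))" for a
    proof -
      have da: "da (Suc i) a \<in> gpart m n (A (Suc i)) (ga (Suc i)) {ga (Suc (Suc i)) a}"
        by (rule chain_complexD(1)[OF A a])
      have "lin_ext (db i) (lin_ext f' (da (Suc i) a)) = lin_ext (\<lambda>b. lin_ext f (da i b)) (da (Suc i) a)"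
        unfolding lin_ext_lin_ext using f'(2) gpartD(1)[OF da] by (intro lin_ext_cong) blast
      also have "\<dots> = 0"
        using chain_complexD(2)[OF A a] by (simp add: lin_ext_lin_ext[symmetric])
      finally have "lin_ext (db i) (lin_ext f' (da (Suc i) a)) = 0" .
      moreover have "lin_ext f' (da (Suc i) a) \<in> gpart m n (B (Suc i)) (gb (Suc i)) UNIV"
        by (rule gpart_UNIV, rule gpart_lin_ext[OF da f'(1)])
      ultimately show ?thesis
        using B unfolding acyclic_complex_def by blast
    qed
    then show "\<exists>f'. P (Suc i) f' \<and> Q i f f'"
      using f' by (intro exI[of _ f']) (auto simp: P_def Q_def)
  qed
  then obtain f where f: "\<And>i. P i (f i)" "\<And>i. Q i (f i) (f (Suc i))" by blast
  show thesis
  proof (rule that)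
    show "f 0 = f0" using f(1)[of 0] by (simp add: P_def)
    show "f i a \<in> gpart m n (B i) (gb i) {ga i a}" if "a \<in> A i" for i a
      using f(1)[of i] that by (auto simp: P_def)
    show "lin_ext (db i) (f (Suc i) a) = lin_ext (f i) (da i a)" if "a \<in> A (Suc i)" for i a
      using f(2)[of i] that by (auto simp: Q_def)
  qed
qed

text \<open>
  The companion for homotopies, for a chain map that vanishes at level \<open>0\<close>. Here the
  invariant is that what the homotopy constructed so far does not account for is a cycle.
\<close>

lemma null_homotopy:
  assumes A: "acyclic_complex m n A g d"
    and f: "\<And>i a. a \<in> A i \<Longrightarrow> f i a \<in> gpart m n (A i) (g i) {g i a}"
    and comm: "\<And>i a. a \<in> A (Suc i) \<Longrightarrow> lin_ext (d i) (f (Suc i) a) = lin_ext (f i) (d i a)"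
    and f0: "\<And>a. a \<in> A 0 \<Longrightarrow> f 0 a = 0"
  obtains h where "h 0 = (\<lambda>_. 0)"
    and "\<And>i a. a \<in> A i \<Longrightarrow> h i a \<in> gpart m n (A (Suc i)) (g (Suc i)) {g i a}"
    and "\<And>i a. a \<in> A (Suc i) \<Longrightarrow> lin_ext (d (Suc i)) (h (Suc i) a) + lin_ext (h i) (d i a) = f (Suc i) a"
proof -
  have A': "chain_complex m n A g d"
    using A by (simp add: acyclic_complex_def)
  define P where "P i h \<longleftrightarrow> (i = 0 \<longrightarrow> h = (\<lambda>_. 0)) \<and>
      (\<forall>a\<in>A i. h a \<in> gpart m n (A (Suc i)) (g (Suc i)) {g i a}) \<and>
      (\<forall>a\<in>A (Suc i). lin_ext (d i) (f (Suc i) a - lin_ext h (d i a)) = 0)" for i h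
  define Q where "Q i h h' \<longleftrightarrow>
      (\<forall>a\<in>A (Suc i). lin_ext (d (Suc i)) (h' a) = f (Suc i) a - lin_ext h (d i a))" for i h h'
  have "\<exists>h. \<forall>i. P i (h i) \<and> Q i (h i) (h (Suc i))"
  proof (rule dependent_nat_choice)
    have "lin_ext (d 0) (f (Suc 0) a) = 0" if a: "a \<in> A (Suc 0)" for a
      using comm[OF a] f0 gpartD(1)[OF chain_complexD(1)[OF A' a]] by (simp add: lin_ext_zero_fun)
    then show "\<exists>h. P 0 h"
      by (intro exI[of _ "\<lambda>_. 0"]) (auto simp: P_def lin_ext_zero_fun)
    fix h i assume Ph: "P i h"
    have "\<exists>y\<in>gpart m n (A (Suc (Suc i))) (g (Suc (Suc i))) {g (Suc i) a}.
        lin_ext (d (Suc i)) y = f (Suc i) a - lin_ext h (d i a)" if a: "a \<in> A (Suc i)" for a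
    proof (rule homogeneous_bounding_chain[OF A])
      have "lin_ext h (d i a) \<in> gpart m n (A (Suc i)) (g (Suc i)) {g (Suc i) a}"
        using Ph by (intro gpart_lin_ext[OF chain_complexD(1)[OF A' a]]) (auto simp: P_def)
      then show "f (Suc i) a - lin_ext h (d i a) \<in> gpart m n (A (Suc i)) (g (Suc i)) {g (Suc i) a}"
        by (rule gpart_diff[OF f[OF a]])
      show "lin_ext (d i) (f (Suc i) a - lin_ext h (d i a)) = 0"
        using Ph a by (auto simp: P_def)
    qed
    then obtain h' where h': "\<And>a. a \<in> A (Suc i) \<Longrightarrow> h' a \<in> gpart m n (A (Suc (Suc i))) (g (Suc (Suc i))) {g (Suc i) a}"
      "\<And>a. a \<in> A (Suc i) \<Longrightarrow> lin_ext (d (Suc i)) (h' a) = f (Suc i) a - lin_ext h (d i a)"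
      by metis
    have "lin_ext (d (Suc i)) (f (Suc (Suc i)) a - lin_ext h' (d (Suc i) a)) = 0"
      if a: "a \<in> A (Suc (Suc i))" for a
    proof -
      have da: "d (Suc i) a \<in> gpart m n (A (Suc i)) (g (Suc i)) {g (Suc (Suc i)) a}"
        by (rule chain_complexD(1)[OF A' a])
      have "lin_ext (d (Suc i)) (lin_ext h' (d (Suc i) a)) =
          lin_ext (\<lambda>b. f (Suc i) b - lin_ext h (d i b)) (d (Suc i) a)"
        unfolding lin_ext_lin_ext using h'(2) gpartD(1)[OF da] by (intro lin_ext_cong) blast
      also have "\<dots> = lin_ext (f (Suc i)) (d (Suc i) a)"
        using chain_complexD(2)[OF A' a] by (simp add: lin_ext_diff_fun lin_ext_lin_ext[symmetric])
      finally show ?thesis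
        by (simp add: lin_ext_diff comm[OF a])
    qed
    then show "\<exists>h'. P (Suc i) h' \<and> Q i h h'"
      using h' by (intro exI[of _ h']) (auto simp: P_def Q_def)
  qed
  then obtain h where h: "\<And>i. P i (h i)" "\<And>i. Q i (h i) (h (Suc i))" by blast
  show thesis
  proof (rule that)
    show "h 0 = (\<lambda>_. 0)" using h(1)[of 0] by (simp add: P_def)
    show "h i a \<in> gpart m n (A (Suc i)) (g (Suc i)) {g i a}" if "a \<in> A i" for i a
      using h(1)[of i] that by (auto simp: P_def)
    show "lin_ext (d (Suc i)) (h (Suc i) a) + lin_ext (h i) (d i a) = f (Suc i) a" if "a \<in> A (Suc i)" for i a
      using h(2)[of i] that by (auto simp: Q_def)
  qed
qed

subsection \<open>Resolutions as augmented complexes\<close>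

text \<open>
  A resolution together with its augmentation is treated as one complex ending in the free module \<open>S\<close>
  (with basis element \<open>0\<close> in degree \<open>0\<close>).
\<close>

fun aug_gens :: "'k::field free_complex \<Rightarrow> nat \<Rightarrow> nat set" where
  "aug_gens F 0 = {0}"
| "aug_gens F (Suc i) = gens F i"

fun aug_deg :: "'k::field free_complex \<Rightarrow> nat \<Rightarrow> nat \<Rightarrow> nat" where
  "aug_deg F 0 = (\<lambda>_. 0)"
| "aug_deg F (Suc i) = gdeg F i"

fun aug_bd :: "'k::field free_complex \<Rightarrow> nat \<Rightarrow> nat \<Rightarrow> (nat \<Rightarrow>\<^sub>0 'k mpol)" where
  "aug_bd F 0 = (\<lambda>b. single 0 (aug F b))"
| "aug_bd F (Suc i) = bd F i"

lemma lin_ext_aug_bd_0: "lin_ext (aug_bd F 0) u = single 0 (aug_map F u)"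
  by (simp add: lin_ext_single_fun aug_map_def)

lemma chain_module_eq: "chain_module m n F i = gpart m n (aug_gens F (Suc i)) (aug_deg F (Suc i)) UNIV"
  by (simp add: chain_module_def free_module_eq_gpart[where g = "gdeg F i"])

lemma resolution_acyclic:
  assumes "graded_free_resolution m n I F" "I \<subseteq> polys m n"
  shows "acyclic_complex m n (aug_gens F) (aug_deg F) (aug_bd F)"
proof -
  note F = assms(1)[unfolded graded_free_resolution_def]
  have graded: "aug_bd F i b \<in> gpart m n (aug_gens F i) (aug_deg F i) {aug_deg F (Suc i) b}"
    if "b \<in> aug_gens F (Suc i)" for i b
  proof (cases i)
    case 0
    with F assms(2) that show ?thesis
      by (auto simp: homogeneous_def intro!: gpart_single)
  next
    case (Suc k)
    with F that have b: "bd F k b \<in> free_module (polys m n) (gens F k)"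
      and deg: "\<forall>c\<in>gens F k. \<forall>t\<in>supp (coef (bd F k b) c). mdeg t + gdeg F k c = gdeg F (Suc k) b"
      by (auto simp: chain_module_def)
    have "mdeg t + gdeg F k c = gdeg F (Suc k) b" if "t \<in> supp (coef (bd F k b) c)" for c t
    proof -
      have "c \<in> supp (bd F k b)"
        using that by (auto simp: in_keys_iff)
      then show ?thesis
        using b deg that by (auto simp: free_module_def)
    qed
    with b Suc show ?thesis by (auto simp: gpart_def)
  qed
  have ker: "lin_ext (aug_bd F (Suc i)) ` gpart m n (aug_gens F (Suc (Suc i))) (aug_deg F (Suc (Suc i))) UNIV =
      {u \<in> gpart m n (aug_gens F (Suc i)) (aug_deg F (Suc i)) UNIV. lin_ext (aug_bd F i) u = 0}" for i
  proof (cases i)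
    case 0
    have "single 0 p = (0 :: nat \<Rightarrow>\<^sub>0 'a mpol) \<longleftrightarrow> p = 0" for p
      by (metis lookup_single_eq single_zero lookup_zero)
    with F 0 show ?thesis
      unfolding chain_module_eq 0 lin_ext_aug_bd_0 by (simp add: numeral_2_eq_2)
  next
    case (Suc k)
    then show ?thesis using F unfolding chain_module_eq by simp
  qed
  have "lin_ext (aug_bd F i) (aug_bd F (Suc i) b) = 0" if "b \<in> aug_gens F (Suc (Suc i))" for i b
  proof -
    have "lin_ext (aug_bd F (Suc i)) (single b 1) \<in>
        {u \<in> gpart m n (aug_gens F (Suc i)) (aug_deg F (Suc i)) UNIV. lin_ext (aug_bd F i) u = 0}"
      unfolding ker[symmetric] by (rule imageI, rule gpart_UNIV, rule gpart_basis[OF that refl])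
    then show ?thesis by simp
  qed
  then show ?thesis
    using graded ker unfolding acyclic_complex_def chain_complex_def by blast
qed

lemma resolution_image:
  assumes "graded_free_resolution m n I F"
  shows "lin_ext (aug_bd F 0) ` gpart m n (aug_gens F (Suc 0)) (aug_deg F (Suc 0)) UNIV = single 0 ` I"
proof -
  have "aug_map F ` chain_module m n F 0 = I"
    using assms unfolding graded_free_resolution_def by blast
  then show ?thesis
    unfolding lin_ext_aug_bd_0 chain_module_eq[symmetric] by (auto simp: image_iff)
qed

subsection \<open>Vanishing of graded Betti numbers\<close>

lemma tensor_part_eq: "tensor_part F i j = {u. supp u \<subseteq> {b \<in> gens F i. gdeg F i b = j}}"
  by (simp add: tensor_part_def free_module_def gens_deg_def)

lemma tensor_bd_eq: "tensor_bd F i b = const_part (bd F i b)"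
  by (simp add: tensor_bd_def const_part_def)

lemma tensor_boundaries_subspace: "module.subspace scale (tensor_boundaries F i j)"
proof -
  interpret vector_space "scale :: 'a \<Rightarrow> (nat \<Rightarrow>\<^sub>0 'a) \<Rightarrow> _" by (rule vector_space_scale)
  have sub: "u + v \<in> tensor_part F i j" if "u \<in> tensor_part F i j" "v \<in> tensor_part F i j" for u v i
    using that keys_add[of u v] by (auto simp: tensor_part_eq)
  have sub': "scale c u \<in> tensor_part F i j" if "u \<in> tensor_part F i j" for u c i
  proof -
    have "supp (scale c u) \<subseteq> supp u" by (auto simp: in_keys_iff)
    then show ?thesis using that by (auto simp: tensor_part_eq)
  qed
  have zero: "0 \<in> tensor_part F i j" for i by (simp add: tensor_part_eq)
  show ?thesis
    unfolding tensor_boundaries_def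
  proof (rule subspaceI)
    show "0 \<in> lin_ext (tensor_bd F i) ` tensor_part F (Suc i) j"
      using zero lin_ext_zero by (metis image_eqI)
    show "x + y \<in> lin_ext (tensor_bd F i) ` tensor_part F (Suc i) j"
      if "x \<in> lin_ext (tensor_bd F i) ` tensor_part F (Suc i) j"
        "y \<in> lin_ext (tensor_bd F i) ` tensor_part F (Suc i) j" for x y
      using that sub by (auto simp: lin_ext_add[symmetric])
    show "scale c x \<in> lin_ext (tensor_bd F i) ` tensor_part F (Suc i) j"
      if "x \<in> lin_ext (tensor_bd F i) ` tensor_part F (Suc i) j" for c x
      using that sub' by (auto simp: lin_ext_scale[symmetric])
  qed
qed

text \<open>
  The difference defining \<open>tor_dim\<close> is a truncated one. As boundaries are cycles and both
  spaces are finite-dimensional, it vanishes only if the spaces agree.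
\<close>

lemma tor_dim_eq_0_iff:
  assumes fin: "\<And>i j. finite (gens_deg F i j)"
    and sub: "tensor_boundaries F i j \<subseteq> tensor_cycles F i j"
  shows "tor_dim F i j = 0 \<longleftrightarrow> tensor_cycles F i j = tensor_boundaries F i j"
proof
  assume "tensor_cycles F i j = tensor_boundaries F i j"
  then show "tor_dim F i j = 0" by (simp add: tor_dim_def)
next
  interpret vector_space "scale :: 'a \<Rightarrow> (nat \<Rightarrow>\<^sub>0 'a) \<Rightarrow> _" by (rule vector_space_scale)
  assume "tor_dim F i j = 0"
  then have le: "dim (tensor_cycles F i j) \<le> dim (tensor_boundaries F i j)"
    by (simp add: tor_dim_def)
  let ?W = "(\<lambda>b. single b 1) ` gens_deg F i j"
  have spanW: "tensor_cycles F i j \<subseteq> span ?W"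
  proof
    fix u assume "u \<in> tensor_cycles F i j"
    then have u: "supp u \<subseteq> gens_deg F i j"
      by (cases i) (auto simp: tensor_part_eq gens_deg_def)
    have "(\<Sum>b\<in>supp u. scale (coef u b) (single b 1)) \<in> span ?W"
      using u by (intro span_sum span_scale span_base) auto
    then show "u \<in> span ?W" by (simp add: poly_mapping_sum_singles)
  qed
  obtain B where B: "B \<subseteq> tensor_boundaries F i j" "independent B" "tensor_boundaries F i j \<subseteq> span B"
    "card B = dim (tensor_boundaries F i j)"
    using basis_exists by blast
  obtain Z where Z: "Z \<subseteq> tensor_cycles F i j" "independent Z" "tensor_cycles F i j \<subseteq> span Z"
    "card Z = dim (tensor_cycles F i j)"
    using basis_exists by blast
  have finZ: "finite Z"
    using independent_span_bound[OF _ Z(2)] fin Z(1) spanW by blast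
  have spanB: "span B \<subseteq> tensor_boundaries F i j"
    by (rule span_minimal[OF B(1) tensor_boundaries_subspace])
  have "z \<in> tensor_boundaries F i j" if z: "z \<in> tensor_cycles F i j" for z
  proof (rule ccontr)
    assume "z \<notin> tensor_boundaries F i j"
    then have nz: "z \<notin> span B" using spanB by blast
    then have ind: "independent (insert z B)"
      using B(2) by (simp add: independent_insert)
    have "insert z B \<subseteq> span Z" using z B(1) sub Z(3) by blast
    then have "finite (insert z B)" "card (insert z B) \<le> card Z"
      using independent_span_bound[OF finZ ind] by auto
    moreover have "z \<notin> B" using nz span_base by blast
    ultimately show False using le B(4) Z(4) by simp
  qed
  with sub show "tensor_cycles F i j = tensor_boundaries F i j" by blast
qed

lemma tensor_boundaries_subset_cycles:
  assumes "graded_free_resolution m n I F" "I \<subseteq> polys m n"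
  shows "tensor_boundaries F i j \<subseteq> tensor_cycles F i j"
proof
  have ac: "chain_complex m n (aug_gens F) (aug_deg F) (aug_bd F)"
    using resolution_acyclic[OF assms] by (simp add: acyclic_complex_def)
  fix u assume "u \<in> tensor_boundaries F i j"
  then obtain w where w: "w \<in> tensor_part F (Suc i) j" "u = lin_ext (tensor_bd F i) w"
    unfolding tensor_boundaries_def by blast
  have w': "of_const w \<in> gpart m n (aug_gens F (Suc (Suc i))) (aug_deg F (Suc (Suc i))) {j}"
    using w(1) by (intro of_const_gpart) (auto simp: tensor_part_eq)
  have u: "u = const_part (lin_ext (bd F i) (of_const w))"
    unfolding const_part_lin_ext w(2) by (simp add: tensor_bd_eq[abs_def])
  have v: "lin_ext (bd F i) (of_const w) \<in> gpart m n (aug_gens F (Suc i)) (aug_deg F (Suc i)) {j}"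
    using gpart_lin_ext[OF w' chain_complexD(1)[OF ac]] by simp
  have part: "u \<in> tensor_part F i j"
    using supp_const_part[OF v] by (simp add: u tensor_part_eq)
  show "u \<in> tensor_cycles F i j"
  proof (cases i)
    case 0
    with part show ?thesis by simp
  next
    case (Suc k)
    have "lin_ext (tensor_bd F k) u = const_part (lin_ext (bd F k) (lin_ext (bd F i) (of_const w)))"
      unfolding u const_part_lin_ext by (simp add: tensor_bd_eq[abs_def])
    also have "lin_ext (bd F k) (lin_ext (bd F i) (of_const w)) = 0"
      unfolding lin_ext_lin_ext using gpartD(1)[OF w'] chain_complexD(2)[OF ac, of _ "Suc k"]
      by (auto simp: Suc intro: lin_ext_zero_fun)
    finally show ?thesis using part by (simp add: Suc)
  qed
qed

text \<open>
  Suppose some acyclic complex over the ideal has its generators at step \<open>i\<close> in the single degree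
  \<open>i + r\<close>. For any resolution \<open>F\<close> of the ideal, the identity of \<open>F\<close> is homotopic to a map that
  factors through that complex. A cycle of the reduced complex in a degree \<open>j \<noteq> i + r\<close> becomes zero on the
  way, because degree \<open>j\<close> elements of the linear complex have no constant coefficients; so the homotopy
  exhibits it as a boundary.
\<close>

lemma tor_dim_zero_of_linear_complex:
  assumes F: "graded_free_resolution m n I F" "I \<subseteq> polys m n"
    and E: "acyclic_complex m n B g d" "B 0 = {e}" "g 0 e = 0"
    and im: "lin_ext (d 0) ` gpart m n (B (Suc 0)) (g (Suc 0)) UNIV = single e ` I"
    and lin: "\<And>i b. b \<in> B (Suc i) \<Longrightarrow> g (Suc i) b = i + r"
    and j: "j \<noteq> i + r"
  shows "tor_dim F i j = 0"
proof -
  let ?A = "aug_gens F" and ?ga = "aug_deg F" and ?da = "aug_bd F"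
  have A: "acyclic_complex m n ?A ?ga ?da" by (rule resolution_acyclic[OF F])
  then have A': "chain_complex m n ?A ?ga ?da" by (simp add: acyclic_complex_def)
  have E': "chain_complex m n B g d" using E(1) by (simp add: acyclic_complex_def)
  have "lin_ext (\<lambda>_. single e 1) (?da 0 a) \<in> lin_ext (d 0) ` gpart m n (B (Suc 0)) (g (Suc 0)) UNIV"
    if "a \<in> ?A (Suc 0)" for a
    using F(1) that unfolding im by (auto simp: graded_free_resolution_def)
  then obtain \<alpha> where \<alpha>: "\<alpha> 0 = (\<lambda>_. single e 1)"
    "\<And>i a. a \<in> ?A i \<Longrightarrow> \<alpha> i a \<in> gpart m n (B i) (g i) {?ga i a}"
    "\<And>i a. a \<in> ?A (Suc i) \<Longrightarrow> lin_ext (d i) (\<alpha> (Suc i) a) = lin_ext (\<alpha> i) (?da i a)"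
    using lift_to_acyclic[OF A' E(1), of "\<lambda>_. single e 1"] E(2,3)
    by (metis (no_types, lifting) aug_deg.simps(1) gpart_basis insertI1)
  have "lin_ext (\<lambda>_. single 0 1) (d 0 b) \<in> lin_ext (?da 0) ` gpart m n (?A (Suc 0)) (?ga (Suc 0)) UNIV"
    if b: "b \<in> B (Suc 0)" for b
  proof -
    have "lin_ext (d 0) (single b 1) \<in> single e ` I"
      unfolding im[symmetric] by (rule imageI, rule gpart_UNIV, rule gpart_basis[OF b refl])
    then obtain p where "d 0 b = single e p" "p \<in> I" by auto
    then show ?thesis unfolding resolution_image[OF F(1)] by (simp del: single_one)
  qed
  then obtain \<beta> where \<beta>: "\<beta> 0 = (\<lambda>_. single 0 1)"
    "\<And>i b. b \<in> B i \<Longrightarrow> \<beta> i b \<in> gpart m n (?A i) (?ga i) {g i b}"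
    "\<And>i b. b \<in> B (Suc i) \<Longrightarrow> lin_ext (?da i) (\<beta> (Suc i) b) = lin_ext (\<beta> i) (d i b)"
    using lift_to_acyclic[OF E' A, of "\<lambda>_. single 0 1"] E(2,3)
    by (metis (no_types, lifting) aug_deg.simps(1) aug_gens.simps(1) gpart_basis insertI1 singletonD)
  \<comment> \<open>identity minus the round trip through the linear complex\<close>
  define f where "f i a = single a 1 - lin_ext (\<beta> i) (\<alpha> i a)" for i a
  have f: "f i a \<in> gpart m n (?A i) (?ga i) {?ga i a}" if a: "a \<in> ?A i" for i a
    unfolding f_def by (intro gpart_diff gpart_basis gpart_lin_ext[OF \<alpha>(2)] \<beta>(2) a refl)
  have comm: "lin_ext (?da i) (f (Suc i) a) = lin_ext (f i) (?da i a)" if a: "a \<in> ?A (Suc i)" for i a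
  proof -
    have "lin_ext (?da i) (lin_ext (\<beta> (Suc i)) (\<alpha> (Suc i) a)) = lin_ext (\<lambda>b. lin_ext (\<beta> i) (d i b)) (\<alpha> (Suc i) a)"
      unfolding lin_ext_lin_ext using gpartD(1)[OF \<alpha>(2)[OF a]] by (intro lin_ext_cong \<beta>(3))
    also have "\<dots> = lin_ext (\<lambda>b. lin_ext (\<beta> i) (\<alpha> i b)) (?da i a)"
      by (simp add: lin_ext_lin_ext[symmetric] \<alpha>(3)[OF a])
    finally show ?thesis
      unfolding f_def lin_ext_diff_fun by (simp add: lin_ext_diff)
  qed
  have f0: "f 0 a = 0" if "a \<in> ?A 0" for a
    using that by (simp add: f_def \<alpha>(1) \<beta>(1))
  obtain h where h: "h 0 = (\<lambda>_. 0)" "\<And>i a. a \<in> ?A i \<Longrightarrow> h i a \<in> gpart m n (?A (Suc i)) (?ga (Suc i)) {?ga i a}"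
    "\<And>i a. a \<in> ?A (Suc i) \<Longrightarrow> lin_ext (?da (Suc i)) (h (Suc i) a) + lin_ext (h i) (?da i a) = f (Suc i) a"
    using null_homotopy[OF A f comm f0] by blast
  have "tensor_cycles F i j \<subseteq> tensor_boundaries F i j"
  proof
    fix u assume u: "u \<in> tensor_cycles F i j"
    then have "u \<in> tensor_part F i j" by (cases i) auto
    then have z: "of_const u \<in> gpart m n (?A (Suc i)) (?ga (Suc i)) {j}"
      by (intro of_const_gpart) (auto simp: tensor_part_eq)
    let ?z = "of_const u"
    have "const_part (lin_ext (\<alpha> (Suc i)) ?z) = 0"
    proof -
      have "lin_ext (\<alpha> (Suc i)) ?z \<in> gpart m n (B (Suc i)) (g (Suc i)) {j}"
        by (rule gpart_lin_ext[OF z \<alpha>(2)])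
      from supp_const_part[OF this] have "supp (const_part (lin_ext (\<alpha> (Suc i)) ?z)) = {}"
        using lin j by fastforce
      then show ?thesis by simp
    qed
    then have ba: "const_part (lin_ext (\<beta> (Suc i)) (lin_ext (\<alpha> (Suc i)) ?z)) = 0"
      by (simp add: const_part_lin_ext)
    have hd: "const_part (lin_ext (h i) (lin_ext (?da i) ?z)) = 0"
    proof (cases i)
      case 0
      then show ?thesis by (simp add: h(1) lin_ext_zero_fun)
    next
      case (Suc k)
      have "const_part (lin_ext (?da i) ?z) = lin_ext (tensor_bd F k) u"
        unfolding const_part_lin_ext by (simp add: Suc tensor_bd_eq[abs_def])
      also have "\<dots> = 0"
        using u by (simp add: Suc)
      finally show ?thesis
        unfolding const_part_lin_ext[of "h i"] by simp
    qed
    let ?y = "lin_ext (h (Suc i)) ?z"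
    have y: "?y \<in> gpart m n (?A (Suc (Suc i))) (?ga (Suc (Suc i))) {j}"
      by (rule gpart_lin_ext[OF z h(2)])
    have "lin_ext (?da (Suc i)) ?y + lin_ext (h i) (lin_ext (?da i) ?z) = lin_ext (f (Suc i)) ?z"
      unfolding lin_ext_lin_ext lin_ext_add_fun[symmetric]
      by (intro lin_ext_cong h(3)) (rule gpartD(1)[OF z])
    also have "\<dots> = ?z - lin_ext (\<beta> (Suc i)) (lin_ext (\<alpha> (Suc i)) ?z)"
      unfolding f_def lin_ext_diff_fun by (simp add: lin_ext_lin_ext)
    finally have "const_part (lin_ext (?da (Suc i)) ?y + lin_ext (h i) (lin_ext (?da i) ?z)) =
        const_part (?z - lin_ext (\<beta> (Suc i)) (lin_ext (\<alpha> (Suc i)) ?z))" by simp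
    then have "const_part (lin_ext (bd F i) ?y) = u"
      using ba hd by (simp add: const_part_add const_part_diff)
    then have "u = lin_ext (tensor_bd F i) (const_part ?y)"
      by (simp add: const_part_lin_ext tensor_bd_eq[abs_def])
    moreover have "const_part ?y \<in> tensor_part F (Suc i) j"
      using supp_const_part[OF y] by (simp add: tensor_part_eq)
    ultimately show "u \<in> tensor_boundaries F i j"
      unfolding tensor_boundaries_def by blast
  qed
  then have "tensor_cycles F i j = tensor_boundaries F i j"
    using tensor_boundaries_subset_cycles[OF F] by blast
  then show ?thesis by (simp add: tor_dim_def)
qed

section \<open>Existence of graded free resolutions\<close>

definition graded_submodule ::
    "nat \<Rightarrow> nat \<Rightarrow> 'b set \<Rightarrow> ('b \<Rightarrow> nat) \<Rightarrow> ('b \<Rightarrow>\<^sub>0 'k::field mpol) set \<Rightarrow> bool" where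
  "graded_submodule m n B g N \<longleftrightarrow> N \<subseteq> gpart m n B g UNIV \<and> 0 \<in> N \<and>
     (\<forall>u\<in>N. \<forall>v\<in>N. u + v \<in> N) \<and> (\<forall>p\<in>polys m n. \<forall>u\<in>N. scale p u \<in> N) \<and>
     (\<forall>u\<in>N. \<forall>j. degree_filter g {j} u \<in> N)"

lemma graded_submodule_image:
  assumes "\<And>b. b \<in> B \<Longrightarrow> f b \<in> gpart m n C h {g b}"
  shows "graded_submodule m n C h (lin_ext f ` gpart m n B g UNIV)"
  unfolding graded_submodule_def
proof (intro conjI ballI allI)
  let ?N = "lin_ext f ` gpart m n B g UNIV"
  show "?N \<subseteq> gpart m n C h UNIV"
    using assms by (auto intro: gpart_lin_ext)
  show "0 \<in> ?N"
    by (rule image_eqI[of _ _ 0]) simp_all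
  show "u + v \<in> ?N" if "u \<in> ?N" "v \<in> ?N" for u v
    using that by (auto simp: lin_ext_add[symmetric] intro: gpart_add)
  show "scale p u \<in> ?N" if "p \<in> polys m n" "u \<in> ?N" for p u
    using that by (auto simp: lin_ext_scale[symmetric] intro: gpart_scale_UNIV)
  show "degree_filter h {j} u \<in> ?N" if u: "u \<in> ?N" for u j
  proof -
    obtain w where w: "w \<in> gpart m n B g UNIV" "u = lin_ext f w"
      using u by blast
    have "degree_filter g {j} w \<in> gpart m n B g UNIV"
      by (rule gpart_UNIV, rule gpart_degree_filter[OF w(1)])
    then show ?thesis
      using degree_filter_lin_ext[OF w(1) assms, of "{j}"] w(2) by (metis image_eqI)
  qed
qed

lemma graded_submodule_kernel:
  assumes "\<And>b. b \<in> B \<Longrightarrow> f b \<in> gpart m n C h {g b}"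
  shows "graded_submodule m n B g {u \<in> gpart m n B g UNIV. lin_ext f u = 0}"
  unfolding graded_submodule_def
proof (intro conjI ballI allI)
  fix u j assume u: "u \<in> {u \<in> gpart m n B g UNIV. lin_ext f u = 0}"
  have "degree_filter h {j} (lin_ext f u) = 0"
    using u by (intro poly_mapping_eqI) (simp add: coef_degree_filter)
  moreover have "degree_filter g {j} u \<in> gpart m n B g UNIV"
    using u by (intro gpart_UNIV[OF gpart_degree_filter]) auto
  ultimately show "degree_filter g {j} u \<in> {u \<in> gpart m n B g UNIV. lin_ext f u = 0}"
    using degree_filter_lin_ext[of u m n B g f C h, OF _ assms] u by simp
qed (auto simp: lin_ext_add lin_ext_scale intro: gpart_add gpart_scale_UNIV)

lemma graded_submodule_sum:
  assumes "graded_submodule m n B g N" "finite A" "\<And>x. x \<in> A \<Longrightarrow> f x \<in> N"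
  shows "sum f A \<in> N"
  using assms(2,3,1) by (induction A) (auto simp: graded_submodule_def)

lemma finite_monomials_of_degree:
  assumes "finite V"
  shows "finite {t :: 'a \<Rightarrow>\<^sub>0 nat. supp t \<subseteq> V \<and> (\<forall>v. coef t v \<le> d)}"
proof (rule finite_imageD)
  show "finite (coef ` {t :: 'a \<Rightarrow>\<^sub>0 nat. supp t \<subseteq> V \<and> (\<forall>v. coef t v \<le> d)})"
  proof (rule finite_subset)
    show "coef ` {t :: 'a \<Rightarrow>\<^sub>0 nat. supp t \<subseteq> V \<and> (\<forall>v. coef t v \<le> d)} \<subseteq>
        {f. \<forall>x. (x \<in> V \<longrightarrow> f x \<in> {..d}) \<and> (x \<notin> V \<longrightarrow> f x = 0)}"
      by (auto simp: in_keys_iff)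
    show "finite {f. \<forall>x. (x \<in> V \<longrightarrow> f x \<in> {..d}) \<and> (x \<notin> V \<longrightarrow> f x = (0::nat))}"
      by (rule finite_set_of_finite_funs) (simp_all add: assms)
  qed
  show "inj_on coef {t :: 'a \<Rightarrow>\<^sub>0 nat. supp t \<subseteq> V \<and> (\<forall>v. coef t v \<le> d)}"
    by (rule inj_onI) (rule poly_mapping_eqI, simp only:)
qed

lemma coef_le_mdeg: "coef t v \<le> mdeg t"
proof (cases "v \<in> supp t")
  case True
  then show ?thesis unfolding mdeg_def by (intro member_le_sum) auto
qed (simp add: in_keys_iff)

text \<open>
  All homogeneous pieces of a free module with finitely many basis elements in each degree are
  finite-dimensional over the field. Bases of the pieces of the submodule generate it, and in each
  degree there are finitely many of them.
\<close>

lemma graded_submodule_generators: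
  fixes N :: "(nat \<Rightarrow>\<^sub>0 'k::field mpol) set"
  assumes N: "graded_submodule m n B g N" and fin: "\<And>j. finite {b \<in> B. g b = j}"
  obtains G h f where "\<And>j. finite {b \<in> G. h b = (j::nat)}"
    and "\<And>b. b \<in> G \<Longrightarrow> f b \<in> gpart m n B g {h b}"
    and "lin_ext f ` gpart m n (G::nat set) h UNIV = N"
proof -
  note N' = N[unfolded graded_submodule_def]
  let ?ks = "\<lambda>c. scale (single 0 c) :: (nat \<Rightarrow>\<^sub>0 'k mpol) \<Rightarrow> (nat \<Rightarrow>\<^sub>0 'k mpol)"
  interpret K: vector_space ?ks
    by unfold_locales (simp_all add: scale_add_right scale_add_left[symmetric] single_add mult_single)
  have "\<exists>xs. set xs \<subseteq> N \<inter> gpart m n B g {j} \<and> N \<inter> gpart m n B g {j} \<subseteq> K.span (set xs)" for j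
  proof -
    let ?T = "{t :: (nat \<times> nat) \<Rightarrow>\<^sub>0 nat. supp t \<subseteq> {1..m} \<times> {1..n} \<and> (\<forall>v. coef t v \<le> j)}"
    let ?W = "(\<lambda>(b, t). single b (single t 1) :: nat \<Rightarrow>\<^sub>0 'k mpol) ` ((\<Union>i\<le>j. {b \<in> B. g b = i}) \<times> ?T)"
    have finW: "finite ?W"
      using fin finite_monomials_of_degree[of "{1..m} \<times> {1..n}" j] by auto
    have spanW: "gpart m n B g {j} \<subseteq> K.span ?W"
    proof
      fix u :: "nat \<Rightarrow>\<^sub>0 'k mpol" assume u: "u \<in> gpart m n B g {j}"
      have "u = (\<Sum>b\<in>supp u. \<Sum>t\<in>supp (coef u b). ?ks (coef (coef u b) t) (single b (single t 1)))"
        by (simp add: mult_single single_sum[symmetric] poly_mapping_sum_singles)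
      moreover have "single b (single t 1) \<in> ?W" if "b \<in> supp u" "t \<in> supp (coef u b)" for b t
      proof -
        have "mdeg t + g b = j" using gpartD(4)[OF u that(2)] by simp
        then have "g b \<le> j" "mdeg t \<le> j" by simp_all
        moreover from this have "\<And>v. coef t v \<le> j"
          using coef_le_mdeg le_trans by blast
        ultimately show ?thesis
          using gpartD(1)[OF u that(1)] gpartD(3)[OF u that(2)] by (intro image_eqI[of _ _ "(b, t)"]) auto
      qed
      ultimately show "u \<in> K.span ?W"
        by (metis (no_types, lifting) K.span_base K.span_scale K.span_sum)
    qed
    obtain Z where Z: "Z \<subseteq> N \<inter> gpart m n B g {j}" "K.independent Z" "N \<inter> gpart m n B g {j} \<subseteq> K.span Z"
      using K.maximal_independent_subset by blast
    have "finite Z"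
      using K.independent_span_bound[OF finW Z(2)] Z(1) spanW by blast
    then obtain xs where "set xs = Z" using finite_list by blast
    with Z show ?thesis by blast
  qed
  then obtain xs where xs: "\<And>j. set (xs j) \<subseteq> N \<inter> gpart m n B g {j}"
    "\<And>j. N \<inter> gpart m n B g {j} \<subseteq> K.span (set (xs j))"
    by metis
  define G where "G = {prod_encode (j, k) | j k. k < length (xs j)}"
  define h where "h b = fst (prod_decode b)" for b
  define f where "f b = xs (h b) ! snd (prod_decode b)" for b
  have fN: "f b \<in> N \<inter> gpart m n B g {h b}" if "b \<in> G" for b
  proof -
    have "f b \<in> set (xs (h b))" using that by (auto simp: G_def h_def f_def)
    then show ?thesis using xs(1) by blast
  qed
  let ?I = "lin_ext f ` gpart m n G h UNIV"
  have gi: "graded_submodule m n B g ?I"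
    by (rule graded_submodule_image) (use fN in blast)
  show thesis
  proof (rule that)
    show "finite {b \<in> G. h b = j}" for j
      by (rule finite_subset[of _ "(\<lambda>k. prod_encode (j, k)) ` {..<length (xs j)}"]) (auto simp: G_def h_def)
    show "f b \<in> gpart m n B g {h b}" if "b \<in> G" for b
      using fN[OF that] by blast
    show "?I = N"
    proof (intro equalityI subsetI)
      fix u assume "u \<in> ?I"
      then obtain w where w: "w \<in> gpart m n G h UNIV" "u = (\<Sum>b\<in>supp w. scale (coef w b) (f b))"
        by (auto simp: lin_ext_def)
      have "scale (coef w b) (f b) \<in> N" if "b \<in> supp w" for b
        using fN gpartD(1,2)[OF w(1)] N' that by blast
      then show "u \<in> N"
        unfolding w(2) by (intro graded_submodule_sum[OF N]) auto
    next
      fix u assume u: "u \<in> N"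
      have part: "N \<inter> gpart m n B g {j} \<subseteq> ?I" for j
      proof -
        have "xs j ! k \<in> ?I" if "k < length (xs j)" for k
        proof (rule image_eqI[of _ _ "single (prod_encode (j, k)) 1"])
          show "xs j ! k = lin_ext f (single (prod_encode (j, k)) 1)"
            by (simp add: f_def h_def)
          show "single (prod_encode (j, k)) 1 \<in> gpart m n G h UNIV"
            using that by (intro gpart_UNIV[OF gpart_basis]) (auto simp: G_def)
        qed
        then have "set (xs j) \<subseteq> ?I" by (auto simp: in_set_conv_nth)
        moreover have "K.subspace ?I"
          using gi unfolding graded_submodule_def by (intro K.subspaceI) auto
        ultimately have "K.span (set (xs j)) \<subseteq> ?I" by (rule K.span_minimal)
        with xs(2) show ?thesis by blast
      qed
      define D where "D = (\<Union>b\<in>supp u. (\<lambda>t. mdeg t + g b) ` supp (coef u b))"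
      have finD: "finite D" by (simp add: D_def)
      have "u = (\<Sum>j\<in>D. degree_filter g {j} u)"
      proof (rule poly_mapping_eqI, rule poly_mapping_eqI)
        fix b t
        have "coef (coef (\<Sum>j\<in>D. degree_filter g {j} u) b) t =
            (\<Sum>j\<in>D. if mdeg t + g b = j then coef (coef u b) t else 0)"
          by (simp add: lookup_sum coef_degree_filter when_def)
        also have "\<dots> = (if mdeg t + g b \<in> D then coef (coef u b) t else 0)"
          by (rule sum.delta'[OF finD])
        also have "\<dots> = coef (coef u b) t"
        proof (cases "coef (coef u b) t = 0")
          case False
          then have "b \<in> supp u" "t \<in> supp (coef u b)" by (auto simp: in_keys_iff)
          then show ?thesis by (auto simp: D_def)
        qed simp
        finally show "coef (coef u b) t = coef (coef (\<Sum>j\<in>D. degree_filter g {j} u) b) t" by simp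
      qed
      moreover have "degree_filter g {j} u \<in> ?I" for j
      proof -
        have "degree_filter g {j} u \<in> N \<inter> gpart m n B g {j}"
          using u N' gpart_degree_filter[of u m n B g UNIV "{j}"] by auto
        then show ?thesis using part by blast
      qed
      then have "(\<Sum>j\<in>D. degree_filter g {j} u) \<in> ?I"
        by (intro graded_submodule_sum[OF gi finD])
      ultimately show "u \<in> ?I" by (simp only:)
    qed
  qed
qed

text \<open>
  The resolution is built by covering the ideal, then the kernel of the covering, and so on. The ideal
  is passed as a submodule of the free module on one basis element, so that all steps have the same form.
\<close>

theorem exists_graded_free_resolution:
  fixes I :: "'k::field mpol set"
  assumes "graded_submodule m n {0::nat} (\<lambda>_. 0) (single 0 ` I)"
  obtains F where "graded_free_resolution m n I F"
proof -
  define P where "P i s = (case s of (A, g, N) \<Rightarrow> graded_submodule m n A g N \<and>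
      (\<forall>j. finite {b \<in> A. g b = j}) \<and> (i = 0 \<longrightarrow> A = {0} \<and> g = (\<lambda>_. 0) \<and> N = single 0 ` I))"
    for i :: nat and s :: "nat set \<times> (nat \<Rightarrow> nat) \<times> (nat \<Rightarrow>\<^sub>0 'k mpol) set"
  define Q where "Q s s' f = (case s of (A, g, N) \<Rightarrow> case s' of (A', g', N') \<Rightarrow>
      (\<forall>b\<in>A'. f b \<in> gpart m n A g {g' b}) \<and> lin_ext f ` gpart m n A' g' UNIV = N \<and>
      N' = {u \<in> gpart m n A' g' UNIV. lin_ext f u = 0})"
    for s s' :: "nat set \<times> (nat \<Rightarrow> nat) \<times> (nat \<Rightarrow>\<^sub>0 'k mpol) set" and f
  have "\<exists>s. \<forall>i. P i (s i) \<and> (\<exists>f. Q (s i) (s (Suc i)) f)"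
  proof (rule dependent_nat_choice)
    show "\<exists>s. P 0 s"
      using assms by (intro exI[of _ "({0}, (\<lambda>_. 0), single 0 ` I)"]) (auto simp: P_def)
    fix s i assume Ps: "P i s"
    obtain A g N where s: "s = (A, g, N)" by (cases s)
    have N: "graded_submodule m n A g N" and fin: "\<And>j. finite {b \<in> A. g b = j}"
      using Ps by (auto simp: P_def s)
    have "\<exists>(G::nat set) h f. (\<forall>j. finite {b \<in> G. h b = j}) \<and> (\<forall>b\<in>G. f b \<in> gpart m n A g {h b}) \<and>
        lin_ext f ` gpart m n G h UNIV = N"
      by (rule graded_submodule_generators[OF N fin]) blast
    then obtain G :: "nat set" and h f where f: "\<forall>j. finite {b \<in> G. h b = j}"
      "\<forall>b\<in>G. f b \<in> gpart m n A g {h b}" "lin_ext f ` gpart m n G h UNIV = N"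
      by (elim exE conjE)
    let ?s = "(G, h, {u \<in> gpart m n G h UNIV. lin_ext f u = 0})"
    have "P (Suc i) ?s"
      using f(1) graded_submodule_kernel[of G f m n A g h, OF bspec[OF f(2)]] by (simp add: P_def)
    moreover have "Q s ?s f"
      using f by (simp add: Q_def s)
    ultimately show "\<exists>s'. P (Suc i) s' \<and> (\<exists>f. Q s s' f)" by blast
  qed
  then obtain s where s: "\<And>i. P i (s i)" "\<And>i. \<exists>f. Q (s i) (s (Suc i)) f" by blast
  then obtain f where f: "\<And>i. Q (s i) (s (Suc i)) (f i)" by metis
  define A g N where "A i = fst (s i)" and "g i = fst (snd (s i))" and "N i = snd (snd (s i))" for i
  have s_eq: "s i = (A i, g i, N i)" for i
    by (simp add: A_def g_def N_def)
  have Q: "\<And>i b. b \<in> A (Suc i) \<Longrightarrow> f i b \<in> gpart m n (A i) (g i) {g (Suc i) b}"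
    "\<And>i. lin_ext (f i) ` gpart m n (A (Suc i)) (g (Suc i)) UNIV = N i"
    "\<And>i. N (Suc i) = {u \<in> gpart m n (A (Suc i)) (g (Suc i)) UNIV. lin_ext (f i) u = 0}"
    using f unfolding Q_def s_eq by auto
  have fin: "finite {b \<in> A i. g i b = j}" for i j
    using s(1)[of i] by (auto simp: P_def s_eq)
  have zero: "A 0 = {0}" "g 0 = (\<lambda>_. 0)" "N 0 = single 0 ` I"
    using s(1)[of 0] by (auto simp: P_def s_eq)
  define F where "F = \<lparr>gens = \<lambda>i. A (Suc i), gdeg = \<lambda>i. g (Suc i), bd = \<lambda>i. f (Suc i),
      aug = \<lambda>b. coef (f 0 b) 0\<rparr>"
  have aug: "single 0 (coef (f 0 b) 0) = f 0 b" if "b \<in> A (Suc 0)" for b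
  proof (rule poly_mapping_eqI)
    fix c
    show "coef (single 0 (coef (f 0 b) 0)) c = coef (f 0 b) c"
      using gpartD(1)[OF Q(1)[OF that], of c] zero(1)
      by (cases "c = 0") (auto simp: lookup_single in_keys_iff)
  qed
  have aug_map: "single 0 (aug_map F u) = lin_ext (f 0) u" if u: "u \<in> gpart m n (A (Suc 0)) (g (Suc 0)) UNIV" for u
  proof -
    have "lin_ext (f 0) u = lin_ext (\<lambda>b. single 0 (coef (f 0 b) 0)) u"
      by (rule lin_ext_cong) (simp add: aug gpartD(1)[OF u])
    also have "\<dots> = single 0 (aug_map F u)"
      by (simp add: lin_ext_single_fun aug_map_def F_def)
    finally show ?thesis by simp
  qed
  have inj: "p = q" if "single 0 p = (single 0 q :: nat \<Rightarrow>\<^sub>0 'k mpol)" for p q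
    using that by (metis lookup_single_eq)
  have mod_eq: "chain_module m n F i = gpart m n (A (Suc i)) (g (Suc i)) UNIV" for i
    by (simp add: chain_module_def F_def free_module_eq_gpart[where g = "g (Suc i)"])
  have "graded_free_resolution m n I F"
    unfolding graded_free_resolution_def
  proof (intro conjI allI ballI)
    show "finite (gens_deg F i j)" for i j
      using fin[of "Suc i" j] by (simp add: gens_deg_def F_def)
    show "aug F b \<in> I" if "b \<in> gens F 0" for b
    proof -
      have b: "b \<in> A (Suc 0)" using that by (simp add: F_def)
      have "lin_ext (f 0) (single b 1) \<in> single 0 ` I"
        using Q(2)[of 0] zero gpart_UNIV[OF gpart_basis[OF b refl, of m n "g (Suc 0)"]] by blast
      then have "single 0 (coef (f 0 b) 0) \<in> single (0::nat) ` I"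
        using aug[OF b] by simp
      then show ?thesis using inj by (auto simp: F_def)
    qed
    show "homogeneous (gdeg F 0 b) (aug F b)" if "b \<in> gens F 0" for b
      using that gpartD(4)[OF Q(1)[of b 0]] zero by (auto simp: homogeneous_def F_def)
    show "bd F i b \<in> chain_module m n F i" if "b \<in> gens F (Suc i)" for i b
      using that Q(1)[of b "Suc i"] unfolding mod_eq by (auto simp: F_def intro: gpart_UNIV)
    show "mdeg t + gdeg F i c = gdeg F (Suc i) b"
      if "b \<in> gens F (Suc i)" "c \<in> gens F i" "t \<in> supp (coef (bd F i b) c)" for i b c t
      using that gpartD(4)[OF Q(1)[of b "Suc i"], of t c] by (auto simp: F_def)
    show "aug_map F ` chain_module m n F 0 = I"
    proof -
      have "single (0::nat) ` (aug_map F ` chain_module m n F 0) = single 0 ` I"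
        using Q(2)[of 0] zero(3) by (simp add: mod_eq image_image aug_map cong: image_cong)
      then show ?thesis using inj by (metis (no_types, lifting) inj_image_eq_iff inj_onI)
    qed
    show "lin_ext (bd F 0) ` chain_module m n F 1 = {u \<in> chain_module m n F 0. aug_map F u = 0}"
    proof -
      have "aug_map F u = 0 \<longleftrightarrow> lin_ext (f 0) u = 0" if "u \<in> gpart m n (A (Suc 0)) (g (Suc 0)) UNIV" for u
        using aug_map[OF that] inj[of "aug_map F u" 0] by auto
      then show ?thesis
        using Q(2)[of "Suc 0"] Q(3)[of 0] unfolding mod_eq by (auto simp: F_def)
    qed
    show "lin_ext (bd F (Suc i)) ` chain_module m n F (Suc (Suc i)) =
        {u \<in> chain_module m n F (Suc i). lin_ext (bd F i) u = 0}" for i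
      using Q(2)[of "Suc (Suc i)"] Q(3)[of "Suc i"] unfolding mod_eq by (simp add: F_def)
  qed
  then show thesis by (rule that)
qed

section \<open>Weights and maximal minors\<close>

definition dot :: "nat list \<Rightarrow> nat list \<Rightarrow> nat" where
  "dot xs ys = sum_list (map2 (*) xs ys)"

lemma dot_simps [simp]: "dot [] ys = 0" "dot xs [] = 0" "dot (x # xs) (y # ys) = x * y + dot xs ys"
  by (simp_all add: dot_def)

lemma crossed_products_less:
  fixes a b c d :: nat
  assumes "a < b" "c < d"
  shows "b * c + a * d < a * c + b * d"
proof -
  obtain x y where "b = a + Suc x" "d = c + Suc y"
    using assms by (metis less_imp_Suc_add add_Suc_right)
  then show ?thesis by (simp add: algebra_simps)
qed

lemma dot_insort:
  assumes "sorted_wrt (<) js" "length js = Suc (length ss)"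
  shows "dot (f # ss) js \<le> dot (insort f ss) js \<and>
    (f # ss \<noteq> insort f ss \<longrightarrow> dot (f # ss) js < dot (insort f ss) js)"
  using assms
proof (induction ss arbitrary: js)
  case (Cons s ss)
  then obtain j j2 js' where js: "js = j # j2 # js'"
    by (metis length_Suc_conv)
  show ?case
  proof (cases "f \<le> s")
    case False
    have "dot (f # ss) (j2 # js') \<le> dot (insort f ss) (j2 # js')"
      using Cons.IH[of "j2 # js'"] Cons.prems by (simp add: js)
    moreover have "f * j + s * j2 < s * j + f * j2"
      using False Cons.prems(1) by (intro crossed_products_less) (auto simp: js)
    ultimately show ?thesis
      using False by (simp add: js)
  qed simp
qed simp

text \<open>
  The rearrangement inequality with its case of equality, by following insertion sort: each
  comparison that swaps two neighbours strictly increases the sum.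
\<close>

lemma dot_sort:
  assumes "sorted_wrt (<) js" "length fs = length js"
  shows "dot fs js \<le> dot (sort fs) js \<and> (fs \<noteq> sort fs \<longrightarrow> dot fs js < dot (sort fs) js)"
  using assms
proof (induction fs arbitrary: js)
  case (Cons f fs)
  then obtain j js' where js: "js = j # js'" by (cases js) auto
  have "dot fs js' \<le> dot (sort fs) js' \<and> (fs \<noteq> sort fs \<longrightarrow> dot fs js' < dot (sort fs) js')"
    using Cons by (simp add: js)
  moreover have "dot (f # sort fs) js \<le> dot (insort f (sort fs)) js \<and>
      (f # sort fs \<noteq> insort f (sort fs) \<longrightarrow> dot (f # sort fs) js < dot (insort f (sort fs)) js)"
    using Cons.prems by (intro dot_insort) auto
  ultimately show ?case
    by (cases "fs = sort fs") (auto simp: js)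
qed simp

definition monomial :: "(nat \<times> nat) list \<Rightarrow> monom" where
  "monomial zs = sum_list (map (\<lambda>z. single z 1) zs)"

lemma monomial_simps [simp]: "monomial [] = 0" "monomial (z # zs) = single z 1 + monomial zs"
  "monomial (xs @ ys) = monomial xs + monomial ys"
  by (simp_all add: monomial_def)

lemma monomial_mset: "mset xs = mset ys \<Longrightarrow> monomial xs = monomial ys"
  unfolding monomial_def by (metis mset_map sum_mset_sum_list)

lemma coef_monomial: "coef (monomial zs) z = count_list zs z"
  by (induction zs) (auto simp: lookup_add lookup_single when_def)

lemma supp_monomial: "supp (monomial zs) = set zs"
  by (auto simp: in_keys_iff coef_monomial count_list_0_iff)

lemma mdeg_monomial: "mdeg (monomial zs) = length zs"
  by (induction zs) simp_all

text \<open>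
  Giving the variable at row \<open>i\<close> and column \<open>j\<close> the weight \<open>i * j\<close> has the effect of a diagonal term order:
  among all ways to distribute given rows over given columns, the increasing one is heaviest.
\<close>

definition weight :: "monom \<Rightarrow> nat" where
  "weight t = (\<Sum>v\<in>supp t. fst v * snd v * coef t v)"

lemma weight_superset: "finite A \<Longrightarrow> supp t \<subseteq> A \<Longrightarrow> weight t = (\<Sum>v\<in>A. fst v * snd v * coef t v)"
  unfolding weight_def by (rule sum.mono_neutral_left) (auto simp: in_keys_iff)

lemma weight_zero [simp]: "weight 0 = 0"
  by (simp add: weight_def)

lemma weight_add [simp]: "weight (s + t) = weight s + weight t"
proof -
  have "weight (s + t) = (\<Sum>v\<in>supp s \<union> supp t. fst v * snd v * coef (s + t) v)"
    by (rule weight_superset) (simp_all add: keys_add)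
  also have "\<dots> = weight s + weight t"
    by (simp add: lookup_add algebra_simps sum.distrib weight_superset[of "supp s \<union> supp t"])
  finally show ?thesis .
qed

lemma weight_single [simp]: "weight (single (i, j) k) = i * j * k"
  by (simp add: weight_def)

lemma weight_monomial_zip: "length xs = length ys \<Longrightarrow> weight (monomial (zip xs ys)) = dot xs ys"
  by (induction xs ys rule: list_induct2) simp_all

subsection \<open>The monomials of a maximal minor\<close>

definition row_monomial :: "nat \<Rightarrow> (nat \<Rightarrow> nat) \<Rightarrow> monom" where
  "row_monomial m f = monomial (map (\<lambda>i. (i, f i)) [1..<Suc m])"

lemma coef_row_monomial: "coef (row_monomial m f) (i, j) = (if i \<in> {1..m} \<and> f i = j then 1 else 0)"
proof -
  have "count_list (map (\<lambda>i. (i, f i)) [1..<Suc m]) (i, j) = (if i \<in> {1..m} \<and> f i = j then 1 else 0)"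
    by (induction m) auto
  then show ?thesis
    by (simp add: row_monomial_def coef_monomial del: upt_Suc)
qed

lemma supp_row_monomial: "supp (row_monomial m f) = (\<lambda>i. (i, f i)) ` {1..m}"
  by (auto simp: row_monomial_def supp_monomial)

lemma mdeg_row_monomial [simp]: "mdeg (row_monomial m f) = m"
  by (simp add: row_monomial_def mdeg_monomial)

lemma row_monomial_cong: "(\<And>i. i \<in> {1..m} \<Longrightarrow> f i = g i) \<Longrightarrow> row_monomial m f = row_monomial m g"
  unfolding row_monomial_def by (rule arg_cong[of _ _ monomial], rule map_cong) auto

lemma row_monomial_eq_iff: "row_monomial m f = row_monomial m g \<longleftrightarrow> (\<forall>i\<in>{1..m}. f i = g i)"
proof
  assume eq: "row_monomial m f = row_monomial m g"
  show "\<forall>i\<in>{1..m}. f i = g i"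
  proof
    fix i assume "i \<in> {1..m}"
    then have "coef (row_monomial m g) (i, f i) = 1"
      unfolding eq[symmetric] by (simp add: coef_row_monomial)
    then show "f i = g i" by (metis coef_row_monomial zero_neq_one)
  qed
qed (auto intro: row_monomial_cong)

text \<open>
  Columns come as a list, since positions in the list carry the signs in the relations between minors.
\<close>

definition minor :: "nat \<Rightarrow> nat list \<Rightarrow> 'k::field mpol" where
  "minor m js = det (mat m m (\<lambda>(i, k). var (Suc i) (js ! k)))"

lemma maximal_minor_eq: "sorted_wrt (<) js \<Longrightarrow> maximal_minor m (set js) = minor m js"
  by (simp add: maximal_minor_def minor_def strict_sorted_iff sorted_list_of_set.idem_if_sorted_distinct)

lemma minor_expansion:
  "minor m js = (\<Sum>p | p permutes {0..<m}. single (row_monomial m (\<lambda>i. js ! p (i - 1))) (signof p) :: 'k::field mpol)"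
proof -
  have prod: "(\<Prod>i\<in>{0..<l}. single (single (Suc i, f (Suc i)) 1) (1::'k)) = single (row_monomial l f) 1" for l and f :: "nat \<Rightarrow> nat"
    by (induction l) (auto simp: row_monomial_def mult_single add.commute)
  have sgn: "signof p * single t 1 = (single t (signof p) :: 'k mpol)" for p :: "nat \<Rightarrow> nat" and t
    by (auto simp: sign_def single_uminus)
  have "minor m js = (\<Sum>p | p permutes {0..<m}. signof p * (\<Prod>i\<in>{0..<m}. var (Suc i) (js ! p i)) :: 'k mpol)"
    unfolding minor_def det_def by (auto intro!: sum.cong prod.cong simp: permutes_in_image)
  also have "\<dots> = (\<Sum>p | p permutes {0..<m}. signof p * single (row_monomial m (\<lambda>i. js ! p (i - 1))) 1)"
    by (intro sum.cong refl) (simp add: var_def prod[of "\<lambda>i. js ! _ (i - 1)", simplified])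
  finally show ?thesis by (simp only: sgn)
qed

lemma bij_betw_nth_perm:
  assumes "distinct js" "length js = m" "bij_betw f {1..m} (set js)"
  shows "\<exists>p. p permutes {0..<m} \<and> (\<forall>i\<in>{1..m}. f i = js ! p (i - 1))"
proof -
  have nth: "bij_betw ((!) js) {0..<m} (set js)"
    using bij_betw_nth[OF assms(1), of "{0..<m}" "set js"] assms(2) by (auto simp: atLeast0LessThan)
  let ?q = "\<lambda>i. inv_into {0..<m} ((!) js) (f (Suc i))"
  have suc: "bij_betw Suc {0..<m} {1..m}"
    by (rule bij_betwI[of _ _ _ "\<lambda>i. i - 1"]) auto
  have q: "bij_betw ?q {0..<m} {0..<m}"
    using bij_betw_trans[OF bij_betw_trans[OF suc assms(3)] bij_betw_inv_into[OF nth]] by (simp add: comp_def)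
  let ?p = "\<lambda>i. if i \<in> {0..<m} then ?q i else i"
  have "bij_betw ?p {0..<m} {0..<m}"
    using q by (rule bij_betw_cong[THEN iffD1, rotated]) simp
  then have "?p permutes {0..<m}"
    by (rule bij_imp_permutes) auto
  moreover have "f i = js ! ?p (i - 1)" if "i \<in> {1..m}" for i
  proof -
    have "f i \<in> (!) js ` {0..<m}"
      using assms(3) nth that by (auto simp: bij_betw_def)
    moreover have "i - 1 < m" using that by auto
    ultimately show ?thesis using that by (simp add: f_inv_into_f)
  qed
  ultimately show ?thesis by blast
qed

text \<open>
  Distinct permutations contribute distinct monomials, so nothing cancels, in any characteristic.
\<close>

lemma supp_minor:
  fixes js :: "nat list"
  assumes "distinct js" "length js = m"
  shows "supp (minor m js :: 'k::field mpol) = row_monomial m ` {f. bij_betw f {1..m} (set js)}" (is "?l = ?r")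
proof (intro equalityI subsetI)
  let ?t = "\<lambda>p. row_monomial m (\<lambda>i. js ! p (i - 1))"
  have nth: "bij_betw ((!) js) {0..<m} (set js)"
    using bij_betw_nth[OF assms(1), of "{0..<m}" "set js"] assms(2) by (auto simp: atLeast0LessThan)
  fix t assume "t \<in> ?l"
  then obtain p where p: "p permutes {0..<m}" "t = ?t p"
    unfolding minor_expansion using keys_sum by (fastforce split: if_splits)
  have "bij_betw (\<lambda>i. i - 1) {1..m} {0..<m}"
    by (rule bij_betwI[of _ _ _ Suc]) auto
  from bij_betw_trans[OF bij_betw_trans[OF this permutes_imp_bij[OF p(1)]] nth]
  have "bij_betw (\<lambda>i. js ! p (i - 1)) {1..m} (set js)" by (simp add: comp_def)
  with p show "t \<in> ?r" by blast
next
  let ?t = "\<lambda>p. row_monomial m (\<lambda>i. js ! p (i - 1))"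
  fix t assume "t \<in> ?r"
  then obtain f where f: "bij_betw f {1..m} (set js)" "t = row_monomial m f" by blast
  obtain p where p: "p permutes {0..<m}" "\<And>i. i \<in> {1..m} \<Longrightarrow> f i = js ! p (i - 1)"
    using bij_betw_nth_perm[OF assms f(1)] by blast
  have t: "t = ?t p" using f(2) p(2) by (auto intro: row_monomial_cong)
  have inj: "p' = p" if "p' permutes {0..<m}" "?t p' = t" for p'
  proof
    fix i
    show "p' i = p i"
    proof (cases "i < m")
      case True
      have "js ! p' (Suc i - 1) = js ! p (Suc i - 1)"
        using that(2) True unfolding t row_monomial_eq_iff by (metis Suc_leI atLeastAtMost_iff le_add1 plus_1_eq_Suc)
      moreover have "p' i < m" "p i < m"
        using True that(1) p(1) permutes_in_image by fastforce+
      ultimately show ?thesis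
        using assms by (simp add: nth_eq_iff_index_eq)
    next
      case False
      then show ?thesis using that(1) p(1) by (simp add: permutes_def)
    qed
  qed
  have "coef (minor m js :: 'k mpol) t = (\<Sum>p' | p' permutes {0..<m}. if p' = p then signof p else 0)"
    unfolding minor_expansion lookup_sum
    by (intro sum.cong refl) (auto simp: lookup_single when_def t dest: inj[unfolded t])
  also have "\<dots> = signof p"
    using p(1) by (simp add: finite_permutations)
  finally show "t \<in> ?l"
    by (simp add: in_keys_iff sign_def)
qed

lemma supp_maximal_minor:
  assumes "finite \<sigma>" "card \<sigma> = m"
  shows "supp (maximal_minor m \<sigma> :: 'k::field mpol) = row_monomial m ` {f. bij_betw f {1..m} \<sigma>}"
proof -
  have "maximal_minor m (set (sorted_list_of_set \<sigma>)) = (minor m (sorted_list_of_set \<sigma>) :: 'k mpol)"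
    using maximal_minor_eq[of "sorted_list_of_set \<sigma>" m] by simp
  then show ?thesis
    using supp_minor[of "sorted_list_of_set \<sigma>" m] assms by simp
qed

lemma minor_polys:
  assumes "distinct js" "length js = m" "set js \<subseteq> {1..n}"
  shows "minor m js \<in> polys m n"
  unfolding in_polys_iff supp_minor[OF assms(1,2)]
  using assms(3) by (auto simp: supp_row_monomial bij_betw_def)

lemma minor_homogeneous:
  assumes "distinct js" "length js = m" "t \<in> supp (minor m js :: 'k::field mpol)"
  shows "mdeg t = m"
  using assms(3) unfolding supp_minor[OF assms(1,2)] by auto

text \<open>By the rearrangement inequality, the diagonal term of a minor is the only one of largest weight.\<close>

lemma minor_leading_term:
  assumes "sorted_wrt (<) js" "length js = m"
  shows "monomial (zip [1..<Suc m] js) \<in> supp (minor m js :: 'k::field mpol)"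
    and "t \<in> supp (minor m js :: 'k::field mpol) \<Longrightarrow> t \<noteq> monomial (zip [1..<Suc m] js) \<Longrightarrow>
      weight t < weight (monomial (zip [1..<Suc m] js))"
proof -
  have js: "distinct js" "sorted js" using assms(1) by (simp_all add: strict_sorted_iff)
  have zip: "map (\<lambda>i. (i, f i)) [1..<Suc m] = zip [1..<Suc m] (map f [1..<Suc m])" for f :: "nat \<Rightarrow> nat"
    by (induction m) auto
  have map_js: "map (\<lambda>i. js ! (i - 1)) [1..<Suc m] = js"
    by (rule nth_equalityI) (use assms(2) in \<open>auto simp del: upt_Suc\<close>)
  have "bij_betw (\<lambda>i. i - 1) {1..m} {0..<m}"
    by (rule bij_betwI[of _ _ _ Suc]) auto
  moreover have "bij_betw ((!) js) {0..<m} (set js)"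
    using bij_betw_nth[OF js(1), of "{0..<m}" "set js"] assms(2) by (auto simp: atLeast0LessThan)
  ultimately have bij: "bij_betw (\<lambda>i. js ! (i - 1)) {1..m} (set js)"
    using bij_betw_trans by (fastforce simp: comp_def)
  have diag: "row_monomial m (\<lambda>i. js ! (i - 1)) = monomial (zip [1..<Suc m] js)"
    unfolding row_monomial_def zip map_js ..
  with bij show "monomial (zip [1..<Suc m] js) \<in> supp (minor m js :: 'k mpol)"
    unfolding supp_minor[OF js(1) assms(2)] by force
  assume t: "t \<in> supp (minor m js :: 'k mpol)" "t \<noteq> monomial (zip [1..<Suc m] js)"
  then obtain f where f: "bij_betw f {1..m} (set js)" "t = row_monomial m f"
    unfolding supp_minor[OF js(1) assms(2)] by blast
  let ?fs = "map f [1..<Suc m]"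
  have upt: "set [1..<Suc m] = {1..m}" by auto
  have "distinct ?fs" "set ?fs = set js"
    unfolding distinct_map set_map upt using f(1) by (simp_all add: bij_betw_def del: upt_Suc)
  then have sort: "sort ?fs = js"
    using js by (intro sorted_distinct_set_unique) (simp_all del: upt_Suc)
  have t_zip: "t = monomial (zip [1..<Suc m] ?fs)"
    unfolding f(2) row_monomial_def zip ..
  have "?fs \<noteq> sort ?fs"
    using t(2) unfolding sort t_zip by (auto simp del: upt_Suc)
  then have less: "dot ?fs [1..<Suc m] < dot js [1..<Suc m]"
    using dot_sort[of "[1..<Suc m]" ?fs] unfolding sort by (simp del: upt_Suc)
  have comm: "dot xs ys = dot ys xs" for xs ys :: "nat list"
    by (induction xs ys rule: list_induct2') (simp_all add: mult.commute)
  have "weight t = dot [1..<Suc m] ?fs"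
    unfolding t_zip by (rule weight_monomial_zip) simp
  moreover have "weight (monomial (zip [1..<Suc m] js)) = dot [1..<Suc m] js"
    by (rule weight_monomial_zip) (simp add: assms(2))
  ultimately show "weight t < weight (monomial (zip [1..<Suc m] js))"
    using less comm by metis
qed

definition delete_nth :: "nat \<Rightarrow> 'a list \<Rightarrow> 'a list" where
  "delete_nth p xs = take p xs @ drop (Suc p) xs"

lemma length_delete_nth [simp]: "p < length xs \<Longrightarrow> length (delete_nth p xs) = length xs - 1"
  by (simp add: delete_nth_def)

lemma nth_delete_nth:
  assumes "p < length xs" "k < length xs - 1"
  shows "delete_nth p xs ! k = xs ! (if k < p then k else Suc k)"
  using assms by (auto simp: delete_nth_def nth_append min_def)

text \<open>Laplace expansion of a determinant with a repeated row.\<close>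

lemma minor_relation:
  assumes "length js = Suc m" "i \<in> {1..m}"
  shows "(\<Sum>p<Suc m. (- 1) ^ p * var i (js ! p) * minor m (delete_nth p js)) = (0 :: 'k::field mpol)"
proof -
  define A where "A = mat (Suc m) (Suc m) (\<lambda>(r, k). var (if r = 0 then i else r) (js ! k) :: 'k mpol)"
  have A: "A \<in> carrier_mat (Suc m) (Suc m)" by (simp add: A_def)
  have "det A = 0"
    by (rule det_identical_rows[OF A, of 0 i]) (use assms(2) in \<open>auto simp: A_def\<close>)
  moreover have "mat_delete A 0 p = mat m m (\<lambda>(r, k). var (Suc r) (delete_nth p js ! k))" if "p < Suc m" for p
    using that assms(1) by (auto simp: A_def mat_delete_def nth_delete_nth)
  ultimately show ?thesis
    unfolding laplace_expansion_row[OF A, of 0, simplified] cofactor_def minor_def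
    using assms(1) by (simp add: A_def mult.assoc mult.left_commute)
qed

section \<open>Exactness from a matching of leading terms\<close>

definition entry :: "('b \<Rightarrow>\<^sub>0 'k::field mpol) \<Rightarrow> monom \<times> 'b \<Rightarrow> 'k" where
  "entry u x = coef (coef u (snd x)) (fst x)"

definition entries :: "('b \<Rightarrow>\<^sub>0 'k::field mpol) \<Rightarrow> (monom \<times> 'b) set" where
  "entries u = {x. entry u x \<noteq> 0}"

definition term_vector :: "monom \<times> 'b \<Rightarrow> ('b \<Rightarrow>\<^sub>0 'k::field mpol)" where
  "term_vector x = single (snd x) (single (fst x) 1)"

definition terms :: "nat \<Rightarrow> nat \<Rightarrow> 'b set \<Rightarrow> (monom \<times> 'b) set" where
  "terms m n B = {(t, b). b \<in> B \<and> supp t \<subseteq> {1..m} \<times> {1..n}}"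

lemma entry_zero [simp]: "entry 0 x = 0"
  by (simp add: entry_def)

lemma entry_add: "entry (u + v) x = entry u x + entry v x"
  by (simp add: entry_def lookup_add)

lemma entry_diff: "entry (u - v) x = entry u x - entry v x"
  by (simp add: entry_def lookup_minus)

lemma entry_sum: "entry (sum f A) x = (\<Sum>a\<in>A. entry (f a) x)"
  by (induction A rule: infinite_finite_induct) (auto simp: entry_add)

lemma entry_scale_const: "entry (scale (single 0 c) u) x = c * entry u x"
  using coef_single_mult_add[of 0 c _ "fst x"] by (simp add: entry_def)

lemma entry_term_vector: "entry (term_vector x) y = (if x = y then 1 else 0)"
  by (cases x, cases y) (auto simp: entry_def term_vector_def lookup_single when_def)

lemma finite_entries [simp]: "finite (entries u)"
proof (rule finite_subset)
  show "entries u \<subseteq> (\<Union>b\<in>supp u. (\<lambda>t. (t, b)) ` supp (coef u b))"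
  proof
    fix x assume x: "x \<in> entries u"
    obtain t b where "x = (t, b)" by (cases x)
    with x have "coef (coef u b) t \<noteq> 0" by (simp add: entries_def entry_def)
    then have "b \<in> supp u" "t \<in> supp (coef u b)" by (auto simp: in_keys_iff)
    then show "x \<in> (\<Union>b\<in>supp u. (\<lambda>t. (t, b)) ` supp (coef u b))" by (auto simp: \<open>x = (t, b)\<close>)
  qed
qed simp

lemma vector_eqI: "(\<And>x. entry u x = entry v x) \<Longrightarrow> u = v"
  by (rule poly_mapping_eqI, rule poly_mapping_eqI) (metis entry_def fst_conv snd_conv)

lemma entries_sum_terms: "(\<Sum>x\<in>entries u. scale (single 0 (entry u x)) (term_vector x)) = u"
proof (rule vector_eqI)
  fix y
  have "entry (\<Sum>x\<in>entries u. scale (single 0 (entry u x)) (term_vector x)) y =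
      (\<Sum>x\<in>entries u. if x = y then entry u x else 0)"
    unfolding entry_sum entry_scale_const entry_term_vector by (intro sum.cong) auto
  also have "\<dots> = (\<Sum>x\<in>entries u. if y = x then entry u x else 0)"
    by (intro sum.cong) auto
  also have "\<dots> = entry u y"
    by (subst sum.delta'[OF finite_entries]) (simp add: entries_def)
  finally show "entry (\<Sum>x\<in>entries u. scale (single 0 (entry u x)) (term_vector x)) y = entry u y" .
qed

lemma gpart_iff_entries: "u \<in> gpart m n B g UNIV \<longleftrightarrow> entries u \<subseteq> terms m n B"
proof
  assume u: "u \<in> gpart m n B g UNIV"
  show "entries u \<subseteq> terms m n B"
  proof
    fix x assume x: "x \<in> entries u"
    obtain t b where tb: "x = (t, b)" by (cases x)
    with x have "coef (coef u b) t \<noteq> 0" by (simp add: entries_def entry_def)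
    then have "b \<in> supp u" "t \<in> supp (coef u b)" by (auto simp: in_keys_iff)
    then show "x \<in> terms m n B"
      using gpartD(1,3)[OF u] by (auto simp: tb terms_def)
  qed
next
  assume e: "entries u \<subseteq> terms m n B"
  have mem: "(t, b) \<in> terms m n B" if "t \<in> supp (coef u b)" for t b
    using e that by (auto simp: entries_def entry_def in_keys_iff)
  show "u \<in> gpart m n B g UNIV"
  proof (rule gpartI)
    fix b assume "b \<in> supp u"
    then obtain t where "t \<in> supp (coef u b)" by (metis in_keys_iff keys_eq_empty ex_in_conv)
    then show "b \<in> B" using mem by (auto simp: terms_def)
  next
    fix b t assume "t \<in> supp (coef u b)"
    then show "supp t \<subseteq> {1..m} \<times> {1..n}"
      using mem by (simp add: terms_def)
  qed simp
qed

lemma gpart_term_vector: "x \<in> terms m n B \<Longrightarrow> term_vector x \<in> gpart m n B g UNIV"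
  unfolding gpart_iff_entries by (auto simp: entries_def entry_term_vector)

lemma exists_maximal_image:
  assumes "wf R" "finite A" "A \<noteq> {}"
  shows "\<exists>x\<in>A. \<forall>y\<in>A. (x, y) \<notin> R"
proof -
  have "acyclic (R \<inter> A \<times> A)"
    using wf_acyclic[OF assms(1)] by (rule acyclic_subset) simp
  then have wfA: "wf ((R \<inter> A \<times> A)\<inverse>)"
    using assms(2) by (intro finite_acyclic_wf_converse) auto
  obtain a where "a \<in> A" using assms(3) by blast
  from wf_eq_minimal[THEN iffD1, rule_format, OF wfA this]
  obtain z where "z \<in> A" "\<And>y. (y, z) \<in> (R \<inter> A \<times> A)\<inverse> \<Longrightarrow> y \<notin> A"
    by blast
  then show ?thesis by (blast intro: converseI)
qed

text \<open>
  Gaussian elimination over the field, with the terms (monomial times basis element) as basis. Every term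
  outside \<open>D1\<close> is the leading term of a boundary, so by well-founded induction each chain
  is congruent, modulo boundaries, to a combination of terms in \<open>D1\<close>. Such a combination is a cycle
  only if it is zero: boundaries of terms in \<open>D1\<close> have distinct leading terms, and a maximal one
  of these cannot be cancelled.
\<close>

theorem exact_of_leading_terms:
  fixes d1 d0 :: "'b \<Rightarrow> ('b \<Rightarrow>\<^sub>0 'k::field mpol)"
    and \<phi>1 \<phi>2 :: "monom \<times> 'b \<Rightarrow> monom \<times> 'b"
  assumes wf: "wf R"
    and sub: "D2 \<subseteq> terms m n B2"
    and d1: "\<And>b. b \<in> B2 \<Longrightarrow> d1 b \<in> gpart m n B1 g1 {g2 b}"
    and dd: "\<And>b. b \<in> B2 \<Longrightarrow> lin_ext d0 (d1 b) = 0"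
    and lead1: "\<And>x. x \<in> D1 \<Longrightarrow> \<phi>1 x \<in> entries (lin_ext d0 (term_vector x))"
      "\<And>x y. x \<in> D1 \<Longrightarrow> y \<in> entries (lin_ext d0 (term_vector x)) \<Longrightarrow> y = \<phi>1 x \<or> (y, \<phi>1 x) \<in> R"
    and lead2: "\<And>x. x \<in> D2 \<Longrightarrow> \<phi>2 x \<in> entries (lin_ext d1 (term_vector x))"
      "\<And>x y. x \<in> D2 \<Longrightarrow> y \<in> entries (lin_ext d1 (term_vector x)) \<Longrightarrow> y = \<phi>2 x \<or> (y, \<phi>2 x) \<in> R"
    and inj: "inj_on \<phi>1 D1"
    and surj: "terms m n B1 - D1 \<subseteq> \<phi>2 ` D2"
    and u: "u \<in> gpart m n B1 g1 UNIV" "lin_ext d0 u = 0"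
  shows "u \<in> lin_ext d1 ` gpart m n B2 g2 UNIV"
proof -
  let ?V2 = "gpart m n B2 g2 UNIV"
  define G where "G v \<longleftrightarrow> (\<exists>w\<in>?V2. entries (v - lin_ext d1 w) \<subseteq> D1)" for v
  have G_zero: "G 0"
    unfolding G_def by (rule bexI[of _ 0]) (auto simp: entries_def)
  have G_add: "G (v + v')" if Gv: "G v" "G v'" for v v'
  proof -
    obtain w w' where w: "w \<in> ?V2" "w' \<in> ?V2"
      "entries (v - lin_ext d1 w) \<subseteq> D1" "entries (v' - lin_ext d1 w') \<subseteq> D1"
      using Gv unfolding G_def by blast
    have "entries (v + v' - lin_ext d1 (w + w')) \<subseteq>
        entries (v - lin_ext d1 w) \<union> entries (v' - lin_ext d1 w')"
      by (auto simp: entries_def entry_add entry_diff lin_ext_add)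
    with w show ?thesis
      unfolding G_def by (intro bexI[of _ "w + w'"] gpart_add) auto
  qed
  have G_scale: "G (scale (single 0 c) v)" if Gv: "G v" for c v
  proof -
    obtain w where w: "w \<in> ?V2" "entries (v - lin_ext d1 w) \<subseteq> D1"
      using Gv unfolding G_def by blast
    have "entries (scale (single 0 c) v - lin_ext d1 (scale (single 0 c) w)) \<subseteq> entries (v - lin_ext d1 w)"
      by (auto simp: entries_def entry_diff entry_scale_const lin_ext_scale)
    with w show ?thesis
      unfolding G_def by (intro bexI[of _ "scale (single 0 c) w"] gpart_scale_const) auto
  qed
  have G_entries: "G v" if "\<And>x. x \<in> entries v \<Longrightarrow> G (term_vector x)" for v
  proof -
    have "G (\<Sum>x\<in>A. scale (single 0 (entry v x)) (term_vector x))" if "finite A" "A \<subseteq> entries v" for A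
      using that
    proof (induction A)
      case (insert x A)
      then have "G (scale (single 0 (entry v x)) (term_vector x))"
        using \<open>\<And>x. x \<in> entries v \<Longrightarrow> G (term_vector x)\<close> by (intro G_scale) auto
      with insert show ?case by (simp add: G_add)
    qed (simp add: G_zero)
    from this[OF finite_entries order_refl] show ?thesis
      by (simp only: entries_sum_terms)
  qed
  have G_term: "x \<in> terms m n B1 \<Longrightarrow> G (term_vector x)" for x
    using wf
  proof (induction x rule: wf_induct_rule)
    case (less x)
    show ?case
    proof (cases "x \<in> D1")
      case True
      then show ?thesis
        unfolding G_def by (intro bexI[of _ 0]) (auto simp: entries_def entry_term_vector)
    next
      case False
      then obtain y where y: "y \<in> D2" "x = \<phi>2 y" using less.prems surj by blast
      let ?dy = "lin_ext d1 (term_vector y)"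
      define c where "c = inverse (entry ?dy x)"
      define v where "v = term_vector x - lin_ext d1 (scale (single 0 c) (term_vector y))"
      have ty: "term_vector y \<in> ?V2"
        using y(1) sub by (intro gpart_term_vector) auto
      have dy: "entries ?dy \<subseteq> terms m n B1"
        using gpart_lin_ext[OF ty d1] unfolding gpart_iff_entries .
      have nz: "entry ?dy x \<noteq> 0"
        using lead2(1)[OF y(1)] by (simp add: entries_def y(2))
      have v: "entry v z = (if z = x then 0 else - c * entry ?dy z)" for z
        using nz by (auto simp: v_def entry_diff entry_term_vector lin_ext_scale entry_scale_const c_def)
      have "G v"
      proof (rule G_entries)
        fix z assume "z \<in> entries v"
        then have "z \<noteq> x" "z \<in> entries ?dy"
          by (auto simp: entries_def v split: if_splits)
        then show "G (term_vector z)"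
          using lead2(2)[OF y(1), of z] y(2) dy by (intro less.IH) auto
      qed
      then obtain w where w: "w \<in> ?V2" "entries (v - lin_ext d1 w) \<subseteq> D1"
        unfolding G_def by blast
      have "term_vector x - lin_ext d1 (scale (single 0 c) (term_vector y) + w) = v - lin_ext d1 w"
        by (simp add: v_def lin_ext_add)
      with w ty show ?thesis
        unfolding G_def
        by (intro bexI[of _ "scale (single 0 c) (term_vector y) + w"] gpart_add gpart_scale_const) auto
    qed
  qed
  have "entries u \<subseteq> terms m n B1"
    using u(1) unfolding gpart_iff_entries .
  then have "G u"
    by (intro G_entries[of u] G_term) blast
  then obtain w where w: "w \<in> ?V2" "entries (u - lin_ext d1 w) \<subseteq> D1"
    unfolding G_def by blast
  define z where "z = u - lin_ext d1 w"
  have dz: "lin_ext d0 z = 0"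
  proof -
    have "lin_ext d0 (lin_ext d1 w) = 0"
      unfolding lin_ext_lin_ext by (rule lin_ext_zero_fun) (rule dd[OF gpartD(1)[OF w(1)]])
    then show ?thesis by (simp add: z_def lin_ext_diff u(2))
  qed
  have "entries z = {}"
  proof (rule ccontr)
    assume "entries z \<noteq> {}"
    then obtain x where x: "x \<in> entries z" "\<forall>y\<in>entries z. (\<phi>1 x, \<phi>1 y) \<notin> R"
      using exists_maximal_image[OF wf, of "\<phi>1 ` entries z"] by auto
    have zD: "entries z \<subseteq> D1" using w(2) by (simp add: z_def)
    have other: "entry (lin_ext d0 (term_vector y)) (\<phi>1 x) = 0" if "y \<in> entries z" "y \<noteq> x" for y
    proof (rule ccontr)
      assume "entry (lin_ext d0 (term_vector y)) (\<phi>1 x) \<noteq> 0"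
      then have "\<phi>1 x = \<phi>1 y \<or> (\<phi>1 x, \<phi>1 y) \<in> R"
        using lead1(2)[of y "\<phi>1 x"] that zD by (auto simp: entries_def)
      then show False
        using x that inj zD by (auto dest: inj_onD)
    qed
    have "lin_ext d0 z = (\<Sum>y\<in>entries z. scale (single 0 (entry z y)) (lin_ext d0 (term_vector y)))"
      by (subst entries_sum_terms[of z, symmetric]) (simp only: lin_ext_sum lin_ext_scale)
    then have "entry (lin_ext d0 z) (\<phi>1 x) =
        (\<Sum>y\<in>entries z. entry z y * entry (lin_ext d0 (term_vector y)) (\<phi>1 x))"
      by (simp only: entry_sum entry_scale_const)
    also have "\<dots> = (\<Sum>y\<in>{x}. entry z y * entry (lin_ext d0 (term_vector y)) (\<phi>1 x))"
      using x(1) other by (intro sum.mono_neutral_right) auto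
    also have "\<dots> \<noteq> 0"
      using x(1) lead1(1)[of x] zD by (auto simp: entries_def)
    finally show False by (simp add: dz)
  qed
  then have "z = 0"
    by (intro vector_eqI) (auto simp: entries_def)
  then have "u = lin_ext d1 w" by (simp add: z_def)
  with w(1) show ?thesis by blast
qed

section \<open>Staircases\<close>

lemma dot_delete_nth:
  assumes "p < length js" "length xs = length js"
  shows "dot xs js = xs ! p * js ! p + dot (delete_nth p xs) (delete_nth p js)"
  using assms
proof (induction xs js arbitrary: p rule: list_induct2')
  case (4 x xs y ys)
  then show ?case by (cases p) (auto simp: delete_nth_def)
qed (auto simp: delete_nth_def)

lemma mset_delete_nth: "p < length xs \<Longrightarrow> add_mset (xs ! p) (mset (delete_nth p xs)) = mset xs"
  unfolding delete_nth_def
  by (subst (3) id_take_nth_drop[of p xs]) auto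

lemma delete_nth_Cons [simp]: "delete_nth 0 (x # xs) = xs" "delete_nth (Suc p) (x # xs) = x # delete_nth p xs"
  by (simp_all add: delete_nth_def)

lemma set_delete_nth: "set (delete_nth p xs) \<subseteq> set xs"
  by (auto simp: delete_nth_def dest: in_set_takeD in_set_dropD)

lemma sorted_wrt_delete_nth: "sorted_wrt P xs \<Longrightarrow> sorted_wrt P (delete_nth p xs)"
proof (induction xs arbitrary: p)
  case (Cons x xs)
  then show ?case
    using set_delete_nth[of _ xs] by (cases p) auto
qed (simp add: delete_nth_def)

lemma delete_nth_eq_remove1:
  assumes "sorted ss" "p < length ss"
  shows "delete_nth p ss = remove1 (ss ! p) ss"
proof -
  have "sorted (delete_nth p ss)"
    using assms(1) by (rule sorted_wrt_delete_nth)
  moreover have "mset (delete_nth p ss) = mset (remove1 (ss ! p) ss)"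
    using mset_delete_nth[OF assms(2)] by (metis add_mset_remove_trivial mset_remove1)
  ultimately show ?thesis
    using assms(1) by (metis properties_for_sort sorted_remove1 sorted_sort_id)
qed

text \<open>
  Rearrangement, applied to the list that has row \<open>i\<close> at position \<open>p\<close> and the remaining rows in order:
  sorting it gives back \<open>ss\<close>, and it differs from \<open>ss\<close> if \<open>ss\<close> has another row at \<open>p\<close>.
\<close>

lemma dot_remove_row:
  assumes "sorted ss" "sorted_wrt (<) js" "length ss = length js" "p < length js" "i \<in> set ss"
  shows "i * js ! p + dot (remove1 i ss) (delete_nth p js) \<le> dot ss js"
    and "ss ! p \<noteq> i \<Longrightarrow> i * js ! p + dot (remove1 i ss) (delete_nth p js) < dot ss js"
proof -
  let ?r = "remove1 i ss"
  let ?fs = "take p ?r @ i # drop p ?r"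
  have len: "length ?r = length ss - 1"
    using assms(5) by (simp add: length_remove1)
  have p: "p \<le> length ?r" using assms len by simp
  have "length ?fs = length js" using p len assms(3,4) by simp
  moreover have "delete_nth p ?fs = ?r" "?fs ! p = i"
    using p by (auto simp: delete_nth_def nth_append)
  ultimately have dot: "dot ?fs js = i * js ! p + dot ?r (delete_nth p js)"
    using dot_delete_nth[of p js ?fs] assms(4) by simp
  have "mset ?fs = mset (take p ?r @ drop p ?r) + {#i#}"
    unfolding mset_append by simp
  also have "\<dots> = mset ss"
    using assms(5) by simp
  finally have sort: "sort ?fs = ss"
    using assms(1) by (metis properties_for_sort)
  show "i * js ! p + dot ?r (delete_nth p js) \<le> dot ss js"
    using dot_sort[OF assms(2), of ?fs] sort dot \<open>length ?fs = length js\<close> by simp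
  show "i * js ! p + dot ?r (delete_nth p js) < dot ss js" if "ss ! p \<noteq> i"
  proof -
    have "?fs \<noteq> sort ?fs" using that \<open>?fs ! p = i\<close> unfolding sort by metis
    then show ?thesis
      using dot_sort[OF assms(2), of ?fs] sort dot \<open>length ?fs = length js\<close> by simp
  qed
qed

lemma monomial_delete_nth:
  assumes "p < length js" "length ss = length js"
  shows "monomial (zip ss js) = single (ss ! p, js ! p) 1 + monomial (zip (delete_nth p ss) (delete_nth p js))"
proof -
  have "delete_nth p (zip ss js) = zip (delete_nth p ss) (delete_nth p js)"
    using assms by (simp add: delete_nth_def take_zip drop_zip)
  moreover have "mset (zip ss js) = mset ((ss ! p, js ! p) # delete_nth p (zip ss js))"
    using mset_delete_nth[of p "zip ss js"] assms by simp
  ultimately show ?thesis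
    using monomial_mset[of "zip ss js" "(ss ! p, js ! p) # delete_nth p (zip ss js)"] by simp
qed

text \<open>
  A basis element of the Eagon-Northcott complex is a set of columns together with a multiset of rows of
  the same size in which every row occurs. Both are kept as sorted lists, so that pairing
  entries at equal positions gives a staircase of matrix positions going down and to the right.
\<close>

type_synonym staircase = "nat list \<times> nat list"

definition staircases :: "nat \<Rightarrow> nat \<Rightarrow> nat \<Rightarrow> staircase set" where
  "staircases m n N = {(ss, js). sorted ss \<and> set ss = {1..m} \<and> length ss = N \<and>
     sorted_wrt (<) js \<and> set js \<subseteq> {1..n} \<and> length js = N}"

definition repeated :: "nat list \<Rightarrow> nat set" where
  "repeated ss = {i. 2 \<le> count (mset ss) i}"

lemma repeated_subset: "repeated ss \<subseteq> set ss"
  by (auto simp: repeated_def) (metis count_greater_eq_one_iff not_less_eq_eq numeral_2_eq_2 set_mset_mset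
    One_nat_def Suc_leD)

lemma finite_repeated [simp]: "finite (repeated ss)"
  by (rule finite_subset[OF repeated_subset]) simp

lemma set_remove1_repeated: "i \<in> repeated ss \<Longrightarrow> set (remove1 i ss) = set ss"
proof -
  assume i: "i \<in> repeated ss"
  then have "i \<in> set ss" using repeated_subset by blast
  then have "x \<in># mset (remove1 i ss) \<longleftrightarrow> x \<in># mset ss" for x
    using i unfolding mset_remove1 in_diff_count by (cases "x = i") (auto simp: repeated_def)
  then show ?thesis
    unfolding set_mset_mset by blast
qed

lemma staircase_delete:
  assumes "(ss, js) \<in> staircases m n (Suc N)" "i \<in> repeated ss" "p < Suc N"
  shows "(remove1 i ss, delete_nth p js) \<in> staircases m n N"
proof -
  have "i \<in> set ss" using assms(2) repeated_subset by blast
  moreover have "sorted_wrt (<) (delete_nth p js)"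
    using assms(1) by (simp add: staircases_def sorted_wrt_delete_nth)
  moreover have "set (delete_nth p js) \<subseteq> {1..n}"
    using assms(1) set_delete_nth[of p js] unfolding staircases_def by blast
  moreover have "set (remove1 i ss) = {1..m}"
    using assms(1) set_remove1_repeated[OF assms(2)] by (simp add: staircases_def)
  ultimately show ?thesis
    using assms(1,3) by (simp add: staircases_def length_remove1 sorted_remove1)
qed

subsection \<open>Pivots\<close>

text \<open>
  A term is a monomial \<open>t\<close> times a staircase. The product of \<open>t\<close> with all positions of the
  staircase may arise from many staircases, and the matching pairs these up. Scanning from
  the top, a column is free at position \<open>q\<close> if \<open>t\<close> offers a variable in the same row strictly between the
  columns at \<open>q - 1\<close> and \<open>q\<close> (column numbers start at \<open>1\<close>, so \<open>0\<close> serves as the column before the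
  first). At the first position where a column is free or the row is repeated, either the leftmost free
  column is pulled from \<open>t\<close> into the staircase, or, if there is none, the position is pushed down
  into \<open>t\<close>; these operations are inverse to each other. A pivot is a place of the second kind.
\<close>

definition free_columns :: "monom \<Rightarrow> nat list \<Rightarrow> nat list \<Rightarrow> nat \<Rightarrow> nat set" where
  "free_columns t ss js q =
     {c. (if q = 0 then 0 else js ! (q - 1)) < c \<and> c < js ! q \<and> (ss ! q, c) \<in> supp t}"

definition step_at :: "nat list \<Rightarrow> nat \<Rightarrow> bool" where
  "step_at ss q \<longleftrightarrow> Suc q < length ss \<and> ss ! Suc q = ss ! q"

definition quiet_before :: "monom \<Rightarrow> nat list \<Rightarrow> nat list \<Rightarrow> nat \<Rightarrow> bool" where
  "quiet_before t ss js q \<longleftrightarrow> (\<forall>l<q. free_columns t ss js l = {} \<and> \<not> step_at ss l)"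

definition pivot :: "monom \<Rightarrow> nat list \<Rightarrow> nat list \<Rightarrow> nat \<Rightarrow> bool" where
  "pivot t ss js q \<longleftrightarrow> quiet_before t ss js q \<and> free_columns t ss js q = {} \<and> step_at ss q"

definition push_down :: "monom \<times> staircase \<Rightarrow> nat \<Rightarrow> monom \<times> staircase" where
  "push_down x q = (case x of (t, ss, js) \<Rightarrow>
     (t + single (ss ! q, js ! q) 1, delete_nth q ss, delete_nth q js))"

lemma pivot_unique: "pivot t ss js q \<Longrightarrow> pivot t ss js q' \<Longrightarrow> q = q'"
  unfolding pivot_def quiet_before_def by (metis nat_neq_iff)

lemma strict_before_step:
  assumes "sorted ss" "\<And>l. l < q \<Longrightarrow> \<not> step_at ss l" "a < b" "b < length ss" "a < q"
  shows "ss ! a < ss ! b"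
proof -
  have "ss ! a \<noteq> ss ! Suc a" using assms(2)[OF assms(5)] assms(3,4) by (auto simp: step_at_def)
  moreover have "ss ! a \<le> ss ! Suc a" "ss ! Suc a \<le> ss ! b"
    using assms by (auto simp: sorted_iff_nth_mono)
  ultimately show ?thesis by simp
qed

lemma repeated_two_positions:
  assumes "ss ! p \<in> repeated ss" "p < length ss"
  shows "\<exists>r<length ss. r \<noteq> p \<and> ss ! r = ss ! p"
proof -
  have "mset ss = add_mset (ss ! p) (mset (delete_nth p ss))"
    using mset_delete_nth[OF assms(2)] by simp
  with assms(1) have "ss ! p \<in># mset (delete_nth p ss)"
    by (simp add: repeated_def count_greater_zero_iff[symmetric] del: count_greater_zero_iff)
  then obtain k where k: "k < length ss - 1" "delete_nth p ss ! k = ss ! p"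
    using assms(2) by (auto simp: in_set_conv_nth)
  then have "ss ! (if k < p then k else Suc k) = ss ! p"
    using nth_delete_nth[OF assms(2) k(1)] by simp
  with k(1) show ?thesis
    by (intro exI[of _ "if k < p then k else Suc k"]) auto
qed

lemma repeated_stepI:
  assumes "step_at ss q"
  shows "ss ! q \<in> repeated ss"
proof -
  have q: "q < length ss" "Suc q < length ss" "ss ! Suc q = ss ! q"
    using assms by (auto simp: step_at_def)
  have "delete_nth q ss ! q = ss ! q"
    using q by (simp add: nth_delete_nth)
  then have "ss ! q \<in> set (delete_nth q ss)"
    using q by (metis length_delete_nth less_diff_conv nth_mem plus_1_eq_Suc add.commute)
  then have "1 \<le> count (mset (delete_nth q ss)) (ss ! q)" by simp
  then show ?thesis
    unfolding repeated_def mset_delete_nth[OF q(1), symmetric] by simp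
qed

lemma repeated_after_quiet:
  assumes "sorted ss" "\<And>l. l < q \<Longrightarrow> \<not> step_at ss l" "ss ! p \<in> repeated ss" "p < length ss"
  shows "q \<le> p"
proof (rule ccontr)
  assume "\<not> q \<le> p"
  obtain r where r: "r < length ss" "r \<noteq> p" "ss ! r = ss ! p"
    using repeated_two_positions[OF assms(3,4)] by blast
  then consider "p < r" | "r < p" by linarith
  then show False
  proof cases
    case 1
    then show False using strict_before_step[of ss q p r, OF assms(1,2) 1 r(1)] \<open>\<not> q \<le> p\<close> r(3) by simp
  next
    case 2
    then show False using strict_before_step[of ss q r p, OF assms(1,2) 2 assms(4)] \<open>\<not> q \<le> p\<close> r(3) by simp
  qed
qed

subsection \<open>The order\<close>

text \<open>
  The first component is the weight of monomial and staircase together. It drops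
  for all terms of a boundary in which the removed row is not the one at the removed column. The columns
  in lexicographic order decide between the remaining ones.
\<close>

definition key :: "monom \<times> staircase \<Rightarrow> nat \<times> nat list" where
  "key x = (case x of (t, ss, js) \<Rightarrow> (weight t + weight (monomial (zip ss js)), js))"

definition key_order :: "((monom \<times> staircase) \<times> (monom \<times> staircase)) set" where
  "key_order = inv_image (less_than <*lex*> lenlex less_than) key"

lemma wf_key_order: "wf key_order"
  unfolding key_order_def by (intro wf_inv_image wf_lex_prod wf_lenlex wf_less_than)

lemma delete_nth_lenlex:
  assumes "sorted_wrt (<) js" "q < p" "p < length (js :: nat list)"
  shows "(delete_nth p js, delete_nth q js) \<in> lenlex less_than"
proof -
  let ?a = "delete_nth p js" and ?b = "delete_nth q js"
  have len: "length ?a = length ?b" "q < length ?a" using assms by auto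
  have eq: "take q ?a = take q ?b"
  proof (rule nth_equalityI)
    fix l assume "l < length (take q ?a)"
    then have "l < q" "l < length js - 1" using len(2) assms by auto
    then show "take q ?a ! l = take q ?b ! l" using assms by (simp add: nth_delete_nth)
  qed (use assms in simp)
  have "?a ! q = js ! q" "?b ! q = js ! Suc q"
    using assms by (auto simp: nth_delete_nth)
  moreover have "js ! q < js ! Suc q"
    using assms by (auto simp: sorted_wrt_iff_nth_less)
  ultimately have less: "?a ! q < ?b ! q" by simp
  have "?a = take q ?a @ ?a ! q # drop (Suc q) ?a" "?b = take q ?a @ ?b ! q # drop (Suc q) ?b"
    using len eq id_take_nth_drop[of q ?a] id_take_nth_drop[of q ?b] by auto
  then have "(?a, ?b) \<in> lex less_than"
    using less len(1) unfolding lex_conv by blast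
  then show ?thesis
    using len(1) by (simp add: lenlex_conv)
qed

text \<open>
  Removing the pivot gives the leading term of the boundary: before the pivot no row is repeated, so a
  competitor of equal weight removes a later column and thus keeps a smaller column at position \<open>q\<close>.
\<close>

lemma pivot_leading:
  assumes x: "(ss, js) \<in> staircases m n N"
    and q: "quiet_before t ss js q" "step_at ss q"
    and pi: "p < N" "i \<in> repeated ss" "(p, i) \<noteq> (q, ss ! q)"
  shows "((t + single (i, js ! p) 1, remove1 i ss, delete_nth p js), push_down (t, ss, js) q) \<in> key_order"
proof -
  have st: "sorted ss" "sorted_wrt (<) js" "length ss = N" "length js = N" "q < N"
    using x q(2) by (auto simp: staircases_def step_at_def)
  have iset: "i \<in> set ss" using pi(2) repeated_subset by blast
  have w: "weight (monomial (zip (remove1 i ss) (delete_nth p js))) = dot (remove1 i ss) (delete_nth p js)"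
    using st pi(1) iset by (intro weight_monomial_zip) (simp add: length_remove1)
  have wq: "weight (monomial (zip ss js)) = ss ! q * js ! q + weight (monomial (zip (delete_nth q ss) (delete_nth q js)))"
    using monomial_delete_nth[of q js ss] st by simp
  have wd: "weight (monomial (zip ss js)) = dot ss js"
    using st by (intro weight_monomial_zip) simp
  show ?thesis
  proof (cases "ss ! p = i")
    case False
    then have "i * js ! p + dot (remove1 i ss) (delete_nth p js) < dot ss js"
      using st pi(1) iset by (intro dot_remove_row(2)) auto
    then show ?thesis
      using w wq wd by (simp add: key_order_def key_def push_down_def)
  next
    case True
    then have "q \<le> p"
      using repeated_after_quiet[of ss q p] st q(1) pi(1,2) by (auto simp: quiet_before_def)
    with pi(3) True have "q < p" by (cases "p = q") auto
    then have lex: "(delete_nth p js, delete_nth q js) \<in> lenlex less_than"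
      using st pi(1) by (intro delete_nth_lenlex) auto
    have "i * js ! p + dot (remove1 i ss) (delete_nth p js) = dot ss js"
      using dot_delete_nth[of p js ss] delete_nth_eq_remove1[of ss p] st pi(1) True by simp
    then show ?thesis
      using w wq wd lex by (simp add: key_order_def key_def push_down_def)
  qed
qed

definition insert_nth :: "nat \<Rightarrow> 'a \<Rightarrow> 'a list \<Rightarrow> 'a list" where
  "insert_nth q c xs = take q xs @ c # drop q xs"

lemma length_insert_nth [simp]: "length (insert_nth q c xs) = Suc (length xs)"
  by (simp add: insert_nth_def)

lemma delete_insert_nth [simp]: "q \<le> length xs \<Longrightarrow> delete_nth q (insert_nth q c xs) = xs"
  by (simp add: delete_nth_def insert_nth_def)

lemma insert_delete_nth [simp]: "q < length xs \<Longrightarrow> insert_nth q (xs ! q) (delete_nth q xs) = xs"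
  by (simp add: delete_nth_def insert_nth_def id_take_nth_drop[symmetric])

lemma nth_insert_nth:
  "q \<le> length xs \<Longrightarrow> insert_nth q c xs ! l = (if l < q then xs ! l else if l = q then c else xs ! (l - 1))"
  by (auto simp: insert_nth_def nth_append nth_Cons')

lemma set_insert_nth: "set (insert_nth q c xs) = insert c (set xs)"
  by (auto simp: insert_nth_def dest: in_set_takeD in_set_dropD) (metis Un_iff append_take_drop_id set_append)

lemma sorted_wrt_insert_nth:
  assumes "sorted_wrt P xs" "q \<le> length xs" "\<And>l. l < q \<Longrightarrow> P (xs ! l) c"
    "\<And>l. q \<le> l \<Longrightarrow> l < length xs \<Longrightarrow> P c (xs ! l)"
  shows "sorted_wrt P (insert_nth q c xs)"
proof -
  have "sorted_wrt P (take q xs @ drop q xs)" using assms(1) by simp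
  then have "sorted_wrt P (take q xs)" "sorted_wrt P (drop q xs)" "\<forall>x\<in>set (take q xs). \<forall>y\<in>set (drop q xs). P x y"
    unfolding sorted_wrt_append by blast+
  moreover have "\<forall>x\<in>set (take q xs). P x c" using assms(2,3) by (auto simp: in_set_conv_nth)
  moreover have "\<forall>y\<in>set (drop q xs). P c y" using assms(4) by (auto simp: in_set_conv_nth)
  ultimately show ?thesis by (auto simp: insert_nth_def sorted_wrt_append)
qed

lemma staircaseD:
  assumes "(ss, js) \<in> staircases m n N"
  shows "sorted ss" "sorted_wrt (<) js" "length ss = N" "length js = N" "set ss = {1..m}" "set js \<subseteq> {1..n}"
  using assms by (auto simp: staircases_def)

lemma staircase_insert:
  assumes x: "(ss, js) \<in> staircases m n N" and q: "q < N" and c: "c \<in> free_columns t ss js q"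
  shows "(insert_nth q (ss ! q) ss, insert_nth q c js) \<in> staircases m n (Suc N)"
proof -
  note st = staircaseD[OF x]
  have c': "(if q = 0 then 0 else js ! (q - 1)) < c" "c < js ! q"
    using c by (auto simp: free_columns_def)
  have less: "js ! a < js ! b" if "a < b" "b < N" for a b
    using st(2,4) that by (simp add: sorted_wrt_iff_nth_less)
  have "sorted (insert_nth q (ss ! q) ss)"
    using st(1,3) q by (intro sorted_wrt_insert_nth) (auto simp: sorted_iff_nth_mono)
  moreover have "sorted_wrt (<) (insert_nth q c js)"
  proof (rule sorted_wrt_insert_nth)
    show "js ! l < c" if "l < q" for l
    proof (cases "l = q - 1")
      case False
      with that have "js ! l < js ! (q - 1)" using q by (intro less) auto
      with c'(1) that show ?thesis by simp
    qed (use c'(1) that in simp)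
    show "c < js ! l" if "q \<le> l" "l < length js" for l
      using c'(2) less[of q l] that st(4) by (cases "l = q") auto
  qed (use st q in simp_all)
  moreover have "c \<in> {1..n}"
  proof -
    have "js ! q \<in> {1..n}" using subsetD[OF st(6) nth_mem[of q js]] st(4) q by simp
    then show ?thesis using c' by auto
  qed
  moreover have "ss ! q \<in> {1..m}" using st(3,5) q nth_mem[of q ss] by auto
  ultimately show ?thesis
    using st by (auto simp: staircases_def set_insert_nth)
qed

lemma free_columns_push_down:
  assumes x: "(ss, js) \<in> staircases m n N" and q: "pivot t ss js q"
    and z: "push_down (t, ss, js) q = (t0, ss0, js0)"
  shows "l < q \<Longrightarrow> free_columns t0 ss0 js0 l = {}"
    and "js ! q \<in> free_columns t0 ss0 js0 q"
    and "c \<in> free_columns t0 ss0 js0 q \<Longrightarrow> js ! q \<le> c"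
proof -
  note st = staircaseD[OF x]
  have q': "Suc q < N" "ss ! Suc q = ss ! q" "free_columns t ss js q = {}"
    "\<And>l. l < q \<Longrightarrow> free_columns t ss js l = {}"
    using q st(3) by (auto simp: pivot_def quiet_before_def step_at_def)
  have z': "t0 = t + single (ss ! q, js ! q) 1" "ss0 = delete_nth q ss" "js0 = delete_nth q js"
    using z by (auto simp: push_down_def)
  have less: "js ! a < js ! b" if "a < b" "b < N" for a b
    using st(2,4) that by (simp add: sorted_wrt_iff_nth_less)
  have supp: "v \<in> supp t0 \<longleftrightarrow> v \<in> supp t \<or> v = (ss ! q, js ! q)" for v
    by (auto simp: z' in_keys_iff lookup_add lookup_single when_def)
  have before: "ss0 ! l = ss ! l" "js0 ! l = js ! l" if "l < q" for l
    using that q'(1) st(3,4) by (simp_all add: z' nth_delete_nth)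
  have at: "ss0 ! q = ss ! q" "js0 ! q = js ! Suc q"
    using q'(1,2) st(3,4) by (simp_all add: z' nth_delete_nth)
  have prev: "(if l = 0 then 0 else js0 ! (l - 1)) = (if l = 0 then 0 else js ! (l - 1))" if "l \<le> q" for l
    using before(2)[of "l - 1"] that by auto
  show "free_columns t0 ss0 js0 l = {}" if l: "l < q"
  proof -
    have "c \<in> free_columns t ss js l" if "c \<in> free_columns t0 ss0 js0 l" for c
    proof -
      have c: "(if l = 0 then 0 else js ! (l - 1)) < c" "c < js ! l" "(ss ! l, c) \<in> supp t0"
        using that prev[of l] before[OF l] l by (auto simp: free_columns_def)
      moreover have "c \<noteq> js ! q" using c(2) less[of l q] l q'(1) by auto
      ultimately show ?thesis by (auto simp: free_columns_def supp)
    qed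
    then show ?thesis using q'(4)[OF l] by blast
  qed
  have pos: "(if q = 0 then 0 else js ! (q - 1)) < js ! q"
  proof (cases q)
    case 0
    have "js ! q \<in> {1..n}" using subsetD[OF st(6) nth_mem[of q js]] st(4) q'(1) by simp
    with 0 show ?thesis by simp
  next
    case (Suc k)
    then show ?thesis using less[of k q] q'(1) by simp
  qed
  show "js ! q \<in> free_columns t0 ss0 js0 q"
    using pos less[of q "Suc q"] q'(1) prev[of q] by (simp add: free_columns_def at supp)
  show "js ! q \<le> c" if "c \<in> free_columns t0 ss0 js0 q"
  proof (rule ccontr)
    assume "\<not> js ! q \<le> c"
    then have "c \<in> free_columns t ss js q"
      using that prev[of q] by (auto simp: free_columns_def at supp)
    then show False using q'(3) by blast
  qed
qed

text \<open>
  In the pushed down term, \<open>q\<close> is the first position with a free column and the pushed column is the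
  leftmost free one there. So both, and hence the original term, can be recovered.
\<close>

lemma push_down_inj:
  assumes x: "(ss, js) \<in> staircases m n N" "pivot t ss js q"
    and x': "(ss', js') \<in> staircases m n N" "pivot t' ss' js' q'"
    and eq: "push_down (t, ss, js) q = push_down (t', ss', js') q'"
  shows "(t, ss, js) = (t', ss', js')"
proof -
  obtain t0 ss0 js0 where z: "push_down (t, ss, js) q = (t0, ss0, js0)"
    by (cases "push_down (t, ss, js) q")
  note z' = z[unfolded eq]
  note fc = free_columns_push_down[OF x z] and fc' = free_columns_push_down[OF x' z']
  have "\<not> q < q'" using fc(2) fc'(1)[of q] by blast
  moreover have "\<not> q' < q" using fc'(2) fc(1)[of q'] by blast
  ultimately have q: "q' = q" by simp
  have c: "js' ! q = js ! q"
    using fc(3)[of "js' ! q"] fc(2) fc'(2) fc'(3)[of "js ! q"] unfolding q by simp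
  have len: "Suc q < length ss" "length js = length ss" "Suc q < length ss'" "length js' = length ss'"
    using x x' staircaseD(3,4)[OF x(1)] staircaseD(3,4)[OF x'(1)] q by (auto simp: pivot_def step_at_def)
  have e: "ss0 = delete_nth q ss" "ss0 = delete_nth q ss'" "js0 = delete_nth q js" "js0 = delete_nth q js'"
    using z z' q by (auto simp: push_down_def)
  have "delete_nth q ss ! q = ss ! q" "delete_nth q ss' ! q = ss' ! q"
    using x(2) x'(2) len q by (auto simp: pivot_def step_at_def nth_delete_nth)
  then have s: "ss0 ! q = ss ! q" "ss0 ! q = ss' ! q" by (simp add: e(1), simp add: e(2))
  have "insert_nth q (ss ! q) ss0 = ss" "insert_nth q (js ! q) js0 = js"
    using len by (simp_all add: e(1,3))
  moreover have "insert_nth q (ss' ! q) ss0 = ss'" "insert_nth q (js' ! q) js0 = js'"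
    using len by (simp_all add: e(2,4))
  ultimately have "ss = ss'" "js = js'" using s c by metis+
  moreover have "t + single (ss ! q, js ! q) 1 = t' + single (ss' ! q, js' ! q) 1"
    using z z' q by (simp add: push_down_def)
  ultimately show ?thesis by simp
qed

text \<open>
  Conversely, pull the leftmost free column into the staircase. Nothing changes before position \<open>q\<close>, and
  no column remains free at \<open>q\<close>, so that \<open>q\<close> is a pivot afterwards.
\<close>

lemma push_down_surj:
  assumes x: "(ss, js) \<in> staircases m n N" and q: "q < N" "quiet_before t ss js q"
    and ne: "free_columns t ss js q \<noteq> {}"
  obtains t' ss' js' where "(ss', js') \<in> staircases m n (Suc N)" "supp t' \<subseteq> supp t"
    "pivot t' ss' js' q" "push_down (t', ss', js') q = (t, ss, js)"
proof -
  note st = staircaseD[OF x]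
  let ?F = "free_columns t ss js q"
  define c where "c = Min ?F"
  have "finite ?F"
    by (rule finite_subset[of _ "{..<js ! q}"]) (auto simp: free_columns_def)
  with ne have c: "c \<in> ?F" "\<And>c'. c' \<in> ?F \<Longrightarrow> c \<le> c'"
    by (simp_all add: c_def)
  let ?v = "(ss ! q, c)"
  let ?t = "t - single ?v 1" and ?ss = "insert_nth q (ss ! q) ss" and ?js = "insert_nth q c js"
  have v: "?v \<in> supp t" using c(1) by (simp add: free_columns_def)
  then have "1 \<le> coef t ?v" by (simp add: in_keys_iff)
  then have t: "?t + single ?v 1 = t"
    by (intro poly_mapping_eqI) (auto simp: lookup_add lookup_minus lookup_single when_def)
  have sub: "supp ?t \<subseteq> supp t"
    by (auto simp: in_keys_iff lookup_minus)
  have before: "?ss ! l = ss ! l" "?js ! l = js ! l" if "l < q" for l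
    using that q(1) st(3,4) by (simp_all add: nth_insert_nth)
  have at: "?ss ! q = ss ! q" "?js ! q = c" "?ss ! Suc q = ss ! q"
    using q(1) st(3,4) by (simp_all add: nth_insert_nth)
  have prev: "(if l = 0 then 0 else ?js ! (l - 1)) = (if l = 0 then 0 else js ! (l - 1))" if "l \<le> q" for l
    using before(2)[of "l - 1"] that by auto
  have "free_columns ?t ?ss ?js l \<subseteq> free_columns t ss js l" if "l < q" for l
    using prev[of l] before[OF that] sub that by (auto simp: free_columns_def)
  moreover have "\<not> step_at ?ss l" if "l < q" for l
  proof -
    have "\<not> step_at ss l" using q(2) that by (simp add: quiet_before_def)
    moreover have "?ss ! Suc l = ss ! Suc l"
      using before(1)[of "Suc l"] at(1) that by (cases "Suc l = q") auto
    ultimately show ?thesis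
      using before(1)[OF that] that q(1) st(3) by (auto simp: step_at_def)
  qed
  ultimately have quiet: "quiet_before ?t ?ss ?js q"
    using q(2) unfolding quiet_before_def by blast
  have "c' \<notin> free_columns ?t ?ss ?js q" for c'
  proof
    assume "c' \<in> free_columns ?t ?ss ?js q"
    then have "(if q = 0 then 0 else js ! (q - 1)) < c'" "c' < c" "(ss ! q, c') \<in> supp t"
      using prev[of q] sub at by (auto simp: free_columns_def)
    moreover from this c(1) have "c' \<in> ?F" by (auto simp: free_columns_def)
    ultimately show False using c(2)[of c'] by simp
  qed
  then have "pivot ?t ?ss ?js q"
    using quiet at q(1) st(3) by (auto simp: pivot_def step_at_def)
  moreover have "push_down (?t, ?ss, ?js) q = (t, ss, js)"
    using t q(1) st(3,4) by (simp add: push_down_def at)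
  ultimately show thesis
    using that[OF staircase_insert[OF x q(1) c(1)] sub] by blast
qed

section \<open>The Eagon-Northcott complex\<close>

text \<open>
  Level \<open>0\<close> is the polynomial ring itself, with the empty staircase as its basis element; the map from
  level \<open>1\<close> sends a staircase to the minor on its columns. The further boundary maps remove
  one column and one repeated row, with the variable at that place as coefficient. In terms of the usual description,
  the rows beyond the first copy of each are the exponents of a divided power monomial.
\<close>

fun en_gens :: "nat \<Rightarrow> nat \<Rightarrow> nat \<Rightarrow> staircase set" where
  "en_gens m n 0 = {([], [])}"
| "en_gens m n (Suc k) = staircases m n (k + m)"

fun en_deg :: "nat \<Rightarrow> nat \<Rightarrow> staircase \<Rightarrow> nat" where
  "en_deg m 0 = (\<lambda>_. 0)"
| "en_deg m (Suc k) = (\<lambda>_. k + m)"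

fun en_bd :: "nat \<Rightarrow> nat \<Rightarrow> staircase \<Rightarrow> (staircase \<Rightarrow>\<^sub>0 'k::field mpol)" where
  "en_bd m 0 = (\<lambda>(ss, js). single ([], []) (minor m js))"
| "en_bd m (Suc k) = (\<lambda>(ss, js). \<Sum>(p, i)\<in>{..<length js} \<times> repeated ss.
     single (remove1 i ss, delete_nth p js) (single (single (i, js ! p) 1) ((- 1) ^ p)))"

lemma en_bd_graded:
  assumes "x \<in> en_gens m n (Suc i)"
  shows "en_bd m i x \<in> gpart m n (en_gens m n i) (en_deg m i) {en_deg m (Suc i) x}"
proof -
  obtain ss js where x: "x = (ss, js)" by (cases x)
  have st: "(ss, js) \<in> staircases m n (i + m)" using assms by (simp add: x)
  note std = staircaseD[OF st]
  show ?thesis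
  proof (cases i)
    case 0
    have js: "distinct js" "length js = m" "set js \<subseteq> {1..n}"
      using std 0 by (auto simp: strict_sorted_iff)
    show ?thesis
      using minor_polys[OF js] minor_homogeneous[OF js(1,2)]
      by (auto simp: 0 x intro!: gpart_single)
  next
    case (Suc k)
    have "single (remove1 j ss, delete_nth p js) (single (single (j, js ! p) 1) ((- 1) ^ p))
        \<in> gpart m n (staircases m n (k + m)) (\<lambda>_. k + m) {Suc k + m}"
      if "p < length js" "j \<in> repeated ss" for p j
    proof (rule gpart_single)
      show "(remove1 j ss, delete_nth p js) \<in> staircases m n (k + m)"
        using st that std by (intro staircase_delete) (auto simp: Suc)
      have "j \<in> {1..m}" "js ! p \<in> {1..n}"
        using that repeated_subset[of ss] std(5) subsetD[OF std(6) nth_mem[of p js]] by auto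
      then show "single (single (j, js ! p) 1) ((- 1) ^ p) \<in> polys m n"
        by (intro polys_single) auto
    qed (auto split: if_splits)
    then show ?thesis
      unfolding Suc x by (auto intro!: gpart_sum)
  qed
qed

subsection \<open>The composition of two boundary maps\<close>

text \<open>
  Removing two elements in either order gives opposite contributions. The terms are cancelled
  in pairs, since over a field of characteristic two it is not enough that the sum equals its negative.
\<close>

lemma face_sum_cancel:
  fixes H :: "nat \<Rightarrow> nat \<Rightarrow> 'a::ab_group_add"
  assumes "\<And>p q. p \<le> q \<Longrightarrow> q < N \<Longrightarrow> H (Suc q) p = - H p q"
  shows "(\<Sum>p<Suc N. \<Sum>q<N. H p q) = 0"
proof -
  let ?A = "{(p, q). p \<le> q \<and> q < N}" and ?B = "{(p, q). q < p \<and> p < Suc N}"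
  have fin: "finite ?A" "finite ?B"
    by (rule finite_subset[of _ "{..N} \<times> {..N}"]; auto)+
  have "(\<Sum>p<Suc N. \<Sum>q<N. H p q) = (\<Sum>(p, q)\<in>{..<Suc N} \<times> {..<N}. H p q)"
    by (rule sum.cartesian_product)
  also have "{..<Suc N} \<times> {..<N} = ?A \<union> ?B" by auto
  also have "(\<Sum>(p, q)\<in>?A \<union> ?B. H p q) = (\<Sum>(p, q)\<in>?A. H p q) + (\<Sum>(p, q)\<in>?B. H p q)"
    by (rule sum.union_disjoint) (use fin in auto)
  also have "(\<Sum>(p, q)\<in>?B. H p q) = (\<Sum>(p, q)\<in>?A. H (Suc q) p)"
    by (rule sum.reindex_bij_witness[of _ "\<lambda>(p, q). (Suc q, p)" "\<lambda>(p, q). (q, p - 1)"]) auto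
  also have "\<dots> = - (\<Sum>(p, q)\<in>?A. H p q)"
    unfolding sum_negf[symmetric] by (rule sum.cong) (auto simp: assms)
  finally show ?thesis by (simp only: add.right_inverse)
qed

lemma delete_nth_commute:
  assumes "p \<le> q" "Suc q < length xs"
  shows "delete_nth q (delete_nth p xs) = delete_nth p (delete_nth (Suc q) xs)"
    "delete_nth p xs ! q = xs ! Suc q" "delete_nth (Suc q) xs ! p = xs ! p"
proof -
  show "delete_nth q (delete_nth p xs) = delete_nth p (delete_nth (Suc q) xs)"
    using assms by (intro nth_equalityI) (auto simp: nth_delete_nth)
qed (use assms in \<open>simp_all add: nth_delete_nth\<close>)

lemma repeated_pairs_symmetric:
  "i \<in> repeated ss \<and> j \<in> repeated (remove1 i ss) \<longleftrightarrow> j \<in> repeated ss \<and> i \<in> repeated (remove1 j ss)"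
  by (cases "i = j") (auto simp: repeated_def)

lemma en_bd_bd:
  assumes "x \<in> en_gens m n (Suc (Suc i))"
  shows "lin_ext (en_bd m i) (en_bd m (Suc i) x) = (0 :: staircase \<Rightarrow>\<^sub>0 'k::field mpol)"
proof -
  obtain ss js where x: "x = (ss, js)" by (cases x)
  have st: "(ss, js) \<in> staircases m n (Suc (i + m))" using assms by (simp add: x)
  note std = staircaseD[OF st]
  show ?thesis
  proof (cases i)
    case 0
    have sgn: "(- 1) ^ p * var a b = (single (single (a, b) 1) ((- 1) ^ p) :: 'k mpol)" for a b p
      unfolding var_def by (induction p) (auto simp: single_uminus)
    have "lin_ext (en_bd m 0) (en_bd m (Suc 0) (ss, js)) =
        (\<Sum>p<length js. \<Sum>j\<in>repeated ss. single ([], []) ((- 1) ^ p * var j (js ! p) * minor m (delete_nth p js)) :: staircase \<Rightarrow>\<^sub>0 'k mpol)"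
      by (simp add: lin_ext_sum split_beta sgn sum.cartesian_product)
    also have "\<dots> = (\<Sum>j\<in>repeated ss. \<Sum>p<Suc m. single ([], []) ((- 1) ^ p * var j (js ! p) * minor m (delete_nth p js)))"
      using std(4) 0 by (subst sum.swap) simp
    also have "\<dots> = (\<Sum>j\<in>repeated ss. single ([], []) (\<Sum>p<Suc m. (- 1) ^ p * var j (js ! p) * minor m (delete_nth p js)))"
      by (simp only: single_sum)
    also have "\<dots> = 0"
      using repeated_subset[of ss] std(4,5) 0 by (intro sum.neutral ballI) (subst minor_relation; auto)
    finally show ?thesis by (simp add: 0 x)
  next
    case (Suc k)
    let ?N = "i + m"
    let ?R = "{(a, b). a \<in> repeated ss \<and> b \<in> repeated (remove1 a ss)}"
    have R: "?R = (SIGMA a:repeated ss. repeated (remove1 a ss))" by auto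
    then have finR: "finite ?R" by simp
    define T where "T p q a b = (single (remove1 b (remove1 a ss), delete_nth q (delete_nth p js))
        (single (single (a, js ! p) 1 + single (b, delete_nth p js ! q) 1) ((- 1) ^ (p + q)))
        :: staircase \<Rightarrow>\<^sub>0 'k mpol)" for p q a b
    have "lin_ext (en_bd m i) (en_bd m (Suc i) x) =
        (\<Sum>(p, a)\<in>{..<length js} \<times> repeated ss. \<Sum>(q, b)\<in>{..<length (delete_nth p js)} \<times> repeated (remove1 a ss). T p q a b)"
      by (simp add: Suc x lin_ext_sum scale_sum_right split_beta mult_single T_def power_add)
    also have "\<dots> = (\<Sum>p<Suc ?N. \<Sum>a\<in>repeated ss. \<Sum>q<?N. \<Sum>b\<in>repeated (remove1 a ss). T p q a b)"
      using std(4) by (simp add: sum.cartesian_product[symmetric] del: sum.lessThan_Suc)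
    also have "\<dots> = (\<Sum>p<Suc ?N. \<Sum>q<?N. \<Sum>a\<in>repeated ss. \<Sum>b\<in>repeated (remove1 a ss). T p q a b)"
      by (rule sum.cong[OF refl], rule sum.swap)
    also have "\<dots> = (\<Sum>p<Suc ?N. \<Sum>q<?N. \<Sum>(a, b)\<in>?R. T p q a b)"
      unfolding R by (intro sum.cong refl) (rule sum.Sigma; simp)
    also have "\<dots> = 0"
    proof (rule face_sum_cancel)
      fix p q assume pq: "p \<le> q" "q < ?N"
      have "(\<Sum>(a, b)\<in>?R. T (Suc q) p a b) = (\<Sum>(a, b)\<in>?R. T (Suc q) p b a)"
        by (rule sum.reindex_bij_witness[of _ "\<lambda>(a, b). (b, a)" "\<lambda>(a, b). (b, a)"])
          (auto dest: repeated_pairs_symmetric[THEN iffD1, OF conjI])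
      also have "\<dots> = (\<Sum>(a, b)\<in>?R. - T p q a b)"
      proof (rule sum.cong, rule refl)
        fix ab assume "ab \<in> ?R"
        have "T (Suc q) p b a = - T p q a b" for a b
          using delete_nth_commute[of p q js] pq std(4)
          by (simp add: T_def remove1_commute add.commute single_uminus)
        then show "(case ab of (a, b) \<Rightarrow> T (Suc q) p b a) = (case ab of (a, b) \<Rightarrow> - T p q a b)"
          by (cases ab) simp
      qed
      also have "\<dots> = - (\<Sum>(a, b)\<in>?R. T p q a b)"
        by (simp add: split_beta sum_negf)
      finally show "(\<Sum>(a, b)\<in>?R. T (Suc q) p a b) = - (\<Sum>(a, b)\<in>?R. T p q a b)" .
    qed
    finally show ?thesis .
  qed
qed


subsection \<open>Exactness\<close>

text \<open>
  At the first level (\<open>k = 0\<close>) no row is repeated, and the terms left over by the matching are those where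
  the greedy choice of columns has been made in every row. They are matched with the monomials divisible by the
  leading monomial of some minor; the greedy choice singles out one such minor for each monomial.
\<close>

definition lower_terms :: "nat \<Rightarrow> nat \<Rightarrow> nat \<Rightarrow> (monom \<times> staircase) set" where
  "lower_terms m n k = {(t, ss, js) \<in> terms m n (staircases m n (k + m)).
     if k = 0 then \<forall>q<m. free_columns t ss js q = {} else \<exists>q. pivot t ss js q}"

definition leading_term :: "nat \<Rightarrow> monom \<times> staircase \<Rightarrow> monom \<times> staircase" where
  "leading_term k x = (case x of (t, ss, js) \<Rightarrow>
     if k = 0 then (t + monomial (zip ss js), [], []) else push_down x (THE q. pivot t ss js q))"

lemma leading_term_pivot: "k \<noteq> 0 \<Longrightarrow> pivot t ss js q \<Longrightarrow> leading_term k (t, ss, js) = push_down (t, ss, js) q"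
  unfolding leading_term_def by (auto intro: pivot_unique the_equality intro!: arg_cong[of _ _ "push_down (t, ss, js)"])

lemma staircase_rows:
  assumes "(ss, js) \<in> staircases m n m"
  shows "ss = [1..<Suc m]"
proof -
  note std = staircaseD[OF assms]
  have "card (set ss) = length ss" using std by simp
  then have "distinct ss" by (rule card_distinct)
  then show ?thesis
    using std by (intro sorted_distinct_set_unique) (auto simp del: upt_Suc)
qed

lemma key_order_irrefl: "(x, x) \<notin> key_order"
  using wf_key_order by auto

lemma leading_term_boundary:
  assumes x: "x \<in> lower_terms m n k"
  shows "leading_term k x \<in> entries (lin_ext (en_bd m k) (term_vector x) :: staircase \<Rightarrow>\<^sub>0 'k::field mpol)"
    and "y \<in> entries (lin_ext (en_bd m k) (term_vector x) :: staircase \<Rightarrow>\<^sub>0 'k::field mpol) \<Longrightarrow>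
      y = leading_term k x \<or> (y, leading_term k x) \<in> key_order"
proof -
  obtain t ss js where x_eq: "x = (t, ss, js)" by (cases x)
  have st: "(ss, js) \<in> staircases m n (k + m)"
    using x by (auto simp: lower_terms_def terms_def x_eq)
  note std = staircaseD[OF st]
  let ?d = "lin_ext (en_bd m k) (term_vector x) :: staircase \<Rightarrow>\<^sub>0 'k mpol"
  have "leading_term k x \<in> entries ?d \<and>
      (\<forall>y. y \<in> entries ?d \<longrightarrow> y = leading_term k x \<or> (y, leading_term k x) \<in> key_order)"
  proof (cases k)
    case 0
    have ss: "ss = [1..<Suc m]" using staircase_rows[of ss js m n] st 0 by simp
    let ?\<Lambda> = "monomial (zip [1..<Suc m] js)"
    have lead: "leading_term k x = (t + ?\<Lambda>, [], [])"
      by (simp only: leading_term_def x_eq 0 ss) simp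
    have d: "?d = single ([], []) (single t 1 * minor m js)"
      by (simp add: 0 x_eq term_vector_def)
    have js: "sorted_wrt (<) js" "length js = m" using std 0 by simp_all
    have "entry ?d (t + ?\<Lambda>, [], []) = coef (minor m js :: 'k mpol) ?\<Lambda>"
      unfolding d entry_def by (simp add: coef_single_mult_add)
    then have 1: "leading_term k x \<in> entries ?d"
      using minor_leading_term(1)[OF js, where 'k = 'k] by (simp add: lead entries_def in_keys_iff)
    moreover have "y = leading_term k x \<or> (y, leading_term k x) \<in> key_order" if y: "y \<in> entries ?d" for y
    proof -
      obtain t' b where tb: "y = (t', b)" by (cases y)
      have "b = ([], [])" "t' \<in> supp (single t 1 * minor m js :: 'k mpol)"
        using y by (auto simp: d tb entries_def entry_def in_keys_iff lookup_single when_def split: if_splits)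
      then obtain s where s: "t' = t + s" "s \<in> supp (minor m js :: 'k mpol)" "b = ([], [])"
        using supp_single_mult[of t 1 "minor m js :: 'k mpol"] by blast
      show ?thesis
      proof (cases "s = ?\<Lambda>")
        case False
        then have "weight s < weight ?\<Lambda>"
          by (rule minor_leading_term(2)[OF js s(2)])
        then show ?thesis by (simp add: key_order_def key_def tb s lead)
      qed (simp add: tb s lead)
    qed
    ultimately show ?thesis by blast
  next
    case (Suc k')
    then obtain q where q: "pivot t ss js q"
      using x by (auto simp: lower_terms_def x_eq)
    have q': "quiet_before t ss js q" "step_at ss q" "q < length js"
      using q std by (auto simp: pivot_def step_at_def)
    have lead: "leading_term k x = push_down (t, ss, js) q"
      unfolding x_eq by (rule leading_term_pivot) (use Suc q in simp_all)
    let ?y = "\<lambda>(p, i). (t + single (i, js ! p) 1, remove1 i ss, delete_nth p js)"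
    let ?I = "{..<length js} \<times> repeated ss"
    have y0: "?y (q, ss ! q) = leading_term k x"
      unfolding lead push_down_def using delete_nth_eq_remove1[of ss q] std q'(3) by simp
    have less: "(?y pi, leading_term k x) \<in> key_order" if "pi \<in> ?I" "pi \<noteq> (q, ss ! q)" for pi
      using pivot_leading[OF st q'(1,2), of "fst pi" "snd pi"] that std(4) unfolding lead
      by (cases pi) auto
    have d: "?d = (\<Sum>pi\<in>?I. single (snd (?y pi)) (single (fst (?y pi)) ((- 1) ^ fst pi)))"
      by (simp add: Suc x_eq term_vector_def scale_sum_right split_beta mult_single)
    have entry_d: "entry ?d y = (\<Sum>pi\<in>?I. if ?y pi = y then (- 1) ^ fst pi else 0)" for y
      unfolding d entry_sum
      by (intro sum.cong refl, cases y) (auto simp: entry_def lookup_single when_def split: prod.splits)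
    have "entry ?d (leading_term k x) = (\<Sum>pi\<in>?I. if pi = (q, ss ! q) then (- 1) ^ fst pi else 0)"
      unfolding entry_d
    proof (intro sum.cong refl)
      fix pi assume pi: "pi \<in> ?I"
      have "?y pi \<noteq> leading_term k x" if "pi \<noteq> (q, ss ! q)"
      proof
        assume "?y pi = leading_term k x"
        with less[OF pi that] have "(leading_term k x, leading_term k x) \<in> key_order" by (simp only:)
        then show False using key_order_irrefl by blast
      qed
      then have "?y pi = leading_term k x \<longleftrightarrow> pi = (q, ss ! q)"
        using y0 by (cases "pi = (q, ss ! q)") (simp_all only: simp_thms)
      then show "(if ?y pi = leading_term k x then (- 1) ^ fst pi else 0 :: 'k) =
          (if pi = (q, ss ! q) then (- 1) ^ fst pi else 0)" by simp
    qed
    also have "\<dots> = (- 1) ^ q"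
      using q'(3) repeated_stepI[OF q'(2)] by (simp add: sum.delta)
    finally have "leading_term k x \<in> entries ?d" by (simp add: entries_def)
    moreover have "y = leading_term k x \<or> (y, leading_term k x) \<in> key_order" if "y \<in> entries ?d" for y
    proof -
      have "\<exists>pi\<in>?I. ?y pi = y"
      proof (rule ccontr)
        assume none: "\<not> (\<exists>pi\<in>?I. ?y pi = y)"
        have "entry ?d y = 0"
          unfolding entry_d by (rule sum.neutral) (use none in auto)
        with that show False by (simp add: entries_def)
      qed
      then obtain pi where "pi \<in> ?I" "?y pi = y" by blast
      then show ?thesis using less[of pi] y0 by metis
    qed
    ultimately show ?thesis by blast
  qed
  then show "leading_term k x \<in> entries ?d"
    and "y \<in> entries ?d \<Longrightarrow> y = leading_term k x \<or> (y, leading_term k x) \<in> key_order" by blast+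
qed

text \<open>
  At the first level the columns are recovered one after the other: if two greedy choices for the same
  monomial first differed in row \<open>q\<close>, the smaller of the two columns would have been free for the other choice.
\<close>

lemma leading_term_inj: "inj_on (leading_term k) (lower_terms m n k)"
proof (rule inj_onI)
  fix x x' assume x: "x \<in> lower_terms m n k" "x' \<in> lower_terms m n k" "leading_term k x = leading_term k x'"
  obtain t ss js t' ss' js' where eq: "x = (t, ss, js)" "x' = (t', ss', js')" by (cases x, cases x')
  have st: "(ss, js) \<in> staircases m n (k + m)" "(ss', js') \<in> staircases m n (k + m)"
    using x by (auto simp: lower_terms_def terms_def eq)
  show "x = x'"
  proof (cases k)
    case (Suc k')
    then obtain q q' where q: "pivot t ss js q" "pivot t' ss' js' q'"
      using x by (auto simp: lower_terms_def eq)
    then have "push_down (t, ss, js) q = push_down (t', ss', js') q'"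
      using x(3) Suc leading_term_pivot[of k] by (simp add: eq)
    then show ?thesis
      unfolding eq by (rule push_down_inj[OF st(1) q(1) st(2) q(2)])
  next
    case 0
    have free: "free_columns t ss js q = {}" "free_columns t' ss' js' q = {}" if "q < m" for q
      using x that by (auto simp: lower_terms_def eq 0)
    have rows: "ss = [1..<Suc m]" "ss' = [1..<Suc m]"
      using staircase_rows[of _ _ m n] st 0 by auto
    have len: "length js = m" "length js' = m" using staircaseD(4) st 0 by auto
    have sum: "t + monomial (zip ss js) = t' + monomial (zip ss' js')"
      using x(3) by (simp add: leading_term_def eq 0)
    have nth: "ss ! q = Suc q" "ss' ! q = Suc q" if "q < m" for q
      using that by (simp_all add: rows del: upt_Suc)
    have row: "(Suc q, c) \<in> set (zip ss js) \<longleftrightarrow> c = js ! q" "(Suc q, c) \<in> set (zip ss' js') \<longleftrightarrow> c = js' ! q"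
      if q: "q < m" for q c
    proof -
      have "length ss = m" "length ss' = m" by (simp_all add: rows del: upt_Suc)
      then have "(Suc q, c) \<in> set (zip ss js) \<longleftrightarrow> (\<exists>l<m. ss ! l = Suc q \<and> js ! l = c)"
        "(Suc q, c) \<in> set (zip ss' js') \<longleftrightarrow> (\<exists>l<m. ss' ! l = Suc q \<and> js' ! l = c)"
        using len by (auto simp: in_set_zip)
      then show "(Suc q, c) \<in> set (zip ss js) \<longleftrightarrow> c = js ! q" "(Suc q, c) \<in> set (zip ss' js') \<longleftrightarrow> c = js' ! q"
        using q nth by auto
    qed
    have supp: "v \<in> supp (t + monomial (zip ss js)) \<longleftrightarrow> v \<in> supp t \<or> v \<in> set (zip ss js)"
      "v \<in> supp (t' + monomial (zip ss' js')) \<longleftrightarrow> v \<in> supp t' \<or> v \<in> set (zip ss' js')" for v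
      unfolding supp_monomial[symmetric] by (auto simp: in_keys_iff lookup_add)
    have pos: "js ! l < js ! q" "js' ! l < js' ! q" if "l < q" "q < m" for l q
      using staircaseD(2)[OF st(1)] staircaseD(2)[OF st(2)] that len by (simp_all add: sorted_wrt_iff_nth_less)
    have pos0: "0 < js ! q" "0 < js' ! q" if "q < m" for q
      using subsetD[OF staircaseD(6)[OF st(1)] nth_mem[of q js]]
        subsetD[OF staircaseD(6)[OF st(2)] nth_mem[of q js']] that len by auto
    have "q < m \<longrightarrow> js ! q = js' ! q" for q
    proof (induction q rule: less_induct)
      case (less q)
      show ?case
      proof (rule impI, rule ccontr)
        assume q: "q < m" and ne: "js ! q \<noteq> js' ! q"
        have prev: "(if q = 0 then 0 else js ! (q - 1)) = (if q = 0 then 0 else js' ! (q - 1))"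
          using less.IH[of "q - 1"] q by auto
        have prev_less: "(if q = 0 then 0 else js ! (q - 1)) < js ! q" "(if q = 0 then 0 else js' ! (q - 1)) < js' ! q"
          using pos[of "q - 1" q] pos0[OF q] q by auto
        consider "js ! q < js' ! q" | "js' ! q < js ! q" using ne by linarith
        then show False
        proof cases
          case 1
          have "(Suc q, js ! q) \<in> supp t'"
            using supp row(1)[OF q, of "js ! q"] row(2)[OF q, of "js ! q"] 1 sum by (metis nat_neq_iff)
          then have "js ! q \<in> free_columns t' ss' js' q"
            using 1 prev prev_less by (simp add: free_columns_def nth q)
          then show False using free(2)[OF q] by blast
        next
          case 2
          have "(Suc q, js' ! q) \<in> supp t"
            using supp row(1)[OF q, of "js' ! q"] row(2)[OF q, of "js' ! q"] 2 sum by (metis nat_neq_iff)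
          then have "js' ! q \<in> free_columns t ss js q"
            using 2 prev prev_less by (simp add: free_columns_def nth q)
          then show False using free(1)[OF q] by blast
        qed
      qed
    qed
    then have "js = js'" using len by (intro nth_equalityI) auto
    moreover from this have "t = t'" using sum rows by simp
    ultimately show ?thesis by (simp add: eq rows)
  qed
qed

text \<open>
  A term is not lower exactly if its first position that is not quiet has a free column. Such a position exists
  above the first level, since some row is repeated in a staircase with more than \<open>m\<close> entries.
\<close>

lemma leading_term_surj:
  "terms m n (staircases m n (k + m)) - lower_terms m n k \<subseteq> leading_term (Suc k) ` lower_terms m n (Suc k)"
proof
  fix x assume x: "x \<in> terms m n (staircases m n (k + m)) - lower_terms m n k"
  obtain t ss js where eq: "x = (t, ss, js)" by (cases x)
  have st: "(ss, js) \<in> staircases m n (k + m)" and t: "supp t \<subseteq> {1..m} \<times> {1..n}"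
    using x by (auto simp: terms_def eq)
  note std = staircaseD[OF st]
  have sorted_strict: "sorted_wrt (<) ss" if "\<And>q. q < k + m \<Longrightarrow> \<not> step_at ss q"
    unfolding sorted_wrt_iff_nth_less
    using strict_before_step[of ss "k + m", OF std(1) that] std(3) by auto
  have k0: "k = 0" if "\<And>q. q < k + m \<Longrightarrow> \<not> step_at ss q"
  proof -
    have "distinct ss" using sorted_strict[OF that] by (simp add: strict_sorted_iff)
    then show ?thesis using distinct_card[of ss] std(3,5) by simp
  qed
  have step_Suc: "\<not> step_at ss q" if "k = 0" for q
  proof -
    have "ss = [1..<Suc m]" using staircase_rows[of ss js m n] st that by simp
    then show ?thesis by (auto simp: step_at_def simp del: upt_Suc)
  qed
  let ?P = "\<lambda>q. q < k + m \<and> (free_columns t ss js q \<noteq> {} \<or> step_at ss q)"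
  have "\<exists>q. ?P q"
  proof (rule ccontr)
    assume none: "\<not> (\<exists>q. ?P q)"
    then have "k = 0" using k0 by blast
    then have "x \<in> lower_terms m n k"
      using x none by (auto simp: lower_terms_def eq)
    with x show False by blast
  qed
  then have P: "?P (LEAST q. ?P q)" and least: "\<And>l. l < (LEAST q. ?P q) \<Longrightarrow> \<not> ?P l"
    by (rule LeastI_ex) (rule not_less_Least)
  define q where "q = (LEAST q. ?P q)"
  have q: "q < k + m" "free_columns t ss js q \<noteq> {} \<or> step_at ss q"
    using P by (auto simp: q_def)
  have quiet: "quiet_before t ss js q"
    unfolding quiet_before_def using least q(1) unfolding q_def[symmetric] by (meson less_trans)
  have "free_columns t ss js q \<noteq> {}"
  proof
    assume empty: "free_columns t ss js q = {}"
    with q(2) have step: "step_at ss q" by blast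
    then have "k \<noteq> 0" using step_Suc by blast
    moreover have "pivot t ss js q"
      using quiet empty step by (simp add: pivot_def)
    ultimately have "x \<in> lower_terms m n k"
      using x by (auto simp: lower_terms_def eq)
    with x show False by blast
  qed
  then have "\<exists>t' ss' js'. (ss', js') \<in> staircases m n (Suc (k + m)) \<and> supp t' \<subseteq> supp t \<and>
      pivot t' ss' js' q \<and> push_down (t', ss', js') q = (t, ss, js)"
    by (rule push_down_surj[OF st q(1) quiet]) blast
  then obtain t' ss' js' where y: "(ss', js') \<in> staircases m n (Suc (k + m))" "supp t' \<subseteq> supp t"
    "pivot t' ss' js' q" "push_down (t', ss', js') q = (t, ss, js)"
    by (elim exE conjE)
  have "(t', ss', js') \<in> lower_terms m n (Suc k)"
    using y t by (auto simp: lower_terms_def terms_def)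
  moreover have "leading_term (Suc k) (t', ss', js') = x"
    using leading_term_pivot[OF _ y(3), of "Suc k"] y(4) by (simp add: eq)
  ultimately show "x \<in> leading_term (Suc k) ` lower_terms m n (Suc k)" by blast
qed

theorem en_acyclic: "acyclic_complex m n (en_gens m n) (en_deg m) (en_bd m :: nat \<Rightarrow> staircase \<Rightarrow> (staircase \<Rightarrow>\<^sub>0 'k::field mpol))"
  unfolding acyclic_complex_def chain_complex_def
proof (intro conjI allI ballI impI)
  fix i and u :: "staircase \<Rightarrow>\<^sub>0 'k mpol"
  assume u: "u \<in> gpart m n (en_gens m n (Suc i)) (en_deg m (Suc i)) UNIV" "lin_ext (en_bd m i) u = 0"
  show "u \<in> lin_ext (en_bd m (Suc i)) ` gpart m n (en_gens m n (Suc (Suc i))) (en_deg m (Suc (Suc i))) UNIV"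
  proof (rule exact_of_leading_terms[OF wf_key_order, where ?D1.0 = "lower_terms m n i" and ?D2.0 = "lower_terms m n (Suc i)"
        and ?\<phi>1.0 = "leading_term i" and ?\<phi>2.0 = "leading_term (Suc i)" and ?d0.0 = "en_bd m i"])
    show "lower_terms m n (Suc i) \<subseteq> terms m n (en_gens m n (Suc (Suc i)))"
      by (auto simp: lower_terms_def)
    show "terms m n (en_gens m n (Suc i)) - lower_terms m n i \<subseteq> leading_term (Suc i) ` lower_terms m n (Suc i)"
      using leading_term_surj by simp
  qed (fact en_bd_graded en_bd_bd leading_term_boundary leading_term_inj u)+
qed (fact en_bd_graded en_bd_bd)+

section \<open>Linear syzygies of minors\<close>

lemma ideal_eq_combinations:
  fixes f :: "'b \<Rightarrow> 'k::field mpol"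
  assumes f: "f ` B \<subseteq> polys m n"
  shows "Idl\<^bsub>poly_ring m n\<^esub> (f ` B) = (\<lambda>u. \<Sum>b\<in>supp u. coef u b * f b) ` gpart m n B g UNIV" (is "_ = ?G")
proof -
  let ?R = "poly_ring m n :: 'k mpol ring"
  interpret R: cring ?R by (rule cring_poly_ring)
  have ops: "x \<oplus>\<^bsub>?R\<^esub> y = x + y" "x \<otimes>\<^bsub>?R\<^esub> y = x * y" "\<zero>\<^bsub>?R\<^esub> = 0" "\<one>\<^bsub>?R\<^esub> = 1" for x y
    by (simp_all add: poly_ring_def)
  have neg: "\<ominus>\<^bsub>?R\<^esub> x = - x" if "x \<in> polys m n" for x
    using R.minus_equality[of "- x" x] that polys_uminus[OF that] by (simp add: ops)
  let ?h = "\<lambda>u. \<Sum>b\<in>supp u. coef u b * f b"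
  have h: "single () (?h u) = lin_ext (\<lambda>b. single () (f b)) u" for u
    by (simp add: lin_ext_single_fun)
  have inj: "p = q" if "single () p = (single () q :: unit \<Rightarrow>\<^sub>0 'k mpol)" for p q
    using that by (metis lookup_single_eq)
  have add: "?h u + ?h v = ?h (u + v)" for u v
    by (rule inj) (simp only: single_add h lin_ext_add)
  have scl: "p * ?h u = ?h (scale p u)" for p u
    by (rule inj) (simp only: h lin_ext_scale scale_single[symmetric])
  have zero: "?h 0 = 0" by simp
  have sub: "?h u \<in> polys m n" if "u \<in> gpart m n B g UNIV" for u
    using f gpartD(1,2)[OF that] by (intro polys_sum polys_mult) blast+
  have ideal: "ideal ?G ?R"
  proof (rule idealI)
    show "ring ?R" by (rule R.ring_axioms)
    show "subgroup ?G (add_monoid ?R)"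
    proof (rule subgroup.intro)
      show "?G \<subseteq> carrier (add_monoid ?R)" using sub by auto
      show "x \<otimes>\<^bsub>add_monoid ?R\<^esub> y \<in> ?G" if "x \<in> ?G" "y \<in> ?G" for x y
        using that by (auto simp: ops add intro!: imageI gpart_add)
      show "\<one>\<^bsub>add_monoid ?R\<^esub> \<in> ?G"
        by (rule image_eqI[of _ _ 0]) (simp_all add: ops)
      show "inv\<^bsub>add_monoid ?R\<^esub> x \<in> ?G" if x: "x \<in> ?G" for x
      proof -
        obtain u where u: "u \<in> gpart m n B g UNIV" "x = ?h u" using x by blast
        have "inv\<^bsub>add_monoid ?R\<^esub> x = - x"
          using neg[OF sub[OF u(1)]] by (simp add: a_inv_def u(2))
        also have "\<dots> = ?h (scale (- 1) u)" unfolding scl[symmetric] u(2) by simp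
        finally show ?thesis
          using gpart_scale_UNIV[OF u(1) polys_uminus[OF polys_one]] by blast
      qed
    qed
    show l: "x \<otimes>\<^bsub>?R\<^esub> a \<in> ?G" if ax: "a \<in> ?G" "x \<in> carrier ?R" for a x
    proof -
      obtain u where u: "u \<in> gpart m n B g UNIV" "a = ?h u" using ax(1) by blast
      have "x \<otimes>\<^bsub>?R\<^esub> a = ?h (scale x u)" by (simp only: ops u(2) scl)
      then show ?thesis using gpart_scale_UNIV[OF u(1) ax(2)] by (rule image_eqI)
    qed
    show "a \<otimes>\<^bsub>?R\<^esub> x \<in> ?G" if "a \<in> ?G" "x \<in> carrier ?R" for a x
      using l[OF that] by (simp only: ops mult.commute[of a x])
  qed
  show ?thesis
  proof
    have "f b \<in> ?G" if "b \<in> B" for b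
      by (rule image_eqI[of _ _ "single b 1"]) (use gpart_UNIV[OF gpart_basis[OF that refl]] in auto)
    then show "Idl\<^bsub>?R\<^esub> (f ` B) \<subseteq> ?G"
      by (intro R.genideal_minimal[OF ideal]) blast
    interpret J: ideal "Idl\<^bsub>?R\<^esub> (f ` B)" ?R
      by (rule R.genideal_ideal[OF f])
    show "?G \<subseteq> Idl\<^bsub>?R\<^esub> (f ` B)"
    proof
      fix x assume "x \<in> ?G"
      then obtain u where u: "u \<in> gpart m n B g UNIV" "x = ?h u" by blast
      have "(\<Sum>b\<in>A. coef u b * f b) \<in> Idl\<^bsub>?R\<^esub> (f ` B)" if "A \<subseteq> supp u" for A
        using finite_subset[OF that finite_keys] that
      proof (induction A)
        case empty
        then show ?case using J.zero_closed by (simp add: ops)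
      next
        case (insert b A)
        then have "f b \<in> Idl\<^bsub>?R\<^esub> (f ` B)"
          using R.genideal_self[OF f] gpartD(1)[OF u(1)] by blast
        then have "coef u b * f b \<in> Idl\<^bsub>?R\<^esub> (f ` B)"
          using J.I_l_closed[of "f b" "coef u b"] gpartD(2)[OF u(1), of b] by (simp add: ops)
        then show ?case
          using insert J.a_closed by (simp add: ops)
      qed
      then show "x \<in> Idl\<^bsub>?R\<^esub> (f ` B)" using u(2) by blast
    qed
  qed
qed

lemma single_ideal:
  fixes f :: "'b \<Rightarrow> 'k::field mpol"
  assumes "f ` B \<subseteq> polys m n"
  shows "single c ` (Idl\<^bsub>poly_ring m n\<^esub> (f ` B)) = lin_ext (\<lambda>b. single c (f b)) ` gpart m n B g UNIV"
  unfolding ideal_eq_combinations[OF assms, of g] lin_ext_single_fun by (simp add: image_image)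

lemma ideal_subset_polys:
  fixes f :: "'b \<Rightarrow> 'k::field mpol"
  assumes "f ` B \<subseteq> polys m n"
  shows "Idl\<^bsub>poly_ring m n\<^esub> (f ` B) \<subseteq> polys m n"
proof -
  interpret R: cring "poly_ring m n :: 'k mpol ring" by (rule cring_poly_ring)
  show ?thesis
    using ideal.Icarr[OF R.genideal_ideal[OF assms]] by blast
qed

text \<open>
  The degree in the definitions of linear presentation and linear resolution is only asserted to exist;
  for a nonzero ideal it is the lowest degree of the monomials occurring in elements of the ideal.
\<close>

lemma generated_in_degree_unique:
  fixes I :: "'k::field mpol set"
  assumes "generated_in_degree m n d I" "generated_in_degree m n d' I" "I \<noteq> {0}"
  shows "d = d'"
proof -
  have *: "d \<le> d'" if d: "generated_in_degree m n d I" and d': "generated_in_degree m n d' I" for d d'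
  proof -
    obtain A where A: "A \<subseteq> polys m n" "\<forall>p\<in>A. homogeneous d p" "I = Idl\<^bsub>poly_ring m n\<^esub> A"
      using d unfolding generated_in_degree_def by blast
    obtain A' where A': "A' \<subseteq> polys m n" "\<forall>p\<in>A'. homogeneous d' p" "I = Idl\<^bsub>poly_ring m n\<^esub> A'"
      using d' unfolding generated_in_degree_def by blast
    have I: "I = (\<lambda>u. \<Sum>b\<in>supp u. coef u b * b) ` gpart m n A (\<lambda>_. 0) UNIV"
      using ideal_eq_combinations[of "\<lambda>b. b" A m n "\<lambda>_. 0"] A by simp
    have I': "I = (\<lambda>u. \<Sum>b\<in>supp u. coef u b * b) ` gpart m n A' (\<lambda>_. 0) UNIV"
      using ideal_eq_combinations[of "\<lambda>b. b" A' m n "\<lambda>_. 0"] A' by simp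
    have "\<exists>p\<in>A'. p \<noteq> 0"
    proof (rule ccontr)
      assume none: "\<not> (\<exists>p\<in>A'. p \<noteq> 0)"
      have "x = 0" if x: "x \<in> I" for x
      proof -
        obtain u where u: "u \<in> gpart m n A' (\<lambda>_. 0) UNIV" "x = (\<Sum>b\<in>supp u. coef u b * b)"
          using x unfolding I' by blast
        have "b = 0" if "b \<in> supp u" for b
          using none gpartD(1)[OF u(1) that] by blast
        then show ?thesis unfolding u(2) by (intro sum.neutral ballI) (metis mult_zero_right)
      qed
      moreover have "0 \<in> I"
        unfolding I by (rule image_eqI[of _ _ 0]) simp_all
      ultimately show False using assms(3) by blast
    qed
    then obtain p where p: "p \<in> A'" "p \<noteq> 0" by blast
    then obtain t where t: "t \<in> supp p" by (metis ex_in_conv keys_eq_empty)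
    have "p \<in> I"
    proof -
      interpret R: cring "poly_ring m n :: 'k mpol ring" by (rule cring_poly_ring)
      show ?thesis unfolding A'(3) using R.genideal_self[OF A'(1)] p(1) by blast
    qed
    then obtain u where u: "u \<in> gpart m n A (\<lambda>_. 0) UNIV" "p = (\<Sum>b\<in>supp u. coef u b * b)"
      unfolding I by blast
    obtain b where b: "b \<in> supp u" "t \<in> supp (coef u b * b)"
      using t keys_sum[of "\<lambda>b. coef u b * b" "supp u"] unfolding u(2) by blast
    then obtain s r where "t = s + r" "r \<in> supp b"
      using keys_mult[of "coef u b" b] by blast
    moreover have "homogeneous d b" using A(2) gpartD(1)[OF u(1) b(1)] by blast
    moreover have "mdeg t = d'" using t p(1) A'(2) by (simp add: homogeneous_def)
    ultimately show ?thesis by (auto simp: homogeneous_def)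
  qed
  from *[OF assms(1,2)] *[OF assms(2,1)] show ?thesis by simp
qed

subsection \<open>Syzygies in the lowest degrees\<close>

lemma columns_row_monomial:
  assumes "bij_betw f {1..m} \<sigma>"
  shows "snd ` supp (row_monomial m f) = \<sigma>"
  using assms by (auto simp: supp_row_monomial image_image bij_betw_def)

lemma mdeg_1E:
  assumes "mdeg t = 1"
  obtains v where "t = single v 1"
proof -
  have "t \<noteq> 0" using assms by auto
  then obtain v where v: "v \<in> supp t" by (metis ex_in_conv keys_eq_empty)
  have sub: "t - single v 1 + single v 1 = t"
    using v by (intro poly_mapping_eqI) (auto simp: lookup_add lookup_minus lookup_single when_def in_keys_iff)
  have "mdeg (t - single v 1) = 0"
    using assms mdeg_add[of "t - single v 1" "single v 1"] unfolding sub by simp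
  then have "t = single v 1"
    using sub by (simp add: mdeg_eq_0_iff)
  then show thesis by (rule that)
qed

lemma bij_betw_with_value:
  assumes "finite \<sigma>" "card \<sigma> = m" "i \<in> {1..m}" "j \<in> \<sigma>"
  obtains f where "bij_betw f {1..m} \<sigma>" "f i = j"
proof -
  have "card ({1..m} - {i}) = card (\<sigma> - {j})" using assms by simp
  then obtain h where h: "bij_betw h ({1..m} - {i}) (\<sigma> - {j})"
    using finite_same_card_bij[of "{1..m} - {i}" "\<sigma> - {j}"] assms(1) by auto
  let ?f = "h(i := j)"
  have "bij_betw ?f ({1..m} - {i}) (\<sigma> - {j})"
    using h by (rule bij_betw_cong[THEN iffD1, rotated]) auto
  then have "bij_betw ?f (({1..m} - {i}) \<union> {i}) ((\<sigma> - {j}) \<union> {?f i})"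
    by (intro notIn_Un_bij_betw) auto
  moreover have "({1..m} - {i}) \<union> {i} = {1..m}" "(\<sigma> - {j}) \<union> {?f i} = \<sigma>"
    using assms(3,4) by auto
  ultimately have "bij_betw ?f {1..m} \<sigma>" by simp
  then show thesis by (rule that) simp
qed

text \<open>
  A variable times a monomial with one position in each row: the row of the variable is the one
  occurring twice, and only its two positions can be exchanged.
\<close>

lemma variable_times_transversal:
  assumes eq: "single (i', k') 1 + row_monomial m f' = single (i, k) 1 + row_monomial m f"
    and i: "i \<in> {1..m}" "i' \<in> {1..m}"
  shows "i' = i" and "\<And>a. a \<in> {1..m} \<Longrightarrow> a \<noteq> i \<Longrightarrow> f' a = f a"
    and "(k' = k \<and> f' i = f i) \<or> (k' = f i \<and> f' i = k)"
proof -
  have e: "(if (i', k') = (a, b) then 1 else 0) + (if f' a = b then 1 else 0) =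
      (if (i, k) = (a, b) then 1 else 0) + (if f a = b then 1 else (0::nat))" if "a \<in> {1..m}" for a b
    using arg_cong[OF eq, of "\<lambda>t. coef t (a, b)"] that
    by (simp only: lookup_add coef_row_monomial lookup_single when_def if_True simp_thms)
  show i': "i' = i"
  proof (rule ccontr)
    assume "i' \<noteq> i"
    then show False
      using e[OF i(1), of k] e[OF i(1), of "f i"] by (auto split: if_splits)
  qed
  show "f' a = f a" if "a \<in> {1..m}" "a \<noteq> i" for a
    using e[OF that(1), of "f a"] that(2) i' by (auto split: if_splits)
  show "(k' = k \<and> f' i = f i) \<or> (k' = f i \<and> f' i = k)"
  proof -
    have "(if k' = k then 1 else 0) + (if f' i = k then 1 else 0) = 1 + (if f i = k then 1 else (0::nat))"
      using e[OF i(1), of k] i' by simp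
    moreover have "(if k' = f i then 1 else 0) + (if f' i = f i then 1 else 0) = (if k = f i then 1 else 0) + (1::nat)"
      using e[OF i(1), of "f i"] i' by simp
    ultimately show ?thesis
      by (cases "f i = k"; cases "k' = k"; cases "f' i = k"; cases "f' i = f i"; cases "k' = f i") simp_all
  qed
qed

text \<open>
  The vertices by which a circuit extends to a clique with one more element. They are what
  the syzygies see: all coefficients of a syzygy at \<open>\<sigma>\<close> lie in the ideal of the variables in good
  columns, as long as linear syzygies generate.
\<close>

definition good_vertex :: "nat \<Rightarrow> nat set set \<Rightarrow> nat set \<Rightarrow> nat \<Rightarrow> bool" where
  "good_vertex m C \<sigma> k \<longleftrightarrow> k \<notin> \<sigma> \<and> (\<forall>\<rho>. \<rho> \<subseteq> insert k \<sigma> \<and> card \<rho> = m \<longrightarrow> \<rho> \<in> C)"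

definition good_vector :: "nat \<Rightarrow> nat set set \<Rightarrow> (nat set \<Rightarrow>\<^sub>0 'k::field mpol) \<Rightarrow> bool" where
  "good_vector m C z \<longleftrightarrow> (\<forall>\<sigma>. \<forall>t\<in>supp (coef z \<sigma>). \<exists>v\<in>supp t. good_vertex m C \<sigma> (snd v))"

abbreviation minor_map :: "nat \<Rightarrow> nat set \<Rightarrow> (nat \<Rightarrow>\<^sub>0 'k::field mpol)" where
  "minor_map m \<equiv> \<lambda>\<sigma>. single 0 (maximal_minor m \<sigma>)"

lemma good_vector_zero: "good_vector m C 0"
  by (simp add: good_vector_def)

lemma good_vector_add: "good_vector m C u \<Longrightarrow> good_vector m C v \<Longrightarrow> good_vector m C (u + v)"
  unfolding good_vector_def lookup_add using keys_add[of "coef u \<sigma>" "coef v \<sigma>" for \<sigma>] by blast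

lemma good_vector_scale: 
  assumes "good_vector m C u"
  shows "good_vector m C (scale p u)"
  unfolding good_vector_def
proof (intro allI ballI)
  fix \<sigma> t assume "t \<in> supp (coef (scale p u) \<sigma>)"
  then obtain s r where sr: "t = s + r" "r \<in> supp (coef u \<sigma>)"
    using keys_mult[of p "coef u \<sigma>"] by auto
  then obtain v where "v \<in> supp r" "good_vertex m C \<sigma> (snd v)"
    using assms unfolding good_vector_def by blast
  moreover from this have "v \<in> supp t" by (simp add: sr(1) in_keys_iff lookup_add)
  ultimately show "\<exists>v\<in>supp t. good_vertex m C \<sigma> (snd v)" by blast
qed

lemma good_vector_lin_ext:
  assumes "\<And>b. b \<in> supp u \<Longrightarrow> good_vector m C (f b)"
  shows "good_vector m C (lin_ext f u)"
proof -
  have "good_vector m C (\<Sum>b\<in>A. scale (coef u b) (f b))" if "A \<subseteq> supp u" for A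
    using finite_subset[OF that finite_keys] that
    by (induction A) (auto intro: good_vector_zero good_vector_add good_vector_scale assms)
  then show ?thesis by (simp add: lin_ext_def)
qed

context
  fixes m n :: nat and C :: "nat set set"
  assumes circs: "\<forall>\<sigma>\<in>C. \<sigma> \<subseteq> {1..n} \<and> card \<sigma> = m"
begin

lemma circuits: "\<sigma> \<in> C \<Longrightarrow> \<sigma> \<subseteq> {1..n} \<and> card \<sigma> = m"
  using circs by blast

lemma circuit_finite: "\<sigma> \<in> C \<Longrightarrow> finite \<sigma>"
  using circuits finite_subset by blast

lemma supp_circuit_minor:
  "\<sigma> \<in> C \<Longrightarrow> supp (maximal_minor m \<sigma> :: 'k::field mpol) = row_monomial m ` {f. bij_betw f {1..m} \<sigma>}"
  using circuits circuit_finite by (intro supp_maximal_minor) auto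

lemma circuit_minor_nonzero: "\<sigma> \<in> C \<Longrightarrow> \<exists>t. t \<in> supp (maximal_minor m \<sigma> :: 'k::field mpol)"
proof -
  assume \<sigma>: "\<sigma> \<in> C"
  obtain f where "bij_betw f {1..m} \<sigma>"
    using finite_same_card_bij[of "{1..m}" \<sigma>] circuits[OF \<sigma>] circuit_finite[OF \<sigma>] by auto
  then show ?thesis unfolding supp_circuit_minor[OF \<sigma>] by blast
qed

lemma circuit_minor_polys:
  assumes "\<sigma> \<in> C"
  shows "(maximal_minor m \<sigma> :: 'k::field mpol) \<in> polys m n"
  unfolding in_polys_iff supp_circuit_minor[OF assms]
  using circuits[OF assms] by (auto simp: supp_row_monomial bij_betw_def)

lemma circuit_minor_homogeneous: "\<sigma> \<in> C \<Longrightarrow> homogeneous m (maximal_minor m \<sigma> :: 'k::field mpol)"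
  unfolding homogeneous_def by (auto simp: supp_circuit_minor)

lemma minor_map_graded:
  "\<sigma> \<in> C \<Longrightarrow> (minor_map m \<sigma> :: nat \<Rightarrow>\<^sub>0 'k::field mpol) \<in> gpart m n {0} (\<lambda>_. 0) {m}"
  using circuit_minor_polys[of \<sigma>] circuit_minor_homogeneous[of \<sigma>]
  by (intro gpart_single) (auto simp: homogeneous_def)

lemma coef_minor_map:
  "coef (coef (lin_ext (minor_map m) z :: nat \<Rightarrow>\<^sub>0 'k::field mpol) 0) t =
    (\<Sum>\<sigma>\<in>supp z. \<Sum>s\<in>supp (coef z \<sigma>). \<Sum>r\<in>supp (maximal_minor m \<sigma> :: 'k mpol).
      coef (coef z \<sigma>) s * coef (maximal_minor m \<sigma>) r when s + r = t)"
  unfolding lin_ext_single_fun by (simp add: lookup_sum coef_mult)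

text \<open>
  The form in which coefficients are compared: a monomial of \<open>\<Sum> z\<^sub>\<rho> m\<^sub>\<rho>\<close> that arises in only
  one way contradicts the vanishing of the sum.
\<close>

lemma unique_contribution:
  fixes z :: "nat set \<Rightarrow>\<^sub>0 'k::field mpol"
  assumes z: "lin_ext (minor_map m) z = 0"
    and t: "t \<in> supp (coef z \<sigma>)" "r \<in> supp (maximal_minor m \<sigma> :: 'k mpol)"
    and uniq: "\<And>\<rho> s r'. \<rho> \<in> supp z \<Longrightarrow> s \<in> supp (coef z \<rho>) \<Longrightarrow>
      r' \<in> supp (maximal_minor m \<rho> :: 'k mpol) \<Longrightarrow> s + r' = t + r \<Longrightarrow> \<rho> = \<sigma> \<and> s = t \<and> r' = r"
  shows False
proof -
  let ?m = "\<lambda>\<sigma>. maximal_minor m \<sigma> :: 'k mpol"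
  let ?c = "\<lambda>\<rho> s r'. coef (coef z \<rho>) s * coef (?m \<rho>) r' when s + r' = t + r"
  have \<sigma>: "\<sigma> \<in> supp z" using t(1) by (auto simp: in_keys_iff)
  have c0: "?c \<rho> s r' = 0"
    if "\<rho> \<in> supp z" "s \<in> supp (coef z \<rho>)" "r' \<in> supp (?m \<rho>)" "\<not> (\<rho> = \<sigma> \<and> s = t \<and> r' = r)" for \<rho> s r'
    using uniq[of \<rho> s r'] that by (auto simp: when_def)
  have "0 = (\<Sum>\<rho>\<in>supp z. \<Sum>s\<in>supp (coef z \<rho>). \<Sum>r'\<in>supp (?m \<rho>). ?c \<rho> s r')"
    using coef_minor_map[of z "t + r"] unfolding z by simp
  also have "\<dots> = (\<Sum>\<rho>\<in>{\<sigma>}. \<Sum>s\<in>supp (coef z \<rho>). \<Sum>r'\<in>supp (?m \<rho>). ?c \<rho> s r')"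
    using \<sigma> c0 by (intro sum.mono_neutral_right) (auto intro!: sum.neutral)
  also have "\<dots> = (\<Sum>s\<in>supp (coef z \<sigma>). \<Sum>r'\<in>supp (?m \<sigma>). ?c \<sigma> s r')"
    by simp
  also have "\<dots> = (\<Sum>s\<in>{t}. \<Sum>r'\<in>supp (?m \<sigma>). ?c \<sigma> s r')"
    using \<sigma> t(1) c0[of \<sigma>] by (intro sum.mono_neutral_right) (auto intro!: sum.neutral)
  also have "\<dots> = (\<Sum>r'\<in>supp (?m \<sigma>). ?c \<sigma> t r')"
    by simp
  also have "\<dots> = (\<Sum>r'\<in>{r}. ?c \<sigma> t r')"
    using \<sigma> t c0[of \<sigma> t] by (intro sum.mono_neutral_right) auto
  also have "\<dots> \<noteq> 0" using t by (simp add: in_keys_iff)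
  finally show False by simp
qed

lemma minors_independent:
  fixes z :: "nat set \<Rightarrow>\<^sub>0 'k::field mpol"
  assumes z: "z \<in> gpart m n C (\<lambda>_. m) {j}" "lin_ext (minor_map m) z = 0" and j: "j \<le> m"
  shows "z = 0"
proof (rule ccontr)
  assume "z \<noteq> 0"
  then obtain \<sigma> where \<sigma>: "\<sigma> \<in> supp z" by (metis ex_in_conv keys_eq_empty)
  then have "coef z \<sigma> \<noteq> 0" by (simp add: in_keys_iff)
  then obtain t where t: "t \<in> supp (coef z \<sigma>)" by (metis ex_in_conv keys_eq_empty)
  have s0: "s = 0" if "s \<in> supp (coef z \<rho>)" for s \<rho>
    using gpartD(4)[OF z(1) that] j by (simp add: mdeg_eq_0_iff[symmetric])
  have C: "\<rho> \<in> C" if "\<rho> \<in> supp z" for \<rho> using gpartD(1)[OF z(1) that] .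
  obtain r where r: "r \<in> supp (maximal_minor m \<sigma> :: 'k mpol)"
    using circuit_minor_nonzero[OF C[OF \<sigma>]] by blast
  show False
  proof (rule unique_contribution[OF z(2) t r])
    fix \<rho> s r' assume *: "\<rho> \<in> supp z" "s \<in> supp (coef z \<rho>)" "r' \<in> supp (maximal_minor m \<rho> :: 'k mpol)" "s + r' = t + r"
    then have "s = t" "r' = r" using s0[OF *(2)] s0[OF t] by simp_all
    moreover have "snd ` supp r' = \<rho>" "snd ` supp r = \<sigma>"
      using *(3) r columns_row_monomial unfolding supp_circuit_minor[OF C[OF *(1)]] supp_circuit_minor[OF C[OF \<sigma>]] by blast+
    ultimately show "\<rho> = \<sigma> \<and> s = t \<and> r' = r" by simp
  qed
qed

text \<open>
  Suppose \<open>x\<^sub>i\<^sub>k\<close> occurs in the coefficient at \<open>\<sigma>\<close>, and multiply it with a monomial of the minor of \<open>\<sigma>\<close>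
  that uses column \<open>j\<close> in row \<open>i\<close>. The product arises in at most one other way, by exchanging \<open>j\<close> and \<open>k\<close>,
  which involves the minor of \<open>\<sigma> - {j} \<union> {k}\<close>. If \<open>k \<in> \<sigma>\<close>, taking \<open>j = k\<close> leaves no other way at all. Otherwise every
  choice of \<open>j\<close> forces \<open>\<sigma> - {j} \<union> {k}\<close> to be a circuit, so \<open>\<sigma> \<union> {k}\<close> is a clique.
\<close>

lemma linear_syzygy_good:
  fixes z :: "nat set \<Rightarrow>\<^sub>0 'k::field mpol"
  assumes z: "z \<in> gpart m n C (\<lambda>_. m) {m + 1}" "lin_ext (minor_map m) z = 0"
  shows "good_vector m C z"
  unfolding good_vector_def
proof (intro allI ballI)
  fix \<sigma> t assume t: "t \<in> supp (coef z \<sigma>)"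
  have var: "\<exists>i k. s = single (i, k) 1 \<and> i \<in> {1..m}" if "s \<in> supp (coef z \<rho>)" for s \<rho>
  proof -
    have "mdeg s = 1" using gpartD(4)[OF z(1) that] by simp
    then obtain v where v: "s = single v 1" by (rule mdeg_1E)
    then show ?thesis using gpartD(3)[OF z(1) that] by (cases v) auto
  qed
  have C: "\<rho> \<in> C" if "\<rho> \<in> supp z" for \<rho> using gpartD(1)[OF z(1) that] .
  have \<sigma>: "\<sigma> \<in> C" using t by (intro C) (auto simp: in_keys_iff)
  obtain i k where ik: "t = single (i, k) 1" "i \<in> {1..m}" using var[OF t] by blast
  have contra: False if f: "bij_betw f {1..m} \<sigma>" and alt: "k = f i \<or> insert k (\<sigma> - {f i}) \<notin> C" for f
  proof (rule unique_contribution[OF z(2) t])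
    show "row_monomial m f \<in> supp (maximal_minor m \<sigma> :: 'k mpol)"
      unfolding supp_circuit_minor[OF \<sigma>] using f by blast
    fix \<rho> s r' assume *: "\<rho> \<in> supp z" "s \<in> supp (coef z \<rho>)" "r' \<in> supp (maximal_minor m \<rho> :: 'k mpol)"
      "s + r' = t + row_monomial m f"
    obtain i' k' where s: "s = single (i', k') 1" "i' \<in> {1..m}" using var[OF *(2)] by blast
    obtain f' where f': "bij_betw f' {1..m} \<rho>" "r' = row_monomial m f'"
      using *(3) unfolding supp_circuit_minor[OF C[OF *(1)]] by blast
    note e = variable_times_transversal[OF *(4)[unfolded s(1) f'(2) ik(1)] ik(2) s(2)]
    have same: "\<rho> = \<sigma> \<and> s = t \<and> r' = row_monomial m f" if "f' i = f i" "k' = k"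
    proof -
      have "f' a = f a" if "a \<in> {1..m}" for a using e(2)[OF that] \<open>f' i = f i\<close> by (cases "a = i") auto
      then have "r' = row_monomial m f" unfolding f'(2) by (rule row_monomial_cong)
      moreover have "\<rho> = \<sigma>"
        using \<open>r' = row_monomial m f\<close> f'(2) columns_row_monomial[OF f'(1)] columns_row_monomial[OF f] by simp
      moreover have "s = t" using s(1) ik(1) e(1) that(2) by simp
      ultimately show "\<rho> = \<sigma> \<and> s = t \<and> r' = row_monomial m f" by blast
    qed
    show "\<rho> = \<sigma> \<and> s = t \<and> r' = row_monomial m f"
    proof (cases "k' = k \<and> f' i = f i")
      case False
      with e(3) have sw: "k' = f i" "f' i = k" by auto
      show ?thesis
      proof (cases "k = f i")
        case True
        with sw same show ?thesis by simp
      next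
        case False
        have "\<rho> = insert (f' i) (f' ` ({1..m} - {i}))"
          using f'(1) ik(2) by (auto simp: bij_betw_def)
        also have "f' ` ({1..m} - {i}) = f ` ({1..m} - {i})"
          using e(2) by (intro image_cong) auto
        also have "\<dots> = f ` {1..m} - f ` {i}"
          using f ik(2) by (intro inj_on_image_set_diff[of f "{1..m}"]) (auto simp: bij_betw_def)
        also have "\<dots> = \<sigma> - {f i}"
          using f by (simp add: bij_betw_def)
        finally have "\<rho> = insert k (\<sigma> - {f i})" using sw(2) by simp
        then show ?thesis using alt False C[OF *(1)] by blast
      qed
    qed (use same in blast)
  qed
  have k\<sigma>: "k \<notin> \<sigma>"
  proof
    assume "k \<in> \<sigma>"
    then obtain f where "bij_betw f {1..m} \<sigma>" "f i = k"
      using bij_betw_with_value[of \<sigma> m i k] circuits[OF \<sigma>] circuit_finite[OF \<sigma>] ik(2) by blast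
    then show False using contra by blast
  qed
  moreover have "\<rho> \<in> C" if \<rho>: "\<rho> \<subseteq> insert k \<sigma>" "card \<rho> = m" for \<rho>
  proof (cases "k \<in> \<rho>")
    case False
    then have "\<rho> \<subseteq> \<sigma>" using \<rho>(1) by blast
    then have "\<rho> = \<sigma>" using card_subset_eq[OF circuit_finite[OF \<sigma>]] circuits[OF \<sigma>] \<rho>(2) by simp
    then show ?thesis using \<sigma> by simp
  next
    case True
    have fin: "finite \<rho>" using \<rho>(1) circuit_finite[OF \<sigma>] finite_subset by blast
    have "\<not> \<sigma> \<subseteq> \<rho>"
    proof
      assume "\<sigma> \<subseteq> \<rho>"
      then have "\<sigma> = \<rho>" using card_subset_eq[OF fin] circuits[OF \<sigma>] \<rho>(2) by simp
      then show False using True k\<sigma> by simp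
    qed
    then obtain j where j: "j \<in> \<sigma>" "j \<notin> \<rho>" by blast
    have "\<rho> \<subseteq> insert k (\<sigma> - {j})" using \<rho>(1) j(2) by blast
    moreover have "card (insert k (\<sigma> - {j})) = card \<rho>"
      using k\<sigma> j(1) circuit_finite[OF \<sigma>] circuits[OF \<sigma>] \<rho>(2) card_gt_0_iff[of \<sigma>] by auto
    ultimately have "\<rho> = insert k (\<sigma> - {j})"
      using circuit_finite[OF \<sigma>] by (intro card_subset_eq) auto
    moreover obtain f where "bij_betw f {1..m} \<sigma>" "f i = j"
      using bij_betw_with_value[of \<sigma> m i j] circuits[OF \<sigma>] circuit_finite[OF \<sigma>] ik(2) j(1) by blast
    ultimately show ?thesis using contra by blast
  qed
  ultimately show "\<exists>v\<in>supp t. good_vertex m C \<sigma> (snd v)"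
    unfolding ik(1) good_vertex_def by auto
qed

section \<open>From linear presentation to completeness\<close>

text \<open>
  Compare the presentation by minors with the resolution \<open>F\<close> by maps \<open>\<alpha>\<close> and \<open>\<beta>\<close> over the ideal; by independence of the minors
  \<open>\<beta>\<alpha>\<close> is the identity. The image of a syzygy \<open>z\<close> of degree \<open>j > m + 1\<close> is a boundary \<open>d w\<close>
  whose constant part vanishes, so the constant part of \<open>w\<close> is a cycle. By assumption it is a boundary,
  and after subtracting one from \<open>w\<close> all coefficients of \<open>w\<close> are without constant term. Thus \<open>z = \<beta> (d w)\<close>
  is a combination of syzygies of smaller degree, and induction applies.
\<close>

lemma syzygy_good:
  fixes z :: "nat set \<Rightarrow>\<^sub>0 'k::field mpol" and J :: "'k mpol set"
  assumes F: "graded_free_resolution m n J F" and J: "J = det_facet_ideal m n C"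
    and lin: "\<And>j. j \<noteq> m + 1 \<Longrightarrow> tor_dim F 1 j = 0"
    and z: "z \<in> gpart m n C (\<lambda>_. m) {j}" "lin_ext (minor_map m) z = 0"
  shows "good_vector m C z"
proof -
  let ?A = "aug_gens F" and ?g = "aug_deg F" and ?d = "aug_bd F"
  let ?M = "minor_map m :: nat set \<Rightarrow> (nat \<Rightarrow>\<^sub>0 'k mpol)"
  have polys: "maximal_minor m ` C \<subseteq> (polys m n :: 'k mpol set)"
    using circuit_minor_polys by blast
  have JP: "J \<subseteq> polys m n"
    unfolding J det_facet_ideal_def by (rule ideal_subset_polys[OF polys])
  have J_image: "single 0 ` J = lin_ext ?M ` gpart m n C (\<lambda>_. m) UNIV"
    unfolding J det_facet_ideal_def by (rule single_ideal[OF polys])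
  have ac: "acyclic_complex m n ?A ?g ?d" by (rule resolution_acyclic[OF F JP])
  then have ch: "chain_complex m n ?A ?g ?d" by (simp add: acyclic_complex_def)
  have M: "?M \<sigma> \<in> gpart m n {0} (\<lambda>_. 0) {m}" if "\<sigma> \<in> C" for \<sigma>
    using that by (rule minor_map_graded)
  have d0: "?d 0 b \<in> gpart m n {0} (\<lambda>_. 0) {?g 1 b}" if "b \<in> ?A 1" for b
    using chain_complexD(1)[OF ch, of b 0] that by simp
  have "\<exists>y\<in>gpart m n (?A 1) (?g 1) {m}. lin_ext (?d 0) y = ?M \<sigma>" if \<sigma>: "\<sigma> \<in> C" for \<sigma>
  proof -
    have "?M \<sigma> \<in> lin_ext ?M ` gpart m n C (\<lambda>_. m) UNIV"
      by (rule image_eqI[of _ _ "single \<sigma> 1"]) (use gpart_UNIV[OF gpart_basis[OF \<sigma> refl]] in simp_all)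
    then obtain w where w: "w \<in> gpart m n (?A 1) (?g 1) UNIV" "lin_ext (?d 0) w = ?M \<sigma>"
      unfolding J_image[symmetric] resolution_image[OF F, symmetric] by auto
    show ?thesis by (rule homogeneous_preimage[OF w(2) M[OF \<sigma>] w(1) d0])
  qed
  then obtain \<alpha> where \<alpha>: "\<And>\<sigma>. \<sigma> \<in> C \<Longrightarrow> \<alpha> \<sigma> \<in> gpart m n (?A 1) (?g 1) {m}"
    "\<And>\<sigma>. \<sigma> \<in> C \<Longrightarrow> lin_ext (?d 0) (\<alpha> \<sigma>) = ?M \<sigma>"
    by metis
  have "\<exists>y\<in>gpart m n C (\<lambda>_. m) {?g 1 b}. lin_ext ?M y = ?d 0 b" if b: "b \<in> ?A 1" for b
  proof -
    have "?d 0 b \<in> lin_ext (?d 0) ` gpart m n (?A 1) (?g 1) UNIV"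
      by (rule image_eqI[of _ _ "single b 1"]) (use gpart_UNIV[OF gpart_basis[OF b refl]] in simp_all)
    then have "?d 0 b \<in> single 0 ` J"
      using resolution_image[OF F] by simp
    then obtain w where w: "w \<in> gpart m n C (\<lambda>_. m) UNIV" "lin_ext ?M w = ?d 0 b"
      unfolding J_image by auto
    show ?thesis by (rule homogeneous_preimage[OF w(2) d0[OF b] w(1) M])
  qed
  then obtain \<beta> where \<beta>: "\<And>b. b \<in> ?A 1 \<Longrightarrow> \<beta> b \<in> gpart m n C (\<lambda>_. m) {?g 1 b}"
    "\<And>b. b \<in> ?A 1 \<Longrightarrow> lin_ext ?M (\<beta> b) = ?d 0 b"
    by metis
  have \<beta>_map: "lin_ext ?M (lin_ext \<beta> u) = lin_ext (?d 0) u" if "u \<in> gpart m n (?A 1) (?g 1) D" for u D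
    unfolding lin_ext_lin_ext by (rule lin_ext_cong) (rule \<beta>(2)[OF gpartD(1)[OF that]])
  have ret: "lin_ext \<beta> (\<alpha> \<sigma>) = single \<sigma> 1" if \<sigma>: "\<sigma> \<in> C" for \<sigma>
  proof -
    have "lin_ext \<beta> (\<alpha> \<sigma>) - single \<sigma> 1 = 0"
    proof (rule minors_independent)
      show "lin_ext \<beta> (\<alpha> \<sigma>) - single \<sigma> 1 \<in> gpart m n C (\<lambda>_. m) {m}"
        by (intro gpart_diff gpart_lin_ext[OF \<alpha>(1)[OF \<sigma>] \<beta>(1)] gpart_basis[OF \<sigma> refl])
      show "lin_ext ?M (lin_ext \<beta> (\<alpha> \<sigma>) - single \<sigma> 1) = 0"
        using \<beta>_map[OF \<alpha>(1)[OF \<sigma>]] \<alpha>(2)[OF \<sigma>] by (simp add: lin_ext_diff)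
    qed simp_all
    then show ?thesis by simp
  qed
  show ?thesis
    using z
  proof (induction j arbitrary: z rule: less_induct)
    case (less j)
    consider "j \<le> m" | "j = m + 1" | "m + 1 < j" by linarith
    then show ?case
    proof cases
      case 1
      then have "z = 0"
        using less.prems by (intro minors_independent)
      then show ?thesis by (simp add: good_vector_zero)
    next
      case 2
      then show ?thesis
        using less.prems by (intro linear_syzygy_good) simp_all
    next
      case 3
      let ?az = "lin_ext \<alpha> z"
      have az: "?az \<in> gpart m n (?A 1) (?g 1) {j}"
        by (rule gpart_lin_ext[OF less.prems(1) \<alpha>(1)])
      have "lin_ext (?d 0) ?az = lin_ext ?M z"
        unfolding lin_ext_lin_ext by (rule lin_ext_cong) (rule \<alpha>(2)[OF gpartD(1)[OF less.prems(1)]])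
      then have "lin_ext (?d 0) ?az = 0" using less.prems(2) by simp
      then obtain w where w: "w \<in> gpart m n (?A 2) (?g 2) {j}" "lin_ext (?d 1) w = ?az"
        using homogeneous_bounding_chain[OF ac, of ?az 0 j] az by (auto simp: numeral_2_eq_2)
      have "const_part z = 0"
        using supp_const_part[OF less.prems(1)] 3 by auto
      then have "lin_ext (tensor_bd F 0) (const_part w) = 0"
        using arg_cong[OF w(2), of const_part] unfolding const_part_lin_ext
        by (simp add: tensor_bd_eq[abs_def])
      then have "const_part w \<in> tensor_cycles F 1 j"
        using supp_const_part[OF w(1)] by (simp add: tensor_part_eq numeral_2_eq_2)
      moreover have "tensor_cycles F 1 j = tensor_boundaries F 1 j"
      proof -
        have fin: "\<And>i j. finite (gens_deg F i j)"
          using F by (simp add: graded_free_resolution_def)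
        show ?thesis
          using lin[of j] 3 tor_dim_eq_0_iff[OF fin tensor_boundaries_subset_cycles[OF F JP]] by auto
      qed
      ultimately obtain y where y: "y \<in> tensor_part F 2 j" "const_part w = lin_ext (tensor_bd F 1) y"
        unfolding tensor_boundaries_def by (auto simp: numeral_2_eq_2)
      have y': "of_const y \<in> gpart m n (?A (Suc 2)) (?g (Suc 2)) {j}"
        using y(1) by (intro of_const_gpart) (auto simp: tensor_part_eq numeral_2_eq_2 numeral_3_eq_3)
      define w' where "w' = w - lin_ext (?d 2) (of_const y)"
      have w': "w' \<in> gpart m n (?A 2) (?g 2) {j}"
        unfolding w'_def by (rule gpart_diff[OF w(1) gpart_lin_ext[OF y' chain_complexD(1)[OF ch]]])
      have "const_part w' = 0"
        using y(2) by (simp add: w'_def const_part_diff const_part_lin_ext tensor_bd_eq[abs_def] numeral_2_eq_2)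
      have "lin_ext (?d 1) (lin_ext (?d 2) (of_const y)) = 0"
        unfolding lin_ext_lin_ext numeral_2_eq_2
        by (rule lin_ext_zero_fun, unfold One_nat_def, rule chain_complexD(2)[OF ch])
          (use gpartD(1)[OF y'] in \<open>simp add: numeral_2_eq_2\<close>)
      then have dw': "lin_ext (?d 1) w' = ?az"
        using w(2) by (simp add: w'_def lin_ext_diff)
      have "z = lin_ext \<beta> ?az"
      proof -
        have "lin_ext \<beta> ?az = lin_ext (\<lambda>\<sigma>. single \<sigma> 1) z"
          unfolding lin_ext_lin_ext by (rule lin_ext_cong) (rule ret[OF gpartD(1)[OF less.prems(1)]])
        then show ?thesis by simp
      qed
      also have "\<dots> = lin_ext (\<lambda>b. lin_ext \<beta> (?d 1 b)) w'"
        unfolding dw'[symmetric] lin_ext_lin_ext ..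
      finally have z_eq: "z = lin_ext (\<lambda>b. lin_ext \<beta> (?d 1 b)) w'" .
      have "good_vector m C (lin_ext \<beta> (?d 1 b))" if b: "b \<in> supp w'" for b
      proof (rule less.IH)
        have bA: "b \<in> ?A 2" by (rule gpartD(1)[OF w' b])
        obtain t where t: "t \<in> supp (coef w' b)"
          using b by (metis ex_in_conv in_keys_iff keys_eq_empty)
        \<comment> \<open>every term of \<open>w'\<close> involves a variable, so its basis elements have degree below \<open>j\<close>\<close>
        have "t \<noteq> 0"
          using t arg_cong[OF \<open>const_part w' = 0\<close>, of "\<lambda>u. coef u b"] by (auto simp: in_keys_iff)
        then show "?g 2 b < j"
          using gpartD(4)[OF w' t] mdeg_eq_0_iff[of t] by auto
        have db: "?d 1 b \<in> gpart m n (?A 1) (?g 1) {?g 2 b}"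
          using chain_complexD(1)[OF ch, of b 1] bA by (simp add: numeral_2_eq_2)
        show "lin_ext \<beta> (?d 1 b) \<in> gpart m n C (\<lambda>_. m) {?g 2 b}"
          by (rule gpart_lin_ext[OF db \<beta>(1)])
        show "lin_ext ?M (lin_ext \<beta> (?d 1 b)) = 0"
          unfolding \<beta>_map[OF db] using chain_complexD(2)[OF ch, of b 0] bA by (simp add: numeral_2_eq_2)
      qed
      then show ?thesis unfolding z_eq by (rule good_vector_lin_ext)
    qed
  qed
qed

text \<open>
  Apply the previous lemma to the Koszul syzygy of two minors: each monomial of the minor of
  \<open>\<tau>\<close>, the coefficient at \<open>\<sigma>\<close>, contains a variable in a good column, and all its columns belong to \<open>\<tau>\<close>.
\<close>

lemma good_vertex_towards:
  fixes J :: "'k::field mpol set"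
  assumes F: "graded_free_resolution m n J F" and J: "J = det_facet_ideal m n C"
    and lin: "\<And>j. j \<noteq> m + 1 \<Longrightarrow> tor_dim F 1 j = 0"
    and \<sigma>: "\<sigma> \<in> C" and \<tau>: "\<tau> \<in> C" and ne: "\<sigma> \<noteq> \<tau>"
  shows "\<exists>k\<in>\<tau>. good_vertex m C \<sigma> k"
proof -
  let ?m = "\<lambda>\<sigma>. maximal_minor m \<sigma> :: 'k mpol"
  let ?z = "single \<sigma> (?m \<tau>) - single \<tau> (?m \<sigma>)"
  note polys = circuit_minor_polys
  note hom = circuit_minor_homogeneous[unfolded homogeneous_def, rule_format]
  note minor_supp = supp_circuit_minor
  have "good_vector m C ?z"
  proof (rule syzygy_good[OF F J lin])
    show "?z \<in> gpart m n C (\<lambda>_. m) {m + m}"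
      using \<sigma> \<tau> polys hom by (intro gpart_diff gpart_single) auto
    show "lin_ext (minor_map m) ?z = 0"
      by (simp add: lin_ext_diff mult.commute)
  qed
  moreover have "coef ?z \<sigma> = ?m \<tau>"
    using ne by (simp add: lookup_minus lookup_single)
  moreover obtain t where t: "t \<in> supp (?m \<tau>)"
    using circuit_minor_nonzero[OF \<tau>] by blast
  ultimately obtain v where v: "v \<in> supp t" "good_vertex m C \<sigma> (snd v)"
    unfolding good_vector_def by metis
  obtain f where f: "bij_betw f {1..m} \<tau>" "t = row_monomial m f"
    using t unfolding minor_supp[OF \<tau>] by blast
  have "snd v \<in> \<tau>"
    using columns_row_monomial[OF f(1)] v(1) f(2) by blast
  with v(2) show ?thesis by blast
qed

text \<open>
  A vertex that extends one circuit inside a clique \<open>U\<close> extends all of \<open>U\<close>. The remaining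
  elements are exchanged one at a time: if two circuits differ in one element, then the
  only vertex of the second outside the first is good, so their union is a clique.
\<close>

lemma clique_extend:
  assumes ext: "\<And>\<sigma> \<tau>. \<sigma> \<in> C \<Longrightarrow> \<tau> \<in> C \<Longrightarrow> \<sigma> \<noteq> \<tau> \<Longrightarrow> \<exists>k\<in>\<tau>. good_vertex m C \<sigma> k"
    and U: "\<And>\<rho>. \<rho> \<subseteq> U \<Longrightarrow> card \<rho> = m \<Longrightarrow> \<rho> \<in> C" "finite U"
    and \<sigma>: "\<sigma> \<in> C" "\<sigma> \<subseteq> U" and k: "good_vertex m C \<sigma> k" "k \<notin> U" and m: "m \<ge> 1"
    and \<rho>: "\<rho> \<subseteq> insert k U" "card \<rho> = m"
  shows "\<rho> \<in> C"
proof (cases "k \<in> \<rho>")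
  case False
  then show ?thesis using \<rho> U by blast
next
  case True
  have "insert k P \<in> C" if "P \<subseteq> U" "card P = m - 1" for P
    using that
  proof (induction "card (P - \<sigma>)" arbitrary: P)
    case 0
    have finP: "finite P" using 0(2) U(2) finite_subset by blast
    then have "P \<subseteq> \<sigma>" using 0(1) by simp
    then have "insert k P \<subseteq> insert k \<sigma>" by blast
    moreover have "card (insert k P) = m"
      using 0(2,3) finP k(2) m by (subst card_insert_disjoint) auto
    ultimately show ?case using k(1) by (auto simp: good_vertex_def)
  next
    case (Suc l)
    have finP: "finite P" using Suc(3) U(2) finite_subset by blast
    have "P - \<sigma> \<noteq> {}" using Suc(2) by (metis card.empty nat.distinct(1))
    then obtain p where p: "p \<in> P" "p \<notin> \<sigma>" by blast
    have "\<not> \<sigma> \<subseteq> P"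
    proof
      assume "\<sigma> \<subseteq> P"
      then have "m \<le> m - 1" using card_mono[OF finP] Suc(4) circuits[OF \<sigma>(1)] by metis
      then show False using m by simp
    qed
    then obtain u where u: "u \<in> \<sigma>" "u \<notin> P" by blast
    let ?P = "insert u (P - {p})"
    have uU: "u \<in> U" using u(1) \<sigma>(2) by blast
    have "?P - \<sigma> = (P - \<sigma>) - {p}" using u by blast
    then have "l = card (?P - \<sigma>)" using Suc(2) p finP by simp
    moreover have P': "?P \<subseteq> U" using Suc(3) uU by blast
    moreover have "card ?P = m - 1"
    proof -
      have "card ?P = Suc (card (P - {p}))" using u(2) finP by (intro card_insert_disjoint) auto
      also have "\<dots> = card P" by (rule card_Suc_Diff1[OF finP p(1)])
      finally show ?thesis by (simp only: Suc(4))
    qed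
    ultimately have \<sigma>1: "insert k ?P \<in> C" by (rule Suc(1))
    have "insert u P \<subseteq> U" "card (insert u P) = m"
      using Suc(3,4) uU u finP m by (auto simp: card_insert_disjoint)
    then have \<tau>1: "insert u P \<in> C" by (rule U(1))
    have kP: "k \<notin> insert u P" using Suc(3) uU k(2) by blast
    then have "insert k ?P \<noteq> insert u P" by blast
    then obtain v where v: "v \<in> insert u P" "good_vertex m C (insert k ?P) v"
      using ext[OF \<sigma>1 \<tau>1] by blast
    then have "v = p" by (auto simp: good_vertex_def)
    have "insert k P \<subseteq> insert p (insert k ?P)" by blast
    moreover have "card (insert k P) = m"
      using Suc(4) finP kP m by (subst card_insert_disjoint) auto
    ultimately show ?case using v(2) unfolding \<open>v = p\<close> good_vertex_def by blast
  qed
  moreover have "\<rho> - {k} \<subseteq> U" "card (\<rho> - {k}) = m - 1"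
    using \<rho> True by auto
  ultimately have "insert k (\<rho> - {k}) \<in> C" by blast
  then show ?thesis using True by (simp add: insert_absorb)
qed

text \<open>
  Let \<open>U\<close> be a clique of maximal size, and suppose that a circuit \<open>\<tau>\<close> is not contained in it. For a circuit
  \<open>\<sigma> \<subseteq> U\<close> missing as few elements of \<open>\<tau>\<close> as possible, there is a good vertex \<open>k \<in> \<tau> - \<sigma>\<close>. If \<open>k \<in> U\<close>,
  exchanging it for an element of \<open>\<sigma> - \<tau>\<close> gives a better \<open>\<sigma>\<close>; otherwise \<open>U \<union> {k}\<close> is a larger clique.
\<close>

lemma all_subsets_circuits:
  assumes ext: "\<And>\<sigma> \<tau>. \<sigma> \<in> C \<Longrightarrow> \<tau> \<in> C \<Longrightarrow> \<sigma> \<noteq> \<tau> \<Longrightarrow> \<exists>k\<in>\<tau>. good_vertex m C \<sigma> k"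
    and cover: "\<And>v. v \<in> {1..n} \<Longrightarrow> \<exists>\<tau>\<in>C. v \<in> \<tau>" and C0: "C \<noteq> {}" and m: "m \<ge> 1"
    and \<rho>: "\<rho> \<subseteq> {1..n}" "card \<rho> = m"
  shows "\<rho> \<in> C"
proof -
  define Q where "Q U \<longleftrightarrow> U \<subseteq> {1..n} \<and> (\<forall>\<rho>. \<rho> \<subseteq> U \<and> card \<rho> = m \<longrightarrow> \<rho> \<in> C) \<and> (\<exists>\<sigma>\<in>C. \<sigma> \<subseteq> U)" for U
  obtain \<sigma>0 where \<sigma>0: "\<sigma>0 \<in> C" using C0 by blast
  have "Q \<sigma>0"
  proof -
    have "\<rho> \<in> C" if "\<rho> \<subseteq> \<sigma>0" "card \<rho> = m" for \<rho>
    proof -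
      have "\<rho> = \<sigma>0"
        using card_subset_eq[OF _ that(1)] that(2) circuits[OF \<sigma>0] finite_subset by fastforce
      then show ?thesis using \<sigma>0 by simp
    qed
    then show ?thesis using \<sigma>0 circuits by (auto simp: Q_def)
  qed
  moreover have "card U \<le> n" if "Q U" for U
    using that card_mono[of "{1..n}" U] by (auto simp: Q_def)
  ultimately have "\<exists>U. Q U \<and> (\<forall>V. Q V \<longrightarrow> card V \<le> card U)"
    using ex_has_greatest_nat[of Q \<sigma>0 card "Suc n"] by (metis less_Suc_eq_le)
  then obtain U where U: "Q U" "\<And>V. Q V \<Longrightarrow> card V \<le> card U" by blast
  have finU: "finite U" using U(1) finite_subset by (auto simp: Q_def)
  have sub: "\<tau> \<subseteq> U" if \<tau>: "\<tau> \<in> C" for \<tau>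
  proof (rule ccontr)
    assume \<tau>U: "\<not> \<tau> \<subseteq> U"
    have fin\<tau>: "finite \<tau>" using circuits[OF \<tau>] finite_subset by blast
    obtain \<sigma> where \<sigma>: "\<sigma> \<in> C" "\<sigma> \<subseteq> U"
      and least: "\<And>\<sigma>'. \<sigma>' \<in> C \<Longrightarrow> \<sigma>' \<subseteq> U \<Longrightarrow> card (\<tau> - \<sigma>) \<le> card (\<tau> - \<sigma>')"
    proof -
      obtain s where "s \<in> C \<and> s \<subseteq> U" using U(1) by (auto simp: Q_def)
      then show thesis
        using ex_has_least_nat[of "\<lambda>\<sigma>. \<sigma> \<in> C \<and> \<sigma> \<subseteq> U" s "\<lambda>\<sigma>. card (\<tau> - \<sigma>)"] that by blast
    qed
    have "\<sigma> \<noteq> \<tau>" using \<sigma>(2) \<tau>U by blast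
    then obtain k where k: "k \<in> \<tau>" "good_vertex m C \<sigma> k" using ext[OF \<sigma>(1) \<tau>] by blast
    have k\<sigma>: "k \<notin> \<sigma>" using k(2) by (simp add: good_vertex_def)
    show False
    proof (cases "k \<in> U")
      case True
      have fin\<sigma>: "finite \<sigma>" using \<sigma>(2) finU finite_subset by blast
      have "\<not> \<sigma> \<subseteq> \<tau>"
      proof
        assume "\<sigma> \<subseteq> \<tau>"
        then have "\<sigma> = \<tau>" using card_subset_eq[OF fin\<tau>] circuits[OF \<sigma>(1)] circuits[OF \<tau>] by simp
        then show False using \<open>\<sigma> \<noteq> \<tau>\<close> by simp
      qed
      then obtain s where s: "s \<in> \<sigma>" "s \<notin> \<tau>" by blast
      let ?\<sigma> = "insert k (\<sigma> - {s})"
      have "?\<sigma> \<subseteq> U" using \<sigma>(2) True by blast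
      moreover have "card ?\<sigma> = m"
        using fin\<sigma> s(1) k\<sigma> circuits[OF \<sigma>(1)] card_Suc_Diff1[of \<sigma> s] by (simp add: card_insert_disjoint)
      ultimately have "?\<sigma> \<in> C" using U(1) by (auto simp: Q_def)
      then have "card (\<tau> - \<sigma>) \<le> card (\<tau> - ?\<sigma>)" using \<open>?\<sigma> \<subseteq> U\<close> by (rule least)
      moreover have "\<tau> - ?\<sigma> \<subset> \<tau> - \<sigma>" using s k(1) k\<sigma> by blast
      then have "card (\<tau> - ?\<sigma>) < card (\<tau> - \<sigma>)" using fin\<tau> by (intro psubset_card_mono) auto
      ultimately show False by simp
    next
      case False
      have "\<rho> \<in> C" if "\<rho> \<subseteq> insert k U" "card \<rho> = m" for \<rho>
        by (rule clique_extend[OF ext _ finU \<sigma> k(2) False m that]) (use U(1) in \<open>auto simp: Q_def\<close>)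
      moreover have "k \<in> {1..n}" using k(1) circuits[OF \<tau>] by blast
      ultimately have "Q (insert k U)"
        using U(1) \<sigma> unfolding Q_def by blast
      then have "card (insert k U) \<le> card U" by (rule U(2))
      then show False using False finU by simp
    qed
  qed
  have "{1..n} \<subseteq> U" using cover sub by blast
  then show ?thesis using \<rho> U(1) by (auto simp: Q_def)
qed

end

section \<open>The equivalence\<close>

lemma det_facet_ideal_resolution:
  assumes "\<forall>\<sigma>\<in>C. \<sigma> \<subseteq> {1..n} \<and> card \<sigma> = m"
  shows "\<exists>F. graded_free_resolution m n (det_facet_ideal m n C :: 'k::field mpol set) F"
proof -
  have polys: "maximal_minor m ` C \<subseteq> (polys m n :: 'k mpol set)"
    using circuit_minor_polys[OF assms] by blast
  have "graded_submodule m n {0::nat} (\<lambda>_. 0) (single 0 ` (det_facet_ideal m n C :: 'k mpol set))"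
    unfolding det_facet_ideal_def single_ideal[OF polys, where g = "\<lambda>_. m"]
    by (rule graded_submodule_image) (rule minor_map_graded[OF assms])
  then show ?thesis
    by (rule exists_graded_free_resolution) blast
qed

lemma det_facet_ideal_generated:
  assumes "\<forall>\<sigma>\<in>C. \<sigma> \<subseteq> {1..n} \<and> card \<sigma> = m"
  shows "generated_in_degree m n m (det_facet_ideal m n C :: 'k::field mpol set)"
  unfolding generated_in_degree_def det_facet_ideal_def
  using circuit_minor_polys[OF assms] circuit_minor_homogeneous[OF assms]
  by (intro exI[of _ "maximal_minor m ` C"]) auto

theorem theorem5p1:
  fixes m n :: nat and C :: "nat set set" and J :: "'k::field mpol set"
  assumes "m \<ge> 1" and "n \<ge> 1"
    and "clutter n C" and "uniform m C"
    and "J = det_facet_ideal m n C"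
  shows "(has_linear_resolution m n J \<longleftrightarrow> linearly_presented m n J) \<and>
         (linearly_presented m n J \<longleftrightarrow> complete_clutter m n C)"
proof -
  have circuits: "\<forall>\<sigma>\<in>C. \<sigma> \<subseteq> {1..n} \<and> card \<sigma> = m"
    using assms(3,4) by (auto simp: clutter_def uniform_def)
  have cover: "\<exists>\<tau>\<in>C. v \<in> \<tau>" if "v \<in> {1..n}" for v
    using assms(3) that by (auto simp: clutter_def)
  have C0: "C \<noteq> {}" using cover[of 1] assms(2) by auto
  have polys: "maximal_minor m ` C \<subseteq> (polys m n :: 'k mpol set)"
    using circuit_minor_polys[OF circuits] by blast
  \<comment> \<open>the resolution through which the Betti numbers are defined\<close>
  define F where "F = (SOME F. graded_free_resolution m n J F)"
  have F: "graded_free_resolution m n J F"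
    unfolding F_def assms(5) by (rule someI_ex[OF det_facet_ideal_resolution[OF circuits]])
  have betti: "betti m n J i j = tor_dim F i j" for i j
    by (simp add: betti_def F_def)
  have gen: "generated_in_degree m n m J"
    unfolding assms(5) by (rule det_facet_ideal_generated[OF circuits])
  have "has_linear_resolution m n J \<Longrightarrow> linearly_presented m n J"
    unfolding has_linear_resolution_def linearly_presented_def by (metis add.commute)
  moreover have "complete_clutter m n C" if lp: "linearly_presented m n J"
  proof -
    obtain d where d: "generated_in_degree m n d J" "\<And>j. j \<noteq> d + 1 \<Longrightarrow> betti m n J 1 j = 0"
      using lp unfolding linearly_presented_def by blast
    obtain \<sigma> where \<sigma>: "\<sigma> \<in> C" using C0 by blast
    have "(maximal_minor m \<sigma> :: 'k mpol) \<in> J"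
    proof -
      interpret R: cring "poly_ring m n :: 'k mpol ring" by (rule cring_poly_ring)
      show ?thesis unfolding assms(5) det_facet_ideal_def using R.genideal_self[OF polys] \<sigma> by blast
    qed
    moreover have "(maximal_minor m \<sigma> :: 'k mpol) \<noteq> 0"
      using circuit_minor_nonzero[OF circuits \<sigma>, where 'k = 'k] by auto
    ultimately have "J \<noteq> {0}" by blast
    then have "d = m" by (rule generated_in_degree_unique[OF d(1) gen])
    then have lin: "tor_dim F 1 j = 0" if "j \<noteq> m + 1" for j
      using d(2)[of j] that by (simp add: betti)
    have "\<rho> \<in> C" if "\<rho> \<subseteq> {1..n}" "card \<rho> = m" for \<rho>
      by (rule all_subsets_circuits[OF circuits
            good_vertex_towards[OF circuits F assms(5) lin] cover C0 assms(1) that])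
    then have "C = {\<tau>. \<tau> \<subseteq> {1..n} \<and> card \<tau> = m}"
      using circuits by blast
    then show ?thesis
      unfolding complete_clutter_iff[OF assms(1,3,4)] .
  qed
  moreover have "has_linear_resolution m n J" if cc: "complete_clutter m n C"
  proof -
    have C: "C = {\<tau>. \<tau> \<subseteq> {1..n} \<and> card \<tau> = m}"
      using cc unfolding complete_clutter_iff[OF assms(1,3,4)] .
    \<comment> \<open>the circuits are the column sets of the staircases at level \<open>1\<close>\<close>
    let ?f = "\<lambda>(ss, js). minor m js :: 'k mpol"
    have gens: "(maximal_minor m ` C :: 'k mpol set) = ?f ` staircases m n m"
    proof (intro equalityI subsetI)
      fix p :: "'k mpol" assume "p \<in> maximal_minor m ` C"
      then obtain \<tau> where \<tau>: "\<tau> \<subseteq> {1..n}" "card \<tau> = m" "p = (maximal_minor m \<tau> :: 'k mpol)"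
        unfolding C by blast
      have fin: "finite \<tau>" using \<tau>(1) finite_subset by blast
      let ?js = "sorted_list_of_set \<tau>"
      have "([1..<Suc m], ?js) \<in> staircases m n m"
        using \<tau> fin by (auto simp: staircases_def simp del: upt_Suc)
      moreover have "p = minor m ?js"
        using maximal_minor_eq[of ?js m] \<tau>(3) fin by simp
      ultimately show "p \<in> ?f ` staircases m n m"
        by (intro image_eqI[of _ _ "([1..<Suc m], ?js)"]) simp_all
    next
      fix p :: "'k mpol" assume "p \<in> ?f ` staircases m n m"
      then obtain x where x: "x \<in> staircases m n m" "p = ?f x" by blast
      obtain ss js where "x = (ss, js)" by (cases x)
      with x have s: "(ss, js) \<in> staircases m n m" "p = minor m js" by simp_all
      note std = staircaseD[OF s(1)]
      have "set js \<in> C"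
        unfolding C using std by (auto simp: strict_sorted_iff distinct_card)
      moreover have "p = maximal_minor m (set js)"
        by (simp add: maximal_minor_eq[OF std(2)] s(2))
      ultimately show "p \<in> maximal_minor m ` C" by blast
    qed
    have JP: "J \<subseteq> polys m n"
      unfolding assms(5) det_facet_ideal_def by (rule ideal_subset_polys[OF polys])
    have bd0: "en_bd m 0 = (\<lambda>b. single ([], []) (?f b))"
      by auto
    have im: "lin_ext (en_bd m 0) ` gpart m n (en_gens m n (Suc 0)) (en_deg m (Suc 0)) UNIV = single ([], []) ` J"
      unfolding assms(5) det_facet_ideal_def gens bd0
      using single_ideal[of ?f "staircases m n m" m n "([], []) :: staircase" "en_deg m (Suc 0)"] polys gens by simp
    have "tor_dim F i j = 0" if "j \<noteq> i + m" for i j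
      by (rule tor_dim_zero_of_linear_complex[OF F JP en_acyclic _ _ im _ that]) simp_all
    then show ?thesis
      unfolding has_linear_resolution_def betti using gen by blast
  qed
  ultimately show ?thesis by blast
qed

end
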